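(* Assume hypothesis $\hat C$ (stated in full in the context: the conjunction of the Riemann hypothesis RH and the conjectures C1, C3, C4, for some $\alpha\in(0,\tfrac12)$). Then $\Delta(s)\to0$ uniformly as $|\operatorname{Im}(s)|\to\infty$ on the strip $\{s\in\mathbb{C}:|\operatorname{Re}(s)|<\tfrac12\}$.
   Context: Notation. $\zeta$ is the Riemann zeta-function; $a(s)=\pi^{-s/2}s\,\Gamma(s/2)(s-1)$; $\xi(s)=\tfrac12a(s)\zeta(s)$ (entire); $n(s)=\sin(\pi s/4)\cdot2\xi(\tfrac12+s)$ (entire); $f(s)=1/n(s)$ (meromorphic). $c(z)=1/n'(z)$ whenever $n'(z)\ne0$ (this holds at every $z=4w$, $w\in\mathbb{Z}$). $Z_i$ is the set of nonreal zeros of $\zeta(\tfrac12+s)$, and $Z^\circ=4\mathbb{Z}\cup Z_i$. Zeta ordinates. $\gamma_1<\gamma_2<\cdots$ enumerate the distinct imaginary parts of the zeros of $\zeta$ with positive imaginary part; $\gamma_{-n}=-\gamma_n$ for $n\ge1$. For a nonzero integer $k$, $\delta_k$ is the smaller of the distances from $\gamma_k$ to its two neighbours in the ordered set $\{\gamma_j: j\in\mathbb{Z}\setminus\{0\}\}$, and $\delta_k'=\min\{1/\log|\gamma_k|,\delta_k\}$. Partial fractions. $p(s)=p_r(s)+p_i(s)$ with $p_r(s)=\frac{c(0)}{s}+\sum_{w\ge1}c(4w)\big(\frac1{s-4w}+\frac1{s+4w}\big)$ and $p_i(s)=\sum_{k\ge1}c(i\gamma_k)\big(\frac1{s-i\gamma_k}+\frac1{s+i\gamma_k}\big)$.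 Under $\hat C$ all nonreal zeros of $\zeta$ are simple, $\sum_{k\ge 1}|c(i\gamma_k)|<\infty$, and $f-p$ extends analytically from $\mathbb{C}\setminus Z^\circ$ to an entire function, denoted $\Delta$. Hypothesis $\hat C$: there is $\alpha$ with $0<\alpha<\tfrac12$ such that all of the following hold. (RH) Every nonreal zero of $\zeta$ has real part $\tfrac12$. (C1) For $t>t(1):=\gamma_1-\alpha\delta_1'$ let $s(t,\alpha)=x(t,\alpha)+it$, where $x(t,\alpha)=\sqrt{(\alpha\delta_k')^2-(t-\gamma_k)^2}$ if $|t-\gamma_k|\le\alpha\delta_k'$ for some $k\ge1$, and $x(t,\alpha)=0$ otherwise. (i) There exist $\varepsilon>0,\lambda>0$ with $|\zeta(\tfrac12+s(t,\alpha))|>\lambda t^{-\varepsilon}$ for all $t>t(1)$; let $\varepsilon_0$ be the infimum of such $\varepsilon$. (ii) $\varepsilon_0<3/4$. (C3) (i′) There is a real $\varepsilon\ge0$ such that for any $\sigma>0$ there is $K>0$ with $|\zeta'(\tfrac12+i\gamma_k)|>K\gamma_k^{-(\varepsilon+\sigma)}$ for all $k\ge1$; let $\varepsilon_1$ be the least such $\varepsilon$. (i) There is $\varepsilon\ge0$ such that for any $\sigma>0$ there is $K>0$ with $\delta_k>K\gamma_k^{-(\varepsilon+\sigma)}$ for all $k\ge1$; let $\varepsilon_2$ be the least such $\varepsilon$. (ii) $\varepsilon_1+\varepsilon_2<3/4$. (C4) Let $j_k(\alpha)=\min\{|\zeta(\tfrac12+it)/(t-\gamma_k)|: t\in\mathbb{R},\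 |t-\gamma_k|\le\alpha\delta_k'\}$, where at $t=\gamma_k$ the quotient is read as $\zeta'(\tfrac12+i\gamma_k)$. (i) There is $\varepsilon\ge0$ such that for any $\sigma>0$ there is $K>0$ with $j_k(\alpha)>K\gamma_k^{-(\varepsilon+\sigma)}$ for all $k\ge1$; let $\tilde\varepsilon_1$ be the least such $\varepsilon$. (ii) $\tilde\varepsilon_1+\varepsilon_2\le1$. "$g(s)\to0$ uniformly as $|\operatorname{Im}(s)|\to\infty$ on $D$" means: for every $\varepsilon>0$ there is $R$ with $|g(s)|<\varepsilon$ for all $s\in D$ with $|\operatorname{Im}(s)|\ge R$. *)

theory Defs
  imports "HOL-Complex_Analysis.Complex_Analysis"
begin

section \<open>The Riemann zeta function and the functions built from it\<close>

text \<open>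
  The analytic continuation of the Dirichlet series to the complex plane without the point 1.
  The value at the pole is irrelevant below; it is fixed only to make the description unique.
\<close>
definition zeta :: "complex \<Rightarrow> complex" where
  "zeta = (THE g. g holomorphic_on (- {1}) \<and>
                  (\<forall>s. Re s > 1 \<longrightarrow> g s = (\<Sum>n. 1 / of_nat (Suc n) powr s)) \<and>
                  g 1 = 0)"

definition a_fun :: "complex \<Rightarrow> complex" where
  "a_fun s = of_real pi powr (- s / 2) * s * Gamma (s / 2) * (s - 1)"

text \<open>
  The product has removable singularities at 1 and at the nonpositive even integers, where
  HOL assigns default values to its factors; \<^const>\<open>remove_sings\<close> fills in
  the limits, which gives the entire function.
\<close>
definition xi :: "complex \<Rightarrow> complex" where
  "xi = remove_sings (\<lambda>s. 1 / 2 * a_fun s * zeta s)"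

definition n_fun :: "complex \<Rightarrow> complex" where
  "n_fun s = sin (of_real pi * s / 4) * (2 * xi (1 / 2 + s))"

definition f_fun :: "complex \<Rightarrow> complex" where
  "f_fun s = 1 / n_fun s"

definition c_coeff :: "complex \<Rightarrow> complex" where
  "c_coeff z = 1 / deriv n_fun z"

definition Z_i :: "complex set" where
  "Z_i = {s. s \<notin> \<real> \<and> zeta (1 / 2 + s) = 0}"

definition Z_circ :: "complex set" where
  "Z_circ = {4 * of_int w |w. True} \<union> Z_i"


section \<open>Ordinates of the zeros\<close>

definition pos_ordinates :: "real set" where
  "pos_ordinates = {Im z |z. zeta z = 0 \<and> Im z > 0}"

text \<open>
  The set of positive ordinates is infinite and has finitely many elements below any bound, so
  it is enumerated by passing repeatedly to the next larger element. The value at index 0 is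
  only the starting point of the recursion.
\<close>
primrec nth_ordinate :: "nat \<Rightarrow> real" where
  "nth_ordinate 0 = 0"
| "nth_ordinate (Suc n) = (LEAST t. t \<in> pos_ordinates \<and> nth_ordinate n < t)"

definition \<gamma> :: "int \<Rightarrow> real" where
  "\<gamma> k = (if k \<ge> 0 then nth_ordinate (nat k) else - nth_ordinate (nat (- k)))"

text \<open>Neighbouring indices in the nonzero integers: the index 0 is skipped.\<close>
definition next_index :: "int \<Rightarrow> int" where
  "next_index k = (if k = -1 then 1 else k + 1)"

definition prev_index :: "int \<Rightarrow> int" where
  "prev_index k = (if k = 1 then -1 else k - 1)"

definition \<delta> :: "int \<Rightarrow> real" where
  "\<delta> k = min \<bar>\<gamma> k - \<gamma> (prev_index k)\<bar> \<bar>\<gamma> (next_index k) - \<gamma> k\<bar>"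

definition \<delta>' :: "int \<Rightarrow> real" where
  "\<delta>' k = min (1 / ln \<bar>\<gamma> k\<bar>) (\<delta> k)"


section \<open>Partial fractions\<close>

definition p_r :: "complex \<Rightarrow> complex" where
  "p_r s = c_coeff 0 / s +
     (\<Sum>m. let w = 4 * of_nat (Suc m) in c_coeff w * (1 / (s - w) + 1 / (s + w)))"

definition p_i :: "complex \<Rightarrow> complex" where
  "p_i s =
     (\<Sum>m. let z = \<i> * of_real (\<gamma> (int (Suc m))) in c_coeff z * (1 / (s - z) + 1 / (s + z)))"

definition p_fun :: "complex \<Rightarrow> complex" where
  "p_fun s = p_r s + p_i s"

text \<open>
  The extension of the difference across the isolated points of \<^term>\<open>Z_circ\<close> is given by
  its limits there.
\<close>
definition \<Delta> :: "complex \<Rightarrow> complex" where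
  "\<Delta> s = (if s \<in> Z_circ then Lim (at s) (\<lambda>z. f_fun z - p_fun z) else f_fun s - p_fun s)"


section \<open>The hypotheses\<close>

definition RH :: bool where
  "RH \<longleftrightarrow> (\<forall>s. zeta s = 0 \<and> Im s \<noteq> 0 \<longrightarrow> Re s = 1 / 2)"

definition t1 :: "real \<Rightarrow> real" where
  "t1 \<alpha> = \<gamma> 1 - \<alpha> * \<delta>' 1"

text \<open>
  For \<open>\<alpha> < 1/2\<close> the intervals of radius \<open>\<alpha> * \<delta>' k\<close> around the ordinates
  are disjoint, so the index is unique.
\<close>
definition x_path :: "real \<Rightarrow> real \<Rightarrow> real" where
  "x_path \<alpha> t =
     (if \<exists>k\<ge>1. \<bar>t - \<gamma> k\<bar> \<le> \<alpha> * \<delta>' k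
      then let k = (THE k. k \<ge> 1 \<and> \<bar>t - \<gamma> k\<bar> \<le> \<alpha> * \<delta>' k)
           in sqrt ((\<alpha> * \<delta>' k)\<^sup>2 - (t - \<gamma> k)\<^sup>2)
      else 0)"

definition s_path :: "real \<Rightarrow> real \<Rightarrow> complex" where
  "s_path \<alpha> t = Complex (x_path \<alpha> t) t"

definition C1_exponents :: "real \<Rightarrow> real set" where
  "C1_exponents \<alpha> =
     {\<epsilon>. \<epsilon> > 0 \<and> (\<exists>c>0. \<forall>t>t1 \<alpha>. cmod (zeta (1 / 2 + s_path \<alpha> t)) > c * t powr (- \<epsilon>))}"

definition C1 :: "real \<Rightarrow> bool" where
  "C1 \<alpha> \<longleftrightarrow> C1_exponents \<alpha> \<noteq> {} \<and> Inf (C1_exponents \<alpha>) < 3 / 4"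

text \<open>The exponents admissible in a lower bound for \<open>q k\<close> by powers of the ordinates.\<close>
definition lower_exponents :: "(int \<Rightarrow> real) \<Rightarrow> real set" where
  "lower_exponents q =
     {\<epsilon>. \<epsilon> \<ge> 0 \<and> (\<forall>\<sigma>>0. \<exists>K>0. \<forall>k\<ge>1. q k > K * \<gamma> k powr (- (\<epsilon> + \<sigma>)))}"

definition least_exponent :: "(int \<Rightarrow> real) \<Rightarrow> real" where
  "least_exponent q = (LEAST \<epsilon>. \<epsilon> \<in> lower_exponents q)"

definition zeta'_abs :: "int \<Rightarrow> real" where
  "zeta'_abs k = cmod (deriv zeta (1 / 2 + \<i> * of_real (\<gamma> k)))"

definition C3 :: bool where
  "C3 \<longleftrightarrow> lower_exponents zeta'_abs \<noteq> {} \<and> lower_exponents \<delta> \<noteq> {} \<and>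
          least_exponent zeta'_abs + least_exponent \<delta> < 3 / 4"

text \<open>The infimum is a minimum, since the quotient is continuous on a compact interval.\<close>
definition j_min :: "real \<Rightarrow> int \<Rightarrow> real" where
  "j_min \<alpha> k =
     (INF t\<in>{t. \<bar>t - \<gamma> k\<bar> \<le> \<alpha> * \<delta>' k}.
        if t = \<gamma> k then zeta'_abs k
        else cmod (zeta (1 / 2 + \<i> * of_real t) / of_real (t - \<gamma> k)))"

definition C4 :: "real \<Rightarrow> bool" where
  "C4 \<alpha> \<longleftrightarrow> lower_exponents (j_min \<alpha>) \<noteq> {} \<and>
            least_exponent (j_min \<alpha>) + least_exponent \<delta> \<le> 1"

definition hypothesis_C_hat :: bool where
  "hypothesis_C_hat \<longleftrightarrow> (\<exists>\<alpha>. 0 < \<alpha> \<and> \<alpha> < 1 / 2 \<and> RH \<and> C1 \<alpha> \<and> C3 \<and> C4 \<alpha>)"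

definition tends_to_0_uniformly_Im :: "(complex \<Rightarrow> complex) \<Rightarrow> complex set \<Rightarrow> bool" where
  "tends_to_0_uniformly_Im g D \<longleftrightarrow>
     (\<forall>\<epsilon>>0. \<exists>R. \<forall>s\<in>D. \<bar>Im s\<bar> \<ge> R \<longrightarrow> cmod (g s) < \<epsilon>)"

end

(*
  By the lower bounds on zeta along the path and by the growth of the Gamma factors, s f(s) is
  bounded on the boundary of the half strip 0 < Re s < 2 with small half discs about the zeros
  removed. Under RH a logarithm of n exists inside the half strip, and the Borel-Caratheodory
  inequality bounds |f| by exp (C t^2) on the horizontal segments that start on top of the discs;
  hence the Phragmen-Lindelof principle applies and f = O(1/|s|) outside the discs. The reflection
  formula carries the bound over to the other quadrants. The spacing of the ordinates replaces a
  zero counting function: it makes the sum of the residues converge absolutely and keeps p_i small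
  outside the discs. Inside a disc Delta is holomorphic and is controlled by the maximum modulus
  principle.

  Everything about zeta is derived from theta(1/x) = sqrt x theta(x), which gives the entire
  function xi as a Laplace integral together with its functional equation and its order of growth.
  There are infinitely many ordinates, because an entire function of order less than 2 with finitely
  many zeros is a polynomial times exp (a + b s), while xi decays in both directions on a vertical
  line.
*)
theory Submission
  imports Defs "HOL-Probability.Characteristic_Functions" "HOL-Probability.Sinc_Integral"
    "HOL-Real_Asymp.Real_Asymp"
begin

section \<open>The transformation formula of the theta function\<close>

text \<open>The exponent 3/4 in C1 and C3 has one source. For 0 <= Re s <= 2 the decay exp (- pi t /
  4) of the Gamma factor is cancelled by the growth of sin (pi s / 4), and what multiplies zeta (1/2
  + s) in n has size at least c t^(7/4). Hence |zeta| > l t^-eps with eps < 3/4 gives |n| >= c' t on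
  the path, which is the decay claimed for f. In the same way a residue is O(t^(a - 7/4)); once a
  factor t^-b has been paid for by a gap between ordinates, an exponent below -1 is left as soon as
  a + b < 3/4. The obstacle is that near the imaginary axis f is controlled a priori on the path
  only. Borel-Caratheodory on discs tangent to the axis costs exp (M t / Re s), so horizontal edges
  are placed exactly at the heights of ordinates, where the removed disc keeps Re s >= const / t.
  The resulting exp (C t^2) is harmless: the strip has width 2 < pi, so a damping factor of size exp
  (- eta exp t / 2) is available and absorbs it.\<close>

definition dirichlet_kernel :: "nat \<Rightarrow> real \<Rightarrow> real" where
  "dirichlet_kernel N u = 1 + 2 * (\<Sum>k=1..N. cos (2 * pi * real k * u))"

text \<open>Stated as a product, so that the integers, where the sine vanishes, need no separate
  case.\<close>

lemma dirichlet_kernel_mult_sin: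
  "dirichlet_kernel N u * sin (pi * u) = sin ((2 * real N + 1) * pi * u)"
proof (induction N)
  case (Suc N)
  have "dirichlet_kernel (Suc N) u * sin (pi * u) =
      dirichlet_kernel N u * sin (pi * u) + 2 * (cos (2 * pi * real (Suc N) * u) * sin (pi * u))"
    by (simp add: dirichlet_kernel_def algebra_simps)
  also have "2 * (cos (2 * pi * real (Suc N) * u) * sin (pi * u)) =
     sin ((2 * real (Suc N) + 1) * pi * u) - sin ((2 * real N + 1) * pi * u)"
    unfolding cos_times_sin by (simp add: algebra_simps diff_divide_distrib add_divide_distrib)
  finally show ?case using Suc by simp
qed (simp add: dirichlet_kernel_def)

lemma abs_dirichlet_kernel_le: "\<bar>dirichlet_kernel N u\<bar> \<le> 1 + 2 * N"
proof -
  have "\<bar>\<Sum>k=1..N. cos (2 * pi * real k * u)\<bar> \<le> (\<Sum>k=1..N. 1)"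
    by (rule order_trans[OF sum_abs], rule sum_mono) auto
  then show ?thesis unfolding dirichlet_kernel_def by simp
qed

lemma dirichlet_kernel_measurable: "dirichlet_kernel N \<in> borel_measurable borel"
  unfolding dirichlet_kernel_def[abs_def] by measurable

abbreviation unit_lborel :: "real measure" where
  "unit_lborel \<equiv> restrict_space lborel {0..1}"

lemma unit_lborel_FTC:
  fixes f F :: "real \<Rightarrow> real"
  assumes "\<And>x. DERIV F x :> f x" "\<And>x. isCont f x"
  shows "(LINT x|unit_lborel. f x) = F 1 - F 0"
proof -
  have "(LINT x|unit_lborel. f x) = (\<integral>x. f x * indicator {0..1} x \<partial>lborel)"
    by (subst integral_restrict_space) (auto simp: mult.commute)
  also have "\<dots> = F 1 - F 0"
    by (rule integral_FTC_Icc_real) (use assms in auto)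
  finally show ?thesis .
qed

lemma finite_measure_unit_lborel: "finite_measure unit_lborel"
  by (intro finite_measureI) (simp add: emeasure_restrict_space space_restrict_space)

lemma integrable_unit_lborel:
  fixes f :: "real \<Rightarrow> real"
  assumes "f \<in> borel_measurable borel" "\<And>x. 0 \<le> x \<Longrightarrow> x \<le> 1 \<Longrightarrow> \<bar>f x\<bar> \<le> B"
  shows "integrable unit_lborel f"
proof (rule finite_measure.integrable_const_bound[OF finite_measure_unit_lborel])
  show "AE x in unit_lborel. norm (f x) \<le> B"
    using assms(2) by (intro AE_I2) (auto simp: space_restrict_space)
  show "f \<in> borel_measurable unit_lborel"
    using assms(1) by (intro measurable_restrict_space1) simp
qed

lemma integral_cos_period:
  assumes "k \<noteq> (0::int)"
  shows "(LINT u|unit_lborel. cos (2 * pi * real_of_int k * u)) = 0"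
proof -
  have "(LINT u|unit_lborel. cos (2 * pi * real_of_int k * u))
     = sin (2 * pi * real_of_int k * 1) / (2 * pi * real_of_int k) - sin (2 * pi * real_of_int k * 0) / (2 * pi * real_of_int k)"
    by (rule unit_lborel_FTC) (use assms in \<open>auto intro!: derivative_eq_intros continuous_intros\<close>)
  also have "sin (2 * pi * real_of_int k * 1) = 0"
    using sin_int_2pin[of k] by (simp add: mult_ac)
  finally show ?thesis by simp
qed

lemma integral_mult_cos_period:
  assumes "k > (0::nat)"
  shows "(LINT u|unit_lborel. u * cos (2 * pi * real k * u)) = 0"
proof -
  let ?c = "2 * pi * real k"
  have c: "?c \<noteq> 0" using assms by auto
  have "(LINT u|unit_lborel. u * cos (?c * u))
     = (1 * sin (?c * 1) / ?c + cos (?c * 1) / ?c^2) - (0 * sin (?c * 0) / ?c + cos (?c * 0) / ?c^2)"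
  proof (rule unit_lborel_FTC)
    fix x
    have lin: "((\<lambda>u. ?c * u) has_real_derivative ?c) (at x)" by (auto intro!: derivative_eq_intros)
    have "((\<lambda>u. u * sin (?c * u) / ?c + cos (?c * u) / ?c^2) has_real_derivative
       (1 * sin (?c * x) + (cos (?c * x) * ?c) * x) / ?c + (- sin (?c * x) * ?c) / ?c^2) (at x)"
      by (intro DERIV_add DERIV_cdivide DERIV_mult DERIV_ident DERIV_chain2[OF DERIV_sin lin] DERIV_chain2[OF DERIV_cos lin])
    moreover have "(1 * sin (?c * x) + (cos (?c * x) * ?c) * x) / ?c + (- sin (?c * x) * ?c) / ?c^2 = x * cos (?c * x)"
    proof -
      have "(1 * s + (d * c) * x) / c + (- s * c) / c^2 = x * d" if "c \<noteq> 0" for s d c :: real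
        using that by (simp add: power2_eq_square add_divide_distrib)
      then show ?thesis using c by blast
    qed
    ultimately show "((\<lambda>u. u * sin (?c * u) / ?c + cos (?c * u) / ?c^2) has_real_derivative x * cos (?c * x)) (at x)"
      by metis
  qed (auto intro!: continuous_intros)
  moreover have "sin (?c * 1) = 0" "cos (?c * 1) = 1"
    using sin_int_2pin[of "int k"] cos_int_2pin[of "int k"] by (simp_all add: mult_ac)
  ultimately show ?thesis by simp
qed

text \<open>The first moment is needed because the kernel will be applied to a function with
  different values at 0 and 1, from which a linear interpolation is split off.\<close>

lemma integral_dirichlet_kernel:
  "(LINT u|unit_lborel. dirichlet_kernel N u) = 1"
  "(LINT u|unit_lborel. u * dirichlet_kernel N u) = 1 / 2"
proof -
  have i: "integrable unit_lborel (\<lambda>u. cos (2 * pi * real k * u))" for k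
    by (rule integrable_unit_lborel[where B = 1]) auto
  have i2: "integrable unit_lborel (\<lambda>u. u * cos (2 * pi * real k * u))" for k
    by (rule integrable_unit_lborel[where B = 1]) (auto simp: abs_mult intro!: mult_le_one)
  have i3: "integrable unit_lborel (\<lambda>u. u)" "integrable unit_lborel (\<lambda>u. 1::real)"
    by (rule integrable_unit_lborel[where B = 1]; auto)+
  have z: "(LINT u|unit_lborel. cos (2 * pi * real k * u)) = 0" if "k \<in> {1..N}" for k
    using integral_cos_period[of "int k"] that by simp
  have 1: "(LINT u|unit_lborel. 1) = (1::real)" using unit_lborel_FTC[of "\<lambda>x. x" "\<lambda>_. 1"] by simp
  have 2: "(LINT u|unit_lborel. u) = (1/2::real)"
  proof -
    have "(LINT u|unit_lborel. u) = 1\<^sup>2 / 2 - 0\<^sup>2 / (2::real)"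
      by (rule unit_lborel_FTC) (auto intro!: derivative_eq_intros)
    then show ?thesis by simp
  qed
  have "(LINT u|unit_lborel. dirichlet_kernel N u) = (LINT u|unit_lborel. 1 + 2 * (\<Sum>k=1..N. cos (2 * pi * real k * u)))"
    by (simp add: dirichlet_kernel_def)
  also have "\<dots> = (LINT u|unit_lborel. 1) + 2 * (\<Sum>k=1..N. LINT u|unit_lborel. cos (2 * pi * real k * u))"
    using i i3 by (subst Bochner_Integration.integral_add) auto
  finally show "(LINT u|unit_lborel. dirichlet_kernel N u) = 1" using z 1 by simp
  have "(LINT u|unit_lborel. u * dirichlet_kernel N u) = (LINT u|unit_lborel. u + 2 * (\<Sum>k=1..N. u * cos (2 * pi * real k * u)))"
    by (simp add: dirichlet_kernel_def algebra_simps sum_distrib_left)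
  also have "\<dots> = (LINT u|unit_lborel. u) + 2 * (\<Sum>k=1..N. LINT u|unit_lborel. u * cos (2 * pi * real k * u))"
    using i2 i3 by (subst Bochner_Integration.integral_add) auto
  finally show "(LINT u|unit_lborel. u * dirichlet_kernel N u) = 1 / 2" using integral_mult_cos_period 2 by simp
qed

lemma integral_sin_odd_orthogonal:
  "(LINT u|unit_lborel. sin ((2 * real i + 1) * pi * u) * sin ((2 * real j + 1) * pi * u)) = (if i = j then 1/2 else 0)"
proof -
  have i: "integrable unit_lborel (\<lambda>u. cos (2 * pi * real_of_int k * u))" for k
    by (rule integrable_unit_lborel[where B = 1]) auto
  have "sin ((2 * real i + 1) * pi * u) * sin ((2 * real j + 1) * pi * u)
     = (cos (2 * pi * real_of_int (int i - int j) * u) - cos (2 * pi * real_of_int (int i + int j + 1) * u)) / 2" for u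
    unfolding sin_times_sin by (simp add: algebra_simps)
  then have "(LINT u|unit_lborel. sin ((2 * real i + 1) * pi * u) * sin ((2 * real j + 1) * pi * u))
    = ((LINT u|unit_lborel. cos (2 * pi * real_of_int (int i - int j) * u)) - (LINT u|unit_lborel. cos (2 * pi * real_of_int (int i + int j + 1) * u))) / 2"
    by (simp only: Bochner_Integration.integral_diff[OF i i] integral_divide_zero)
  also have "(LINT u|unit_lborel. cos (2 * pi * real_of_int (int i + int j + 1) * u)) = 0"
    by (rule integral_cos_period) auto
  also have "(LINT u|unit_lborel. cos (2 * pi * real_of_int (int i - int j) * u)) = (if i = j then 1 else 0)"
    using integral_cos_period[of "int i - int j"] unit_lborel_FTC[of "\<lambda>x. x" "\<lambda>_. 1"] by auto
  finally show ?thesis by (cases "i = j") simp_all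
qed

text \<open>Bessel's inequality: the coefficients with respect to an orthogonal system are square
  summable, hence tend to 0. Boundedness and measurability of \<open>K\<close> are enough, no
  approximation by smooth functions is made.\<close>

lemma riemann_lebesgue_sin_odd:
  fixes K :: "real \<Rightarrow> real"
  assumes K: "K \<in> borel_measurable borel" "\<And>x. \<bar>K x\<bar> \<le> B"
  shows "(\<lambda>N. LINT u|unit_lborel. K u * sin ((2 * real N + 1) * pi * u)) \<longlonglongrightarrow> 0"
proof -
  define \<phi> where "\<phi> N u = sin ((2 * real N + 1) * pi * u)" for N u
  define c where "c N = (LINT u|unit_lborel. K u * \<phi> N u)" for N
  \<comment> \<open>The remainder after projection onto the first N sines; the factor 2 is the
    inverse of their squared norm 1/2.\<close>
  define r where "r N u = K u - 2 * (\<Sum>j<N. c j * \<phi> j u)" for N u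
  have \<phi>: "\<phi> N \<in> borel_measurable borel" "\<bar>\<phi> N x\<bar> \<le> 1" for N x
    by (auto simp: \<phi>_def[abs_def])
  have r: "r N \<in> borel_measurable borel" for N
    unfolding r_def using K(1) \<phi>(1) by (intro borel_measurable_diff borel_measurable_times borel_measurable_sum) auto
  have rb: "\<exists>D. \<forall>x. \<bar>r N x\<bar> \<le> D" for N
  proof (intro exI allI)
    fix x
    have "\<bar>r N x\<bar> \<le> \<bar>K x\<bar> + 2 * \<bar>\<Sum>j<N. c j * \<phi> j x\<bar>" unfolding r_def by linarith
    also have "\<bar>\<Sum>j<N. c j * \<phi> j x\<bar> \<le> (\<Sum>j<N. \<bar>c j\<bar>)"
      by (rule order_trans[OF sum_abs], rule sum_mono) (use \<phi> in \<open>auto simp: abs_mult intro: mult_left_le\<close>)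
    finally show "\<bar>r N x\<bar> \<le> B + 2 * (\<Sum>j<N. \<bar>c j\<bar>)" using K(2)[of x] by linarith
  qed
  have int: "integrable unit_lborel (\<lambda>u. f u * g u)"
    if "f \<in> borel_measurable borel" "g \<in> borel_measurable borel" "\<forall>x. \<bar>f x\<bar> \<le> D" "\<forall>x. \<bar>g x\<bar> \<le> E" for f g :: "real \<Rightarrow> real" and D E
    by (rule integrable_unit_lborel[where B = "D * E"])
      (use that in \<open>auto simp: abs_mult intro!: mult_mono intro: order_trans[OF abs_ge_zero]\<close>)
  have rr: "integrable unit_lborel (\<lambda>u. r N u * r N u)" for N using rb[of N] int r by blast
  have r\<phi>: "integrable unit_lborel (\<lambda>u. r N u * \<phi> j u)" for N j using rb[of N] int r \<phi> by blast
  have \<phi>\<phi>: "integrable unit_lborel (\<lambda>u. \<phi> N u * \<phi> j u)" for N j using int \<phi> by blast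
  have K\<phi>: "integrable unit_lborel (\<lambda>u. K u * \<phi> j u)" for j using int \<phi> K by blast
  have orth: "(LINT u|unit_lborel. r N u * \<phi> N u) = c N" for N
  proof -
    have "(LINT u|unit_lborel. r N u * \<phi> N u) = (LINT u|unit_lborel. K u * \<phi> N u - 2 * (\<Sum>j<N. c j * (\<phi> j u * \<phi> N u)))"
      by (intro Bochner_Integration.integral_cong) (auto simp: r_def left_diff_distrib sum_distrib_left sum_distrib_right right_diff_distrib mult_ac)
    also have "\<dots> = c N - 2 * (\<Sum>j<N. c j * (LINT u|unit_lborel. \<phi> j u * \<phi> N u))"
      using K\<phi> \<phi>\<phi> by (subst Bochner_Integration.integral_diff) (auto simp: c_def)
    also have "(\<Sum>j<N. c j * (LINT u|unit_lborel. \<phi> j u * \<phi> N u)) = 0"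
      unfolding \<phi>_def by (intro sum.neutral) (auto simp: integral_sin_odd_orthogonal)
    finally show ?thesis by simp
  qed
  have bessel: "(LINT u|unit_lborel. r N u * r N u) = (LINT u|unit_lborel. K u * K u) - (\<Sum>j<N. 2 * (c j)\<^sup>2)" for N
  proof (induction N)
    case (Suc N)
    have "(LINT u|unit_lborel. r (Suc N) u * r (Suc N) u)
       = (LINT u|unit_lborel. r N u * r N u - 4 * c N * (r N u * \<phi> N u) + 4 * (c N)\<^sup>2 * (\<phi> N u * \<phi> N u))"
      by (intro Bochner_Integration.integral_cong) (auto simp: r_def power2_eq_square algebra_simps)
    also have "\<dots> = (LINT u|unit_lborel. r N u * r N u) - 4 * c N * (LINT u|unit_lborel. r N u * \<phi> N u) + 4 * (c N)\<^sup>2 * (LINT u|unit_lborel. \<phi> N u * \<phi> N u)"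
      using rr r\<phi> \<phi>\<phi> by (subst Bochner_Integration.integral_add Bochner_Integration.integral_diff, simp, simp)+ simp
    also have "(LINT u|unit_lborel. \<phi> N u * \<phi> N u) = 1/2"
      unfolding \<phi>_def by (simp add: integral_sin_odd_orthogonal)
    finally show ?case using Suc by (simp add: orth power2_eq_square)
  qed (simp add: r_def)
  have "(\<Sum>j<N. 2 * (c j)\<^sup>2) \<le> (LINT u|unit_lborel. K u * K u)" for N
  proof -
    have "(LINT u|unit_lborel. r N u * r N u) \<ge> 0" by (rule Bochner_Integration.integral_nonneg) auto
    then show ?thesis using bessel[of N] by simp
  qed
  then have "summable (\<lambda>j. 2 * (c j)\<^sup>2)"
    by (intro summableI_nonneg_bounded) auto
  from tendsto_mult[OF tendsto_const[of "1/2"] summable_LIMSEQ_zero[OF this]] have "(\<lambda>j. (c j)\<^sup>2) \<longlonglongrightarrow> 0" by simp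
  then have "(\<lambda>j. \<bar>c j\<bar>) \<longlonglongrightarrow> 0" using tendsto_real_sqrt[of "\<lambda>j. (c j)\<^sup>2" 0] by simp
  then have "c \<longlonglongrightarrow> 0" by (simp add: tendsto_rabs_zero_iff)
  then show ?thesis unfolding c_def \<phi>_def .
qed

text \<open>Concavity puts the sine above its chord on [0, pi/2]; the other half follows by symmetry
  about 1/2.\<close>

lemma sin_pi_lower_bound:
  assumes "0 \<le> u" "u \<le> (1::real)"
  shows "sin (pi * u) \<ge> min u (1 - u) / 2"
proof -
  have main: "sin (pi * v) \<ge> v / 2" if v: "0 \<le> v" "v \<le> 1/2" for v
  proof -
    have c: "concave_on {0..pi} sin"
      by (rule f''_le0_imp_concave[where f' = cos and f'' = "\<lambda>x. - sin x"])
        (auto intro!: derivative_eq_intros sin_ge_zero)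
    have "sin ((1 - 2 * v) *\<^sub>R 0 + (2 * v) *\<^sub>R (pi / 2)) \<ge> (1 - 2 * v) * sin 0 + (2 * v) * sin (pi / 2)"
      by (rule concave_onD[OF c]) (use v in auto)
    then show ?thesis using v by (simp add: mult.commute)
  qed
  show ?thesis
  proof (cases "u \<le> 1/2")
    case True then show ?thesis using main[of u] assms by (simp add: min_def)
  next
    case False
    have "sin (pi * u) = sin (pi * (1 - u))" by (simp add: algebra_simps sin_diff)
    then show ?thesis using main[of "1 - u"] False assms by (simp add: min_def)
  qed
qed

text \<open>After subtraction of the linear interpolation of the end values the Lipschitz function
  vanishes to first order at 0 and at 1, so its quotient by sin (pi u) is bounded and the
  Riemann-Lebesgue lemma applies. The interpolation itself contributes the mean of the end values;
  periodicity is not assumed.\<close>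

lemma dirichlet_kernel_tendsto:
  fixes f :: "real \<Rightarrow> real"
  assumes f: "f \<in> borel_measurable borel"
    and lip: "\<And>x y. x \<in> {0..1} \<Longrightarrow> y \<in> {0..1} \<Longrightarrow> \<bar>f x - f y\<bar> \<le> L * \<bar>x - y\<bar>"
  shows "(\<lambda>N. LINT u|unit_lborel. f u * dirichlet_kernel N u) \<longlonglongrightarrow> (f 0 + f 1) / 2"
proof -
  define E where "E u = f u - ((1 - u) * f 0 + u * f 1)" for u
  \<comment> \<open>At the end points division by zero makes the quotient 0, which is right because
    \<open>E\<close> vanishes there as well. The value 0 outside the interval makes the bound on
    \<open>K\<close> global.\<close>
  define K where "K u = (if u \<in> {0..1} then E u / sin (pi * u) else 0)" for u
  have L: "L \<ge> 0" using lip[of 0 1] by simp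
  have f01: "\<bar>f 1 - f 0\<bar> \<le> L" using lip[of 1 0] by simp
  have E: "\<bar>E u\<bar> \<le> 2 * L * min u (1 - u)" if u: "0 \<le> u" "u \<le> 1" for u
  proof -
    have "E u = (f u - f 0) - u * (f 1 - f 0)" by (simp add: E_def algebra_simps)
    moreover have "\<bar>u * (f 1 - f 0)\<bar> \<le> u * L" using u f01 by (simp add: abs_mult mult_left_mono)
    moreover have "\<bar>f u - f 0\<bar> \<le> u * L" using lip[of u 0] u by (simp add: mult.commute)
    ultimately have "\<bar>E u\<bar> \<le> u * L + u * L" by linarith
    then have 1: "\<bar>E u\<bar> \<le> 2 * L * u" by simp
    have "E u = (f u - f 1) + (1 - u) * (f 1 - f 0)" by (simp add: E_def algebra_simps)
    moreover have "\<bar>(1 - u) * (f 1 - f 0)\<bar> \<le> (1 - u) * L" using u f01 by (simp add: abs_mult mult_left_mono)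
    moreover have "\<bar>f u - f 1\<bar> \<le> (1 - u) * L" using lip[of u 1] u by (simp add: mult.commute abs_minus_commute)
    ultimately have "\<bar>E u\<bar> \<le> (1 - u) * L + (1 - u) * L" by linarith
    then have 2: "\<bar>E u\<bar> \<le> 2 * L * (1 - u)" by simp
    show ?thesis using 1 2 by (simp add: min_def)
  qed
  have Kb: "\<bar>K u\<bar> \<le> 4 * L" for u
  proof (cases "u \<in> {0..1} \<and> sin (pi * u) \<noteq> 0")
    case True
    then have u: "0 \<le> u" "u \<le> 1" by auto
    have s: "sin (pi * u) > 0" using True u sin_ge_zero[of "pi * u"] by (auto simp: mult_left_le)
    have "\<bar>E u\<bar> \<le> 4 * L * sin (pi * u)"
      using E[OF u] mult_left_mono[OF sin_pi_lower_bound[OF u], of "4 * L"] L by simp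
    then show ?thesis using True s by (simp add: K_def abs_divide divide_simps)
  qed (use L in \<open>auto simp: K_def\<close>)
  have Km: "K \<in> borel_measurable borel" unfolding K_def E_def using f by measurable
  have *: "f u * dirichlet_kernel N u = K u * sin ((2 * real N + 1) * pi * u)
      + (f 0 * dirichlet_kernel N u + (f 1 - f 0) * (u * dirichlet_kernel N u))"
    if u: "u \<in> {0..1}" for u N
  proof -
    have "K u * sin ((2 * real N + 1) * pi * u) = E u * dirichlet_kernel N u"
    proof (cases "sin (pi * u) = 0")
      case True
      then have "min u (1 - u) \<le> 0" using sin_pi_lower_bound[of u] u by auto
      then have "2 * L * min u (1 - u) \<le> 2 * L * 0" using L by (intro mult_left_mono) auto
      then have "E u = 0" using E[of u] u by auto
      then show ?thesis by (simp add: K_def)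
    next
      case False then show ?thesis using u by (simp add: K_def dirichlet_kernel_mult_sin[symmetric])
    qed
    then show ?thesis by (simp add: E_def algebra_simps)
  qed
  have eq: "(LINT u|unit_lborel. f u * dirichlet_kernel N u) = (LINT u|unit_lborel. K u * sin ((2 * real N + 1) * pi * u)) + (f 0 + f 1) / 2" for N
  proof -
    have i1: "integrable unit_lborel (\<lambda>u. K u * sin ((2 * real N + 1) * pi * u))"
    proof (rule integrable_unit_lborel[where B = "4 * L"])
      show "\<bar>K x * sin ((2 * real N + 1) * pi * x)\<bar> \<le> 4 * L" for x
        using mult_mono[OF Kb[of x] abs_sin_le_one[of "(2 * real N + 1) * pi * x"]] L by (simp add: abs_mult)
    qed (use Km in measurable)
    have i2: "integrable unit_lborel (dirichlet_kernel N)" by (rule integrable_unit_lborel[OF dirichlet_kernel_measurable abs_dirichlet_kernel_le])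
    have i3: "integrable unit_lborel (\<lambda>u. u * dirichlet_kernel N u)"
    proof (rule integrable_unit_lborel)
      show "\<bar>x * dirichlet_kernel N x\<bar> \<le> 1 * real (1 + 2 * N)" if "0 \<le> x" "x \<le> 1" for x
        unfolding abs_mult by (rule mult_mono) (use that abs_dirichlet_kernel_le[of N x] in auto)
    qed (use dirichlet_kernel_measurable in measurable)
    have "(LINT u|unit_lborel. f u * dirichlet_kernel N u) = (LINT u|unit_lborel. K u * sin ((2 * real N + 1) * pi * u)
      + (f 0 * dirichlet_kernel N u + (f 1 - f 0) * (u * dirichlet_kernel N u)))"
      by (rule Bochner_Integration.integral_cong[OF refl]) (use * in \<open>simp add: space_restrict_space\<close>)
    also have "\<dots> = (LINT u|unit_lborel. K u * sin ((2 * real N + 1) * pi * u)) + (f 0 * 1 + (f 1 - f 0) * (1/2))"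
      using i1 i2 i3 by (simp add: integral_dirichlet_kernel)
    finally show ?thesis by (simp add: field_simps)
  qed
  show ?thesis unfolding eq using tendsto_add[OF riemann_lebesgue_sin_odd[OF Km Kb] tendsto_const[of "(f 0 + f 1)/2"]] by simp
qed

section \<open>The Gaussian folded into the unit interval\<close>

lemma exp_square_le_power:
  assumes "x > (0::real)" "v \<ge> real m"
  shows "exp (- pi * x * v\<^sup>2) \<le> exp (- pi * x) ^ m"
proof -
  have "real m \<le> real m * real m" by (cases m) auto
  also have "\<dots> \<le> v\<^sup>2" using assms by (auto simp: power2_eq_square intro!: mult_mono)
  finally have "pi * x * real m \<le> pi * x * v\<^sup>2" using assms by (intro mult_left_mono) auto
  then show ?thesis by (simp add: exp_of_nat_mult[symmetric] mult_ac)
qed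

lemma summable_theta:
  assumes "x > (0::real)" "0 \<le> u"
  shows "summable (\<lambda>m. exp (- pi * x * (u + real m)\<^sup>2))"
proof (rule summable_comparison_test')
  show "summable (\<lambda>m. exp (- pi * x) ^ m)" using assms by (intro summable_geometric) auto
  show "norm (exp (- pi * x * (u + real n)\<^sup>2)) \<le> exp (- pi * x) ^ n" for n
    using exp_square_le_power[of x n "u + real n"] assms by simp
qed

text \<open>Riemann's psi: the theta function is \<open>1 + 2 * half_theta x\<close>.\<close>

definition half_theta :: "real \<Rightarrow> real" where
  "half_theta x = (\<Sum>n. exp (- pi * x * (real (Suc n))\<^sup>2))"

text \<open>The Lipschitz constant on [m, m + 1] is summable in m; this makes the folded Gaussian
  Lipschitz, as the convergence theorem for the kernel requires.\<close>

lemma gaussian_lipschitz: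
  assumes x: "x > (0::real)" and u: "real m \<le> u" "u \<le> real m + 1" and v: "real m \<le> v" "v \<le> real m + 1"
  shows "\<bar>exp (- pi * x * u\<^sup>2) - exp (- pi * x * v\<^sup>2)\<bar> \<le> 2 * pi * x * (real m + 1) * exp (- pi * x) ^ m * \<bar>u - v\<bar>"
proof -
  let ?D = "\<lambda>u. exp (- pi * x * u\<^sup>2) * (- pi * x * (2 * u))"
  have "norm (exp (- pi * x * u\<^sup>2) - exp (- pi * x * v\<^sup>2)) \<le> (2 * pi * x * (real m + 1) * exp (- pi * x) ^ m) * norm (u - v)"
  proof (rule field_differentiable_bound[of "{real m..real m + 1}" _ ?D])
    fix w assume w: "w \<in> {real m..real m + 1}"
    have q: "((\<lambda>u. - pi * x * u\<^sup>2) has_real_derivative - pi * x * (2 * w)) (at w within {real m..real m + 1})"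
      by (auto intro!: derivative_eq_intros)
    show "((\<lambda>u. exp (- pi * x * u\<^sup>2)) has_field_derivative ?D w) (at w within {real m..real m + 1})"
      using DERIV_chain2[OF DERIV_exp q] .
    have "norm (?D w) = exp (- pi * x * w\<^sup>2) * (2 * pi * x * w)"
      using w x by (simp add: abs_mult)
    also have "\<dots> \<le> exp (- pi * x) ^ m * (2 * pi * x * (real m + 1))"
      using w x exp_square_le_power[OF x, of m w] by (intro mult_mono) auto
    finally show "norm (?D w) \<le> 2 * pi * x * (real m + 1) * exp (- pi * x) ^ m" by (simp add: mult_ac)
  qed (use u v in auto)
  then show ?thesis by simp
qed

text \<open>The kernel has period 1, so the half line folds into the unit interval, and evenness
  gives the factor 2. Folding the half line instead of the whole line produces a one-sided sum
  \<open>F\<close> with F 0 = 1 + psi and F 1 = psi, whose mean is half of theta.\<close>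

lemma theta_half_line_integral:
  fixes x :: real
  assumes x: "x > 0"
  defines "F \<equiv> \<lambda>u. \<Sum>m. exp (- pi * x * (u + real m)\<^sup>2)"
  shows "(\<integral>u. exp (- pi * x * u\<^sup>2) * dirichlet_kernel N u \<partial>lborel) = 2 * (LINT u|unit_lborel. (if 0 \<le> u then F u else 0) * dirichlet_kernel N u)"
proof -
  define g where "g u = exp (- pi * x * u\<^sup>2) * dirichlet_kernel N u" for u
  define q where "q = exp (- pi * x)"
  have q: "0 < q" "q < 1" using x by (auto simp: q_def)
  have Dper: "dirichlet_kernel N (u + real m) = dirichlet_kernel N u" for u m
  proof -
    have "cos (2 * pi * real k * (u + real m)) = cos (2 * pi * real k * u)" for k
    proof -
      have "2 * pi * real k * (u + real m) = 2 * pi * real k * u + real_of_int (int (k * m)) * (2 * pi)" by (simp add: algebra_simps)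
      then show ?thesis using sin_int_2pin[of "int (k*m)"] cos_int_2pin[of "int (k*m)"]
        by (simp only: cos_add mult.commute[of _ "2 * pi"] mult_zero_right mult_1_right diff_zero)
    qed
    then show ?thesis by (simp add: dirichlet_kernel_def)
  qed
  have gm: "g \<in> borel_measurable borel" unfolding g_def[abs_def] using dirichlet_kernel_measurable by measurable
  have gb: "\<bar>g (u + real m)\<bar> \<le> q ^ m * (1 + 2 * N)" if "u \<ge> 0" for u m
    unfolding g_def q_def abs_mult
    by (rule mult_mono) (use abs_dirichlet_kernel_le[of N "u + real m"] exp_square_le_power[OF x, of m "u + real m"] that in auto)
  \<comment> \<open>Half-open pieces make exactly one summand nonzero at each point of the half
    line. A shifted piece differs from the closed unit interval at the point 1 only, hence the
    almost-everywhere comparison below. The parameter \<open>\<phi>\<close> lets one computation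
    serve for \<open>f\<close> and for its norm.\<close>
  define f where "f m u = indicator {real m..<real m + 1} u * g u" for m :: nat and u
  have fshift: "(\<integral>u. \<phi> (f m u) \<partial>lborel) = (LINT u|unit_lborel. \<phi> (g (u + real m)))"
    if \<phi>: "\<phi> 0 = 0" "\<phi> \<in> borel_measurable borel" for m and \<phi> :: "real \<Rightarrow> real"
  proof -
    have "(\<integral>u. \<phi> (f m u) \<partial>lborel) = (\<integral>u. \<phi> (f m (real m + 1 * u)) \<partial>lborel)"
      by (subst lborel_integral_real_affine[of 1 _ "real m"]) auto
    also have "\<dots> = (\<integral>u. indicator {0..1} u *\<^sub>R \<phi> (g (u + real m)) \<partial>lborel)"
    proof (rule integral_cong_AE)
      have "AE u in lborel. u \<noteq> (1::real)" by (rule AE_lborel_singleton)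
      then show "AE u in lborel. \<phi> (f m (real m + 1 * u)) = indicator {0..1} u *\<^sub>R \<phi> (g (u + real m))"
        by eventually_elim (auto simp: f_def indicator_def \<phi> add.commute)
      show "(\<lambda>u. \<phi> (f m (real m + 1 * u))) \<in> borel_measurable lborel" unfolding f_def using gm \<phi>(2) by measurable
      show "(\<lambda>u. indicator {0..1} u *\<^sub>R \<phi> (g (u + real m))) \<in> borel_measurable lborel" using gm \<phi>(2) by measurable
    qed
    also have "\<dots> = (LINT u|unit_lborel. \<phi> (g (u + real m)))"
      by (subst integral_restrict_space) auto
    finally show ?thesis .
  qed
  have fi: "integrable lborel (f m)" for m
  proof (rule Bochner_Integration.integrable_bound)
    show "integrable lborel (\<lambda>u. indicator {real m..<real m + 1} u * (1 + 2 * real N))" by simp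
    show "f m \<in> borel_measurable lborel" unfolding f_def[abs_def] using gm by measurable
    show "AE u in lborel. norm (f m u) \<le> norm (indicator {real m..<real m + 1} u * (1 + 2 * real N))"
    proof (intro AE_I2)
      fix u
      have "q ^ m * (1 + 2 * real N) \<le> 1 * (1 + 2 * real N)" using q by (intro mult_right_mono power_le_one) auto
      then show "norm (f m u) \<le> norm (indicator {real m..<real m + 1} u * (1 + 2 * real N))"
        using order_trans[OF gb[of "u - real m" m]] by (auto simp: f_def indicator_def)
    qed
  qed
  have sg: "summable (\<lambda>m. q ^ m * (1 + 2 * real N))" using q by (intro summable_mult2 summable_geometric) auto
  have ig: "integrable unit_lborel (\<lambda>u. g (u + real m))" for m
    by (rule integrable_unit_lborel[where B = "q ^ m * (1 + 2 * N)"]) (use gm gb in auto)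
  have nint: "(LINT u|unit_lborel. norm (g (u + real m))) \<le> q ^ m * (1 + 2 * real N)" for m
  proof -
    have c: "integrable unit_lborel (\<lambda>u. q ^ m * (1 + 2 * real N))" by (rule integrable_unit_lborel[where B = "\<bar>q ^ m * (1 + 2 * N)\<bar>"]) auto
    have "(LINT u|unit_lborel. norm (g (u + real m))) \<le> (LINT u|unit_lborel. q ^ m * (1 + 2 * real N))"
      by (rule integral_mono[OF integrable_norm[OF ig] c]) (use gb in \<open>auto simp: space_restrict_space\<close>)
    also have "\<dots> = q ^ m * (1 + 2 * real N)"
      using unit_lborel_FTC[of "\<lambda>u. q ^ m * (1 + 2 * real N) * u" "\<lambda>_. q ^ m * (1 + 2 * real N)"] by (auto intro!: derivative_eq_intros)
    finally show ?thesis .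
  qed
  have s2: "summable (\<lambda>m. LINT u|unit_lborel. norm (g (u + real m)))"
    by (rule summable_comparison_test'[OF sg]) (use nint in auto)
  have fsums: "(\<lambda>m. f m u) sums (indicator {0..} u * g u)" for u
  proof (cases "u \<ge> 0")
    case True
    have "f m u = (if m = nat \<lfloor>u\<rfloor> then g u else 0)" for m
      using True by (auto simp: f_def indicator_def) linarith+
    then show ?thesis using sums_single[of "nat \<lfloor>u\<rfloor>" "\<lambda>_. g u"] True by simp
  next
    case False
    then have "f m u = 0" for m by (auto simp: f_def indicator_def)
    then show ?thesis using False by simp
  qed
  have aes: "AE u in lborel. summable (\<lambda>m. norm (f m u))"
  proof (intro AE_I2)
    fix u
    have "(\<lambda>m. norm (f m u)) = (\<lambda>m. if m \<in> {nat \<lfloor>u\<rfloor>} then norm (f m u) else 0)"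
      by (auto simp: f_def indicator_def fun_eq_iff) linarith+
    then show "summable (\<lambda>m. norm (f m u))" using summable_If_finite_set[of "{nat \<lfloor>u\<rfloor>}" "\<lambda>m. norm (f m u)"] by simp
  qed
  have sms: "summable (\<lambda>m. \<integral>u. norm (f m u) \<partial>lborel)"
    using s2 fshift[of norm] by simp
  have 1: "(\<lambda>m. \<integral>u. f m u \<partial>lborel) sums (\<integral>u. (\<Sum>m. f m u) \<partial>lborel)"
    by (rule sums_integral[OF fi aes sms])
  have int_sum: "integrable lborel (\<lambda>u. \<Sum>m. f m u)"
    by (rule integrable_suminf[OF fi aes sms])
  have sm: "(\<Sum>m. f m u) = indicator {0..} u * g u" for u using fsums by (simp add: sums_iff)
  have I2: "(\<lambda>m. LINT u|unit_lborel. g (u + real m)) sums (LINT u|unit_lborel. (\<Sum>m. g (u + real m)))"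
  proof (rule sums_integral[OF ig _ s2])
    show "AE u in unit_lborel. summable (\<lambda>m. norm (g (u + real m)))"
    proof (intro AE_I2)
      fix u assume "u \<in> space unit_lborel"
      then have "u \<ge> 0" by (simp add: space_restrict_space)
      then show "summable (\<lambda>m. norm (g (u + real m)))"
        by (intro summable_comparison_test'[OF sg]) (use gb in auto)
    qed
  qed
  have "(\<integral>u. indicator {0..} u * g u \<partial>lborel) = (LINT u|unit_lborel. (\<Sum>m. g (u + real m)))"
    using sums_unique2[OF 1 I2[folded fshift[of "\<lambda>u. u", simplified]]] by (simp add: sm)
  also have "\<dots> = (LINT u|unit_lborel. (if 0 \<le> u then F u else 0) * dirichlet_kernel N u)"
  proof (rule Bochner_Integration.integral_cong[OF refl])
    fix u assume "u \<in> space unit_lborel"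
    then have "u \<ge> 0" by (simp add: space_restrict_space)
    then show "(\<Sum>m. g (u + real m)) = (if 0 \<le> u then F u else 0) * dirichlet_kernel N u"
      using suminf_mult2[OF summable_theta[OF x], of u "dirichlet_kernel N u"] by (simp add: F_def g_def Dper)
  qed
  finally have half: "(\<integral>u. indicator {0..} u * g u \<partial>lborel) = (LINT u|unit_lborel. (if 0 \<le> u then F u else 0) * dirichlet_kernel N u)" .
  have "has_bochner_integral lborel (\<lambda>u. indicator {0..} u *\<^sub>R g u) (\<integral>u. indicator {0..} u * g u \<partial>lborel)"
    using int_sum by (simp add: sm has_bochner_integral_iff)
  then have "has_bochner_integral lborel g (2 *\<^sub>R (\<integral>u. indicator {0..} u * g u \<partial>lborel))"
    by (rule has_bochner_integral_even_function) (simp add: g_def dirichlet_kernel_def)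
  then show ?thesis unfolding half by (simp add: has_bochner_integral_iff g_def[abs_def])
qed
text \<open>This is the characteristic function of the standard normal distribution after the
  scaling v = c u with c = sqrt (2 pi x).\<close>

lemma gaussian_cos_integral:
  assumes x: "x > (0::real)"
  shows "integrable lborel (\<lambda>u. exp (- pi * x * u\<^sup>2) * cos (2 * pi * k * u))" (is ?I)
    and "(\<integral>u. exp (- pi * x * u\<^sup>2) * cos (2 * pi * k * u) \<partial>lborel) = exp (- pi * k\<^sup>2 / x) / sqrt x" (is ?E)
proof -
  define c where "c = sqrt (2 * pi * x)"
  have c: "c > 0" "c\<^sup>2 = 2 * pi * x" using x by (auto simp: c_def)
  define t where "t = 2 * pi * k / c"
  have i0: "integrable lborel (\<lambda>v. std_normal_density v * cos (t * v))"
  proof (rule Bochner_Integration.integrable_bound)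
    show "integrable lborel std_normal_density" by simp
    show "AE v in lborel. norm (std_normal_density v * cos (t * v)) \<le> norm (std_normal_density v)"
      by (intro AE_I2) (auto simp: abs_mult intro!: mult_left_le)
  qed auto
  have i1: "integrable lborel (\<lambda>v. std_normal_density v *\<^sub>R iexp (t * v))"
  proof (rule Bochner_Integration.integrable_bound)
    show "integrable lborel std_normal_density" by simp
    show "AE v in lborel. norm (std_normal_density v *\<^sub>R iexp (t * v)) \<le> norm (std_normal_density v)"
      by (intro AE_I2) auto
  qed auto
  have "complex_of_real (exp (- (t\<^sup>2) / 2)) = char std_normal_distribution t"
    by (simp add: char_std_normal_distribution)
  also have "\<dots> = (\<integral>v. std_normal_density v *\<^sub>R iexp (t * v) \<partial>lborel)"
    unfolding char_def by (subst integral_density) (auto simp: normal_density_nonneg)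
  finally have "exp (- (t\<^sup>2) / 2) = Re (\<integral>v. std_normal_density v *\<^sub>R iexp (t * v) \<partial>lborel)"
    by (metis Re_complex_of_real)
  also have "\<dots> = (\<integral>v. Re (std_normal_density v *\<^sub>R iexp (t * v)) \<partial>lborel)"
    by (rule integral_Re[OF i1, symmetric])
  also have "\<dots> = (\<integral>v. std_normal_density v * cos (t * v) \<partial>lborel)"
    by (simp add: Re_exp)
  also have "\<dots> = \<bar>c\<bar> *\<^sub>R (\<integral>u. std_normal_density (0 + c * u) * cos (t * (0 + c * u)) \<partial>lborel)"
    by (rule lborel_integral_real_affine) (use c in auto)
  also have "(\<lambda>u. std_normal_density (0 + c * u) * cos (t * (0 + c * u))) = (\<lambda>u. (exp (- pi * x * u\<^sup>2) * cos (2 * pi * k * u)) / sqrt (2 * pi))"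
    using c by (auto simp: fun_eq_iff std_normal_density_def t_def power_mult_distrib field_simps)
  finally have 1: "exp (- (t\<^sup>2) / 2) = c * (\<integral>u. exp (- pi * x * u\<^sup>2) * cos (2 * pi * k * u) \<partial>lborel) / sqrt (2 * pi)"
    using c by simp
  have "t\<^sup>2 / 2 = pi * k\<^sup>2 / x"
    using x by (simp add: t_def power_divide c(2) power_mult_distrib) (simp add: field_simps power2_eq_square)
  then have "exp (- (t\<^sup>2) / 2) = exp (- pi * k\<^sup>2 / x)" by simp
  moreover have "c = sqrt (2 * pi) * sqrt x" by (simp add: c_def real_sqrt_mult)
  ultimately have "sqrt x * (\<integral>u. exp (- pi * x * u\<^sup>2) * cos (2 * pi * k * u) \<partial>lborel) = exp (- pi * k\<^sup>2 / x)"
    using 1 by simp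
  then show ?E using x by (simp add: field_simps del: mult_minus_left)
  have "integrable lborel (\<lambda>u. std_normal_density (0 + c * u) * cos (t * (0 + c * u)))"
    by (rule lborel_integrable_real_affine[OF i0]) (use c in auto)
  also have "(\<lambda>u. std_normal_density (0 + c * u) * cos (t * (0 + c * u))) = (\<lambda>u. (exp (- pi * x * u\<^sup>2) * cos (2 * pi * k * u)) / sqrt (2 * pi))"
    using c by (auto simp: fun_eq_iff std_normal_density_def t_def power_mult_distrib field_simps)
  finally have "integrable lborel (\<lambda>u. (exp (- pi * x * u\<^sup>2) * cos (2 * pi * k * u)) / sqrt (2 * pi) * sqrt (2 * pi))"
    by (rule integrable_mult_left)
  then show ?I by simp
qed

text \<open>Poisson summation for the Gaussian. One sequence is evaluated twice: as integrals
  against the Dirichlet kernel it tends to the mean of the end values of the folded Gaussian, as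
  partial sums of Fourier coefficients it tends to theta (1/x) / (2 sqrt x).\<close>

theorem half_theta_transformation:
  assumes x: "x > (0::real)"
  shows "1 + 2 * half_theta x = (1 + 2 * half_theta (1 / x)) / sqrt x"
proof -
  define F where "F u = (\<Sum>m. exp (- pi * x * (u + real m)\<^sup>2))" for u
  define f where "f u = (if 0 \<le> u then F u else 0)" for u
  define q where "q = exp (- pi * x)"
  have q: "0 < q" "q < 1" using x by (auto simp: q_def)
  have fm: "f \<in> borel_measurable borel" unfolding f_def[abs_def] F_def by measurable
  have sq: "summable (\<lambda>m. 2 * pi * x * (real m + 1) * q ^ m)"
  proof -
    have "summable (\<lambda>m. (real m + 1) * q ^ m)"
      using geometric_deriv_sums[of q] q by (auto simp: sums_iff add.commute)
    from summable_mult[OF this, of "2 * pi * x"] show ?thesis by (simp add: mult_ac)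
  qed
  define L where "L = (\<Sum>m. 2 * pi * x * (real m + 1) * q ^ m)"
  have lip: "\<bar>f u - f v\<bar> \<le> L * \<bar>u - v\<bar>" if u: "u \<in> {0..1}" and v: "v \<in> {0..1}" for u v
  proof -
    have s: "summable (\<lambda>m. exp (- pi * x * (u + real m)\<^sup>2))" "summable (\<lambda>m. exp (- pi * x * (v + real m)\<^sup>2))"
      using summable_theta[OF x] u v by auto
    have b: "norm (exp (- pi * x * (u + real m)\<^sup>2) - exp (- pi * x * (v + real m)\<^sup>2)) \<le> 2 * pi * x * (real m + 1) * q ^ m * \<bar>u - v\<bar>" for m
      using gaussian_lipschitz[OF x, of m "u + real m" "v + real m"] u v by (simp add: q_def)
    have "f u - f v = (\<Sum>m. exp (- pi * x * (u + real m)\<^sup>2) - exp (- pi * x * (v + real m)\<^sup>2))"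
      using u v suminf_diff[OF s] by (simp add: f_def F_def)
    also have "\<bar>\<dots>\<bar> \<le> (\<Sum>m. 2 * pi * x * (real m + 1) * q ^ m * \<bar>u - v\<bar>)"
      using norm_suminf_le[OF b summable_mult2[OF sq]] by simp
    also have "\<dots> = L * \<bar>u - v\<bar>" unfolding L_def by (rule suminf_mult2[OF sq, symmetric])
    finally show ?thesis .
  qed
  have lim1: "(\<lambda>N. LINT u|unit_lborel. f u * dirichlet_kernel N u) \<longlonglongrightarrow> (f 0 + f 1) / 2"
    by (rule dirichlet_kernel_tendsto[OF fm lip])
  have f1: "f 1 = half_theta x" by (simp add: f_def F_def half_theta_def add.commute)
  have f0: "f 0 = 1 + half_theta x"
    using suminf_split_head[OF summable_theta[OF x, of 0]] by (simp add: f_def F_def half_theta_def)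
  have sx: "summable (\<lambda>n. exp (- pi * (1/x) * (real (Suc n))\<^sup>2))"
    using summable_theta[of "1/x" 1] x by (simp add: add.commute)
  have int: "(LINT u|unit_lborel. f u * dirichlet_kernel N u)
      = (1 + 2 * (\<Sum>n<N. exp (- pi * (1/x) * (real (Suc n))\<^sup>2))) / sqrt x / 2" for N
  proof -
    have g0: "integrable lborel (\<lambda>u. exp (- pi * x * u\<^sup>2))" "(\<integral>u. exp (- pi * x * u\<^sup>2) \<partial>lborel) = 1 / sqrt x"
      using gaussian_cos_integral[OF x, of 0] by simp_all
    have "(\<integral>u. exp (- pi * x * u\<^sup>2) * dirichlet_kernel N u \<partial>lborel) =
      (\<integral>u. exp (- pi * x * u\<^sup>2) + 2 * (\<Sum>k=1..N. exp (- pi * x * u\<^sup>2) * cos (2 * pi * real k * u)) \<partial>lborel)"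
      by (simp add: dirichlet_kernel_def algebra_simps sum_distrib_left)
    also have "\<dots> = 1 / sqrt x + 2 * (\<Sum>k=1..N. exp (- pi * (real k)\<^sup>2 / x) / sqrt x)"
      using g0 gaussian_cos_integral[OF x] by (subst Bochner_Integration.integral_add) auto
    also have "(\<Sum>k=1..N. exp (- pi * (real k)\<^sup>2 / x) / sqrt x) = (\<Sum>n<N. exp (- pi * (1/x) * (real (Suc n))\<^sup>2)) / sqrt x"
      unfolding sum_divide_distrib by (rule sum.reindex_bij_witness[of _ Suc "\<lambda>k. k - 1"]) auto
    finally show ?thesis
      using theta_half_line_integral[OF x, of N, folded F_def, folded f_def] by (simp add: add_divide_distrib)
  qed
  have lim2: "(\<lambda>N. LINT u|unit_lborel. f u * dirichlet_kernel N u) \<longlonglongrightarrow> (1 + 2 * half_theta (1/x)) / sqrt x / 2"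
    unfolding int half_theta_def by (intro tendsto_intros summable_LIMSEQ[OF sx]) (use x in auto)
  have aux: "1 + 2 * h = Y" if "(1 + h + h) / 2 = Y / 2" for h Y :: real using that by simp
  show ?thesis by (rule aux) (rule LIMSEQ_unique[OF lim1[unfolded f0 f1] lim2])
qed

section \<open>Entire Laplace integrals and the Gamma integral\<close>

text \<open>Expanding the exponential and integrating term by term gives a power series that
  converges everywhere; \<open>exp (r * \<bar>u\<bar>)\<close> dominates all partial sums.\<close>

lemma integrable_exp_entire:
  fixes k :: "real \<Rightarrow> real"
  assumes int: "\<And>r. integrable lborel (\<lambda>u. k u * exp (r * \<bar>u\<bar>))" and k: "k \<in> borel_measurable borel"
  shows "(\<lambda>s. \<integral>u. of_real (k u) * exp (of_real u * s) \<partial>lborel) holomorphic_on UNIV"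
proof -
  define m where "m n = (\<integral>u. of_real (k u * u ^ n / fact n) \<partial>lborel :: complex)" for n
  have pw: "\<bar>u\<bar> ^ n / fact n * r ^ n \<le> exp (r * \<bar>u\<bar>)" if "r \<ge> 0" for u r :: real and n
  proof -
    have "(\<lambda>n. (r * \<bar>u\<bar>) ^ n /\<^sub>R fact n) sums exp (r * \<bar>u\<bar>)" by (rule exp_converges)
    then have "(r * \<bar>u\<bar>) ^ n /\<^sub>R fact n \<le> exp (r * \<bar>u\<bar>)"
      using sum_le_suminf[of "\<lambda>n. (r * \<bar>u\<bar>) ^ n /\<^sub>R fact n" "{n}"] that by (auto simp: sums_iff)
    then show ?thesis by (simp add: power_mult_distrib field_simps)
  qed
  have sums: "(\<lambda>n. m n * (s - 0) ^ n) sums (\<integral>u. of_real (k u) * exp (of_real u * s) \<partial>lborel)" for s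
  proof -
    define f where "f n u = of_real (k u) * ((of_real u * s) ^ n /\<^sub>R fact n)" for n u
    have nf: "norm (f n u) = \<bar>k u\<bar> * ((\<bar>u\<bar> * cmod s) ^ n / fact n)" for n u
      by (simp add: f_def norm_mult norm_power divide_inverse mult_ac power_mult_distrib)
    have fm: "f n \<in> borel_measurable lborel" for n unfolding f_def[abs_def] using k by measurable
    have fi: "integrable lborel (f n)" for n
    proof (rule Bochner_Integration.integrable_bound[OF int[of "cmod s"] fm])
      have "norm (f n u) \<le> norm (k u * exp (cmod s * \<bar>u\<bar>))" for u
        using mult_left_mono[OF pw[of "cmod s" u n], of "\<bar>k u\<bar>"]
        by (simp add: nf abs_mult power_mult_distrib mult_ac)
      then show "AE u in lborel. norm (f n u) \<le> norm (k u * exp (cmod s * \<bar>u\<bar>))" by simp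
    qed
    have es: "(\<lambda>n. norm (f n u)) sums (\<bar>k u\<bar> * exp (\<bar>u\<bar> * cmod s))" for u
      unfolding nf using sums_mult[OF exp_converges[of "\<bar>u\<bar> * cmod s"], of "\<bar>k u\<bar>"] by (simp add: divide_inverse mult_ac)
    have s1: "AE u in lborel. summable (\<lambda>n. norm (f n u))" using es by (auto simp: sums_iff)
    have s2: "summable (\<lambda>n. \<integral>u. norm (f n u) \<partial>lborel)"
    proof (rule summableI_nonneg_bounded)
      fix N
      have "(\<Sum>n<N. \<integral>u. norm (f n u) \<partial>lborel) = (\<integral>u. (\<Sum>n<N. norm (f n u)) \<partial>lborel)"
        using fi by (subst Bochner_Integration.integral_sum) auto
      also have "\<dots> \<le> (\<integral>u. norm (k u * exp (cmod s * \<bar>u\<bar>)) \<partial>lborel)"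
      proof (rule integral_mono)
        show "integrable lborel (\<lambda>u. norm (k u * exp (cmod s * \<bar>u\<bar>)))" using int by (rule integrable_norm)
        fix u
        have "(\<Sum>n<N. norm (f n u)) \<le> (\<Sum>n. norm (f n u))"
          by (rule sum_le_suminf) (use es in \<open>auto simp: sums_iff\<close>)
        also have "\<dots> = norm (k u * exp (cmod s * \<bar>u\<bar>))"
          using es[of u] by (simp add: sums_iff abs_mult mult_ac)
        finally show "(\<Sum>n<N. norm (f n u)) \<le> norm (k u * exp (cmod s * \<bar>u\<bar>))" .
      qed (use fi in auto)
      finally show "(\<Sum>n<N. \<integral>u. norm (f n u) \<partial>lborel) \<le> (\<integral>u. norm (k u * exp (cmod s * \<bar>u\<bar>)) \<partial>lborel)" .
    qed auto
    have "(\<lambda>n. \<integral>u. f n u \<partial>lborel) sums (\<integral>u. (\<Sum>n. f n u) \<partial>lborel)"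
      by (rule sums_integral[OF fi s1 s2])
    moreover have "(\<Sum>n. f n u) = of_real (k u) * exp (of_real u * s)" for u
      unfolding f_def using sums_mult[OF exp_converges[of "of_real u * s"], of "of_real (k u)"] by (simp add: sums_iff)
    moreover have "(\<integral>u. f n u \<partial>lborel) = m n * (s - 0) ^ n" for n
    proof -
      have "f n u = of_real (k u * u ^ n / fact n) * s ^ n" for u
        by (simp add: f_def scaleR_conv_of_real power_mult_distrib field_simps)
      then show ?thesis by (simp only: integral_mult_left_zero m_def) simp
    qed
    ultimately show ?thesis by simp
  qed
  show ?thesis
  proof (rule holomorphic_on_subset)
    show "(\<lambda>s. \<integral>u. of_real (k u) * exp (of_real u * s) \<partial>lborel) holomorphic_on \<Union>(range (ball 0))"
      by (rule holomorphic_on_UN_open) (use sums in \<open>auto intro!: power_series_holomorphic\<close>)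
    show "UNIV \<subseteq> \<Union> (range (ball (0::complex)))"
      by (force simp: dist_norm intro: gt_ex)
  qed
qed

text \<open>Euler's integral under t = exp u, so that powers become exponentials and multiplicative
  substitutions become shifts.\<close>

lemma Gamma_integral_exp:
  assumes s: "Re s > 0"
  shows "integrable lborel (\<lambda>u. exp (of_real u * s) * of_real (exp (- exp u)))"
    and "(\<integral>u. exp (of_real u * s) * of_real (exp (- exp u)) \<partial>lborel) = Gamma s"
proof -
  define f where "f t = complex_of_real t powr (s - 1) / of_real (exp t)" for t
  define h where "h u = exp (of_real u * s) * complex_of_real (exp (- exp u))" for u :: real
  have abs: "f absolutely_integrable_on {0<..}"
    using absolutely_integrable_Gamma_integral'[OF s] by (simp add: f_def[abs_def])
  have int: "integral {0<..} f = Gamma s"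
    using Gamma_integral_complex'[OF s] by (simp add: f_def[abs_def] integral_unique)
  have hf: "of_real \<bar>exp u\<bar> * f (exp u) = h u" for u
  proof -
    have "f (exp u) = exp ((s - 1) * of_real u) / exp (of_real (exp u))"
      by (simp add: f_def powr_def exp_of_real[symmetric])
    then have "of_real \<bar>exp u\<bar> * f (exp u) = exp (of_real u) * (exp ((s - 1) * of_real u) / exp (of_real (exp u)))"
      by (simp add: exp_of_real)
    also have "\<dots> = exp (of_real u + (s - 1) * of_real u) / exp (of_real (exp u))" by (simp add: exp_add)
    also have "\<dots> = h u" by (simp add: h_def exp_minus exp_of_real divide_inverse algebra_simps)
    finally show ?thesis .
  qed
  have rng: "range exp = {0::real<..}" by (auto simp: image_def) (metis exp_ln)
  \<comment> \<open>The substitution is made for a real-valued linear image of the integrand; the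
    real and the imaginary part are put together at the end.\<close>
  have comp: "(\<lambda>u. P (h u)) absolutely_integrable_on UNIV \<and> integral UNIV (\<lambda>u. P (h u)) = P (Gamma s)"
    if P: "bounded_linear P" for P :: "complex \<Rightarrow> real"
  proof -
    interpret bounded_linear P by fact
    have 1: "(\<lambda>t. P (f t)) absolutely_integrable_on {0<..}"
      using absolutely_integrable_linear[OF abs P] by (simp add: o_def)
    have 2: "integral {0<..} (\<lambda>t. P (f t)) = P (Gamma s)"
      using integral_linear[OF set_lebesgue_integral_eq_integral(1)[OF abs] P] int by (simp add: o_def)
    have "(\<lambda>u. \<bar>exp u\<bar> * P (f (exp u))) absolutely_integrable_on UNIV \<and> integral UNIV (\<lambda>u. \<bar>exp u\<bar> * P (f (exp u))) = P (Gamma s)"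
      by (subst has_absolute_integral_change_of_variables_1')
        (use 1 2 rng in \<open>auto intro!: derivative_eq_intros inj_onI\<close>)
    moreover have "\<bar>exp u\<bar> * P (f (exp u)) = P (h u)" for u
      using scaleR[of "\<bar>exp u\<bar>" "f (exp u)"] hf[of u] by (simp add: scaleR_conv_of_real)
    ultimately show ?thesis by simp
  qed
  have hm: "h \<in> borel_measurable borel" unfolding h_def[abs_def] by measurable
  have R: "integrable lborel (\<lambda>u. P (h u))" "(\<integral>u. P (h u) \<partial>lborel) = P (Gamma s)"
    if P: "bounded_linear P" for P :: "complex \<Rightarrow> real"
  proof -
    have m: "(\<lambda>u. P (h u)) \<in> borel_measurable lborel"
      using measurable_compose[OF hm borel_measurable_continuous_onI[OF linear_continuous_on[OF P]]] by simp
    have a: "integrable lebesgue (\<lambda>u. P (h u))" using comp[OF P] by (simp add: set_integrable_def)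
    then show i: "integrable lborel (\<lambda>u. P (h u))" using integrable_completion[OF m] by simp
    have "(\<integral>u. P (h u) \<partial>lborel) = integral UNIV (\<lambda>u. P (h u))"
      using integral_lborel[OF i] by simp
    then show "(\<integral>u. P (h u) \<partial>lborel) = P (Gamma s)" using comp[OF P] by simp
  qed
  have "integrable lborel (\<lambda>u. of_real (Re (h u)) + \<i> * of_real (Im (h u)))"
    using R(1)[OF bounded_linear_Re] R(1)[OF bounded_linear_Im] by (intro Bochner_Integration.integrable_add integrable_mult_right integrable_of_real) auto
  then have ih: "integrable lborel h" by (simp add: complex_eq[symmetric])
  then show "integrable lborel (\<lambda>u. exp (of_real u * s) * of_real (exp (- exp u)))"
    by (simp add: h_def[abs_def])
  have "(\<integral>u. h u \<partial>lborel) = Gamma s"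
    by (rule complex_eqI) (use R(2)[OF bounded_linear_Re] R(2)[OF bounded_linear_Im] integral_Re[OF ih] integral_Im[OF ih] in auto)
  then show "(\<integral>u. exp (of_real u * s) * of_real (exp (- exp u)) \<partial>lborel) = Gamma s"
    by (simp add: h_def)
qed

section \<open>The zeta function and the entire function xi\<close>

lemma half_theta_bounds:
  assumes "x \<ge> 1"
  shows "half_theta x > 0" "half_theta x \<le> 2 * exp (- x)"
proof -
  have s: "summable (\<lambda>n. exp (- pi * x * (real (Suc n))\<^sup>2))"
    using summable_theta[of x 1] assms by (simp add: add.commute)
  show "half_theta x > 0" unfolding half_theta_def by (rule suminf_pos[OF s]) auto
  define q where "q = exp (- pi * x)"
  have "q \<le> exp (-1)" unfolding q_def using assms pi_gt3 mult_mono[of 1 pi 1 x] by auto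
  also have "exp (-1) \<le> (1/2::real)" using exp_ge_add_one_self[of 1] by (simp add: exp_minus field_simps)
  finally have q: "0 < q" "q \<le> 1/2" by (auto simp: q_def)
  have sg: "summable (\<lambda>n. q ^ n)" using q by (intro summable_geometric) auto
  have "half_theta x \<le> (\<Sum>n. q * q ^ n)" unfolding half_theta_def
  proof (rule suminf_le[OF _ s])
    show "exp (- pi * x * (real (Suc n))\<^sup>2) \<le> q * q ^ n" for n
      using exp_square_le_power[of x "Suc n" "real (Suc n)"] assms by (simp add: q_def)
    show "summable (\<lambda>n. q * q ^ n)" by (rule summable_mult[OF sg])
  qed
  also have "\<dots> = q * (1 / (1 - q))" using suminf_mult[OF sg, of q] suminf_geometric[of q] q by simp
  also have "\<dots> \<le> q * 2" using q by (intro mult_left_mono) (auto simp: field_simps)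
  also have "q \<le> exp (- x)" unfolding q_def using assms pi_gt3 mult_right_mono[of 1 pi x] by simp
  finally show "half_theta x \<le> 2 * exp (- x)" by simp
qed

section \<open>The Laplace transform of the theta kernel\<close>

text \<open>With x = exp (2 u) the factor x^(s/2) dx/x becomes 2 exp (u s) du, and Riemann's
  integral of psi over x >= 1 becomes a Laplace integral over u >= 0.\<close>

definition theta_kernel :: "real \<Rightarrow> real" where
  "theta_kernel u = (if u \<ge> 0 then half_theta (exp (2 * u)) else 0)"

lemma half_theta_measurable [measurable]: "half_theta \<in> borel_measurable borel"
  unfolding half_theta_def[abs_def] by measurable

lemma theta_kernel_measurable [measurable]: "theta_kernel \<in> borel_measurable borel"
  unfolding theta_kernel_def[abs_def] by measurable

lemma theta_kernel_nonneg: "theta_kernel u \<ge> 0"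
  using half_theta_bounds(1)[of "exp (2 * u)"] by (auto simp: theta_kernel_def)

text \<open>The left side is largest at u = ln A.\<close>

lemma mult_minus_exp_le:
  fixes A u :: real
  assumes "A > 0"
  shows "A * u - exp u \<le> A * ln A - A"
proof -
  have "ln (exp u / A) \<le> exp u / A - 1" using assms by (intro ln_le_minus_one) auto
  then have "A * (u - ln A) \<le> A * (exp u / A - 1)" using assms by (intro mult_left_mono) (auto simp: ln_div)
  then show ?thesis using assms by (simp add: algebra_simps)
qed

text \<open>One unit of the exponent is kept back as the factor exp (- u), whose integral over the
  half line is 1. The constant exp (A ln A) is what limits the growth of \<open>Xi\<close> to order
  1.\<close>

lemma theta_kernel_exp_bound:
  assumes "A > 0"
  shows "theta_kernel u * exp ((A - 1) * u) \<le> 2 * exp (A * ln A) * (exp (-u) * indicator {0..} u)"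
proof (cases "u \<ge> 0")
  case True
  have "exp (2 * u) \<ge> exp u" using True by simp
  then have "theta_kernel u \<le> 2 * exp (- exp u)"
    using half_theta_bounds(2)[of "exp (2 * u)"] True by (auto simp: theta_kernel_def intro: order_trans)
  then have "theta_kernel u * exp ((A - 1) * u) \<le> 2 * exp (- exp u) * exp ((A - 1) * u)"
    by (rule mult_right_mono) simp
  also have "\<dots> = 2 * exp (A * u - exp u) * exp (-u)" by (simp add: exp_add[symmetric] algebra_simps)
  also have "\<dots> \<le> 2 * exp (A * ln A) * exp (-u)"
    using mult_minus_exp_le[OF assms, of u] assms by (intro mult_right_mono mult_left_mono) auto
  finally show ?thesis using True by simp
qed (simp add: theta_kernel_def)

lemma integral_exp_minus:
  "integrable lborel (\<lambda>u::real. exp (-u) * indicator {0..} u)"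
  "(\<integral>u. exp (-u) * indicator {0..} (u::real) \<partial>lborel) = 1"
  using has_bochner_integral_I0i_power_exp_m'[of 0] by (auto simp: has_bochner_integral_iff)

lemma theta_kernel_integrable: "integrable lborel (\<lambda>u. theta_kernel u * exp (r * u))"
proof -
  define A where "A = \<bar>r\<bar> + 1"
  have A: "A > 0" by (simp add: A_def)
  show ?thesis
  proof (rule Bochner_Integration.integrable_bound)
    show "integrable lborel (\<lambda>u. 2 * exp (A * ln A) * (exp (-u) * indicator {0..} u))"
      by (intro integrable_mult_right integral_exp_minus)
    have "norm (theta_kernel u * exp (r * u)) \<le> 2 * exp (A * ln A) * (exp (-u) * indicator {0..} u)" for u
    proof (cases "u \<ge> 0")
      case True
      have "norm (theta_kernel u * exp (r * u)) \<le> theta_kernel u * exp ((A - 1) * u)"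
        using True theta_kernel_nonneg by (simp add: A_def abs_mult mult_left_mono mult_right_mono)
      also note theta_kernel_exp_bound[OF A]
      finally show ?thesis .
    qed (simp add: theta_kernel_def)
    then show "AE u in lborel. norm (theta_kernel u * exp (r * u)) \<le> norm (2 * exp (A * ln A) * (exp (-u) * indicator {0..} u))"
      by (intro AE_I2) (auto intro: order_trans)
  qed measurable
qed

definition theta_laplace :: "complex \<Rightarrow> complex" where
  "theta_laplace s = (\<integral>u. of_real (theta_kernel u) * exp (of_real u * s) \<partial>lborel)"

lemma theta_laplace_holomorphic: "theta_laplace holomorphic_on A"
proof -
  have "(\<lambda>u. theta_kernel u * exp (r * \<bar>u\<bar>)) = (\<lambda>u. theta_kernel u * exp (r * u))" for r
    by (auto simp: theta_kernel_def)
  then have "theta_laplace holomorphic_on UNIV"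
    unfolding theta_laplace_def[abs_def] using theta_kernel_integrable by (intro integrable_exp_entire) auto
  then show ?thesis by (rule holomorphic_on_subset) auto
qed

lemma theta_laplace_integrable: "integrable lborel (\<lambda>u. of_real (theta_kernel u) * exp (of_real u * s))" for s :: complex
proof (rule Bochner_Integration.integrable_bound[OF theta_kernel_integrable[of "Re s"]])
  show "AE u in lborel. norm (of_real (theta_kernel u) * exp (of_real u * s)) \<le> norm (theta_kernel u * exp (Re s * u))"
    by (intro AE_I2) (auto simp: norm_mult theta_kernel_nonneg mult.commute)
qed measurable

lemma norm_theta_laplace_le:
  "cmod (theta_laplace s) \<le> 2 * exp ((\<bar>Re s\<bar> + 1) * ln (\<bar>Re s\<bar> + 1))"
proof -
  define A where "A = \<bar>Re s\<bar> + 1"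
  have A: "A > 0" by (simp add: A_def)
  have "cmod (theta_laplace s) \<le> (\<integral>u. norm (of_real (theta_kernel u) * exp (of_real u * s)) \<partial>lborel)"
    unfolding theta_laplace_def by (rule integral_norm_bound)
  also have "\<dots> \<le> (\<integral>u. 2 * exp (A * ln A) * (exp (-u) * indicator {0..} u) \<partial>lborel)"
  proof (rule integral_mono)
    fix u
    show "norm (of_real (theta_kernel u) * exp (of_real u * s)) \<le> 2 * exp (A * ln A) * (exp (-u) * indicator {0..} u)"
    proof (cases "u \<ge> 0")
      case True
      then have "u * Re s \<le> (A - 1) * u" by (simp add: A_def mult.commute mult_left_mono)
      then have "norm (of_real (theta_kernel u) * exp (of_real u * s)) \<le> theta_kernel u * exp ((A - 1) * u)"
        using theta_kernel_nonneg by (simp add: norm_mult mult_left_mono)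
      also note theta_kernel_exp_bound[OF A]
      finally show ?thesis .
    qed (simp add: theta_kernel_def)
  qed (intro integrable_norm theta_laplace_integrable integrable_mult_right integral_exp_minus)+
  also have "\<dots> = 2 * exp (A * ln A)" by (simp add: integral_exp_minus)
  finally show ?thesis by (simp add: A_def)
qed

lemma theta_laplace_cnj: "theta_laplace (cnj s) = cnj (theta_laplace s)"
proof -
  have "cnj (theta_laplace s) = (\<integral>u. cnj (of_real (theta_kernel u) * exp (of_real u * s)) \<partial>lborel)"
    unfolding theta_laplace_def by (rule integral_bounded_linear[OF bounded_linear_cnj, symmetric]) (rule theta_laplace_integrable)
  then show ?thesis by (simp add: theta_laplace_def exp_cnj)
qed

text \<open>The kernel is nonnegative and lives on u >= 0, where exp (r u) >= 1. The positive
  constant \<open>Re (theta_laplace 0)\<close> later bounds the derivative of n at 4w from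
  below.\<close>

lemma Re_theta_laplace_ge:
  assumes "r \<ge> 0"
  shows "Re (theta_laplace (of_real r)) \<ge> Re (theta_laplace 0)" "Re (theta_laplace 0) > 0"
proof -
  have e: "Re (theta_laplace (of_real r)) = (\<integral>u. theta_kernel u * exp (r * u) \<partial>lborel)" for r
    unfolding theta_laplace_def
    by (subst integral_Re[OF theta_laplace_integrable, symmetric]) (simp add: exp_of_real Re_exp mult.commute)
  show "Re (theta_laplace (of_real r)) \<ge> Re (theta_laplace 0)"
    using e[of 0] unfolding e[of r]
  proof (simp, intro integral_mono)
    show "integrable lborel theta_kernel" "integrable lborel (\<lambda>u. theta_kernel u * exp (r * u))"
      using theta_kernel_integrable[of 0] theta_kernel_integrable[of r] by auto
    show "theta_kernel u \<le> theta_kernel u * exp (r * u)" for u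
    proof (cases "u \<ge> 0")
      case True
      then have "theta_kernel u * 1 \<le> theta_kernel u * exp (r * u)"
        using assms theta_kernel_nonneg by (intro mult_left_mono) auto
      then show ?thesis by simp
    qed (simp add: theta_kernel_def)
  qed
  have i: "integrable lborel theta_kernel" using theta_kernel_integrable[of 0] by simp
  have "(\<integral>u. theta_kernel u \<partial>lborel) \<noteq> 0"
  proof
    assume "(\<integral>u. theta_kernel u \<partial>lborel) = 0"
    then have "AE u in lborel. theta_kernel u = 0"
      using integral_nonneg_eq_0_iff_AE[OF i] theta_kernel_nonneg by auto
    moreover have "theta_kernel u \<noteq> 0" if "u \<ge> 0" for u
      using half_theta_bounds(1)[of "exp (2 * u)"] that by (auto simp: theta_kernel_def)
    ultimately have "AE u in lborel. u < (0::real)" by (auto elim!: eventually_mono simp: not_le[symmetric])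
    then have "emeasure lborel {u. \<not> u < (0::real)} = 0"
      by (subst AE_iff_measurable[symmetric, where P = "\<lambda>u. u < 0"]) auto
    moreover have "emeasure lborel {0..1::real} \<le> emeasure lborel {u. \<not> u < (0::real)}" by (intro emeasure_mono) auto
    ultimately show False by simp
  qed
  moreover have "(\<integral>u. theta_kernel u \<partial>lborel) \<ge> 0" by (intro Bochner_Integration.integral_nonneg theta_kernel_nonneg)
  ultimately show "Re (theta_laplace 0) > 0" using e[of 0] by simp
qed

lemma theta_laplace_reflect_holomorphic: "(\<lambda>s. theta_laplace (1 - s)) holomorphic_on A"
  by (rule holomorphic_on_compose[of "\<lambda>s. 1 - s" A theta_laplace, unfolded o_def])
    (intro theta_laplace_holomorphic holomorphic_intros)+

text \<open>Riemann's formula. The pole terms (1 / (s - 1) - 1 / s) / 2 of the theta integral,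
  multiplied by s (s - 1), have become the constant 1/2, so that analyticity in the plane and the
  symmetry under s -> 1 - s can be read off.\<close>

definition Xi :: "complex \<Rightarrow> complex" where
  "Xi s = 1/2 + s * (s - 1) * (theta_laplace s + theta_laplace (1 - s))"

lemma Xi_holomorphic: "Xi holomorphic_on A"
  unfolding Xi_def[abs_def]
  by (intro holomorphic_intros theta_laplace_holomorphic theta_laplace_reflect_holomorphic)

lemma Xi_reflect: "Xi (1 - s) = Xi s"
  by (simp add: Xi_def algebra_simps)

lemma Xi_cnj: "Xi (cnj s) = cnj (Xi s)"
  by (simp add: Xi_def theta_laplace_cnj[symmetric])

lemma integral_exp_half_line:
  assumes s: "Re s > 0"
  shows "integrable lborel (\<lambda>u. indicator {0..} u *\<^sub>R exp (- (of_real u * s)))"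
    and "(\<integral>u. indicator {0..} u *\<^sub>R exp (- (of_real u * s)) \<partial>lborel) = 1 / s"
proof -
  have s0: "s \<noteq> 0" using s by auto
  have "integrable lborel (\<lambda>x. exp (- (0 + Re s * x)) * indicator {0..} (0 + Re s * x))"
    using s by (intro lborel_integrable_real_affine[OF integral_exp_minus(1)]) auto
  then have i1: "integrable lborel (\<lambda>x. exp (- (Re s * x)) * indicator {0..} x)"
    using s by (auto simp: indicator_def zero_le_mult_iff cong: if_cong elim!: Bochner_Integration.integrable_cong[THEN iffD1, rotated -1])
  show i: "integrable lborel (\<lambda>u. indicator {0..} u *\<^sub>R exp (- (of_real u * s)))"
    by (rule Bochner_Integration.integrable_bound[OF i1]) (auto intro!: AE_I2 simp: indicator_def mult.commute)
  have fin: "(LINT u:{0..N}|lborel. exp (- (of_real u * s))) = (1 - exp (- (of_real N * s))) / s" if "N \<ge> 0" for N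
  proof -
    have "(\<integral>u. indicator {0..N} u *\<^sub>R exp (- (of_real u * s)) \<partial>lborel) = - exp (- (of_real N * s)) / s - (- exp (- (of_real 0 * s)) / s)"
    proof (rule integral_FTC_Icc)
      fix x
      have "((\<lambda>z. - exp (- (z * s)) / s) has_field_derivative exp (- (of_real x * s))) (at (of_real x))"
        using s0 by (auto intro!: derivative_eq_intros)
      then have "((\<lambda>z. - exp (- (of_real z * s)) / s) has_vector_derivative exp (- (of_real x * s))) (at x within {0..N})"
        by (rule has_vector_derivative_real_field)
      then show "((\<lambda>z. - exp (- (of_real z * s)) / s) has_vector_derivative exp (- (of_real x * s))) (at x within {0..N})" .
    qed (use that in \<open>auto intro!: continuous_intros\<close>)
    then show ?thesis by (simp add: set_lebesgue_integral_def diff_divide_distrib)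
  qed
  have "((\<lambda>N. LINT u:{0..N}|lborel. exp (- (of_real u * s))) \<longlongrightarrow> (LINT u:{0..}|lborel. exp (- (of_real u * s)))) at_top"
    by (rule tendsto_set_lebesgue_integral_at_top) (use i in \<open>auto simp: set_integrable_def\<close>)
  moreover have "((\<lambda>N. LINT u:{0..N}|lborel. exp (- (of_real u * s))) \<longlongrightarrow> (1 - 0) / s) at_top"
  proof (rule Lim_transform_eventually)
    have "((\<lambda>N. norm (exp (- (of_real N * s)))) \<longlongrightarrow> 0) at_top"
      using s by simp real_asymp
    then have "((\<lambda>N. exp (- (of_real N * s))) \<longlongrightarrow> 0) at_top" by (rule tendsto_norm_zero_cancel)
    then show "((\<lambda>N. (1 - exp (- (of_real N * s))) / s) \<longlongrightarrow> (1 - 0) / s) at_top"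
      by (intro tendsto_intros) (use s0 in auto)
    show "\<forall>\<^sub>F N in at_top. (1 - exp (- (of_real N * s))) / s = (LINT u:{0..N}|lborel. exp (- (of_real u * s)))"
      using eventually_ge_at_top[of 0] by eventually_elim (simp add: fin)
  qed
  ultimately have "(LINT u:{0..}|lborel. exp (- (of_real u * s))) = (1 - 0) / s"
    by (rule tendsto_unique[rotated]) simp
  then show "(\<integral>u. indicator {0..} u *\<^sub>R exp (- (of_real u * s)) \<partial>lborel) = 1 / s"
    by (simp add: set_lebesgue_integral_def)
qed

section \<open>The Mellin transform of psi and the Dirichlet series\<close>

text \<open>The substitution v = ln c + 2 u in the Gamma integral; c = pi n^2 gives the n-th term of
  psi.\<close>

lemma Gamma_mellin_gaussian:
  assumes s: "Re s > 0" and c: "c > (0::real)"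
  shows "integrable lborel (\<lambda>u. exp (of_real u * s) * of_real (exp (- c * exp (2 * u))))"
    and "(\<integral>u. exp (of_real u * s) * of_real (exp (- c * exp (2 * u))) \<partial>lborel) = Gamma (s / 2) * exp (- (s / 2) * of_real (ln c)) / 2"
proof -
  define h where "h v = exp (of_real v * (s / 2)) * complex_of_real (exp (- exp v))" for v
  have s2: "Re (s / 2) > 0" using s by simp
  have h: "integrable lborel h" "(\<integral>v. h v \<partial>lborel) = Gamma (s / 2)"
    using Gamma_integral_exp[OF s2] by (simp_all add: h_def[abs_def])
  have hs: "h (ln c + 2 * u) = exp ((s / 2) * of_real (ln c)) * (exp (of_real u * s) * of_real (exp (- c * exp (2 * u))))" for u
  proof -
    have "exp (of_real (ln c + 2 * u) * (s / 2)) = exp ((s / 2) * of_real (ln c)) * exp (of_real u * s)"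
      by (simp add: exp_add[symmetric] algebra_simps)
    then show ?thesis using c by (simp add: h_def exp_add)
  qed
  have i: "integrable lborel (\<lambda>u. h (ln c + 2 * u))" by (rule lborel_integrable_real_affine[OF h(1)]) simp
  have "integrable lborel (\<lambda>u. exp (- (s / 2) * of_real (ln c)) * h (ln c + 2 * u))" by (rule integrable_mult_right) (rule i)
  then show "integrable lborel (\<lambda>u. exp (of_real u * s) * of_real (exp (- c * exp (2 * u))))"
    unfolding hs by (simp add: mult.assoc[symmetric] exp_add[symmetric] del: of_real_exp)
  have "Gamma (s / 2) = \<bar>2\<bar> *\<^sub>R (\<integral>u. h (ln c + 2 * u) \<partial>lborel)"
    unfolding h(2)[symmetric] by (rule lborel_integral_real_affine) simp
  also have "(\<integral>u. h (ln c + 2 * u) \<partial>lborel) = exp ((s / 2) * of_real (ln c)) * (\<integral>u. exp (of_real u * s) * of_real (exp (- c * exp (2 * u))) \<partial>lborel)"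
    unfolding hs by (rule integral_mult_right_zero)
  finally show "(\<integral>u. exp (of_real u * s) * of_real (exp (- c * exp (2 * u))) \<partial>lborel) = Gamma (s / 2) * exp (- (s / 2) * of_real (ln c)) / 2"
    by (simp add: exp_minus scaleR_conv_of_real field_simps)
qed

lemma norm_of_nat_Suc_powr: "norm (of_nat (Suc n) powr s :: complex) = real (Suc n) powr Re s"
  by (subst norm_powr_real_powr) auto

lemma summable_dirichlet_norm:
  assumes "Re s > 1"
  shows "summable (\<lambda>n. norm (1 / of_nat (Suc n) powr s :: complex))"
proof -
  have "summable (\<lambda>n. of_nat n powr (- Re s) :: real)" using assms by (simp add: summable_real_powr_iff)
  then have "summable (\<lambda>n. of_nat (Suc n) powr (- Re s) :: real)" by (subst summable_Suc_iff)
  then show ?thesis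
    by (simp add: norm_divide norm_of_nat_Suc_powr powr_minus divide_inverse norm_inverse del: of_nat_Suc)
qed

lemma half_theta_mellin:
  assumes s: "Re s > 1"
  shows "integrable lborel (\<lambda>u. of_real (half_theta (exp (2 * u))) * exp (of_real u * s))"
    and "(\<integral>u. of_real (half_theta (exp (2 * u))) * exp (of_real u * s) \<partial>lborel) =
      of_real pi powr (- s / 2) * Gamma (s / 2) / 2 * (\<Sum>n. 1 / of_nat (Suc n) powr s)"
proof -
  define c where "c n = pi * (real (Suc n))\<^sup>2" for n
  have c: "c n > 0" for n by (simp add: c_def)
  define f where "f n u = exp (of_real u * s) * complex_of_real (exp (- c n * exp (2 * u)))" for n u
  have s0: "Re s > 0" using s by simp
  have ex: "exp (- (z / 2) * of_real (ln (c n))) = of_real pi powr (- z / 2) * (1 / of_nat (Suc n) powr z)" for z :: complex and n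
  proof -
    have "ln (c n) = ln pi + 2 * ln (real (Suc n))"
      unfolding c_def by (subst ln_mult_pos) (auto simp: ln_realpow simp del: of_nat_Suc)
    then have e1: "- (z / 2) * of_real (ln (c n)) = - z / 2 * of_real (ln pi) + - z * of_real (ln (real (Suc n)))"
      by (simp add: algebra_simps del: of_nat_Suc)
    have e2: "of_nat (Suc n) powr z = exp (z * of_real (ln (real (Suc n))))"
      by (simp add: powr_def Ln_of_nat del: of_nat_Suc)
    have e3: "of_real pi powr (- z / 2) = exp (- z / 2 * of_real (ln pi))"
      by (simp add: powr_def Ln_of_real)
    have "- z * of_real (ln (real (Suc n))) = - (z * of_real (ln (real (Suc n))))" by simp
    then show ?thesis unfolding e1 e2 e3 exp_add by (simp only: exp_minus inverse_eq_divide)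
  qed
  have fi: "integrable lborel (f n)" for n
    unfolding f_def using Gamma_mellin_gaussian(1)[OF s0 c[of n]] .
  have fint: "(\<integral>u. f n u \<partial>lborel) = of_real pi powr (- s / 2) * Gamma (s / 2) / 2 * (1 / of_nat (Suc n) powr s)" for n
    unfolding f_def Gamma_mellin_gaussian(2)[OF s0 c[of n]] ex by (simp add: mult_ac)
  \<comment> \<open>The norm of the integrand is the integrand at the real point Re s, so the closed
    formula already available evaluates its integral too.\<close>
  have nint: "(\<integral>u. norm (f n u) \<partial>lborel) = norm (of_real pi powr (- of_real (Re s) / 2) * Gamma (of_real (Re s) / 2) / 2 :: complex) * norm (1 / of_nat (Suc n) powr s :: complex)" for n
  proof -
    have r0: "Re (of_real (Re s)) > 0" using s0 by simp
    have e: "complex_of_real (norm (f n u)) = exp (of_real u * of_real (Re s)) * complex_of_real (exp (- c n * exp (2 * u)))" for u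
      by (simp add: f_def norm_mult exp_of_real[symmetric])
    have "complex_of_real (\<integral>u. norm (f n u) \<partial>lborel) = (\<integral>u. complex_of_real (norm (f n u)) \<partial>lborel)"
      by (rule integral_of_real[symmetric]) (rule integrable_norm[OF fi])
    also have "\<dots> = of_real pi powr (- of_real (Re s) / 2) * Gamma (of_real (Re s) / 2) / 2 * (1 / of_nat (Suc n) powr of_real (Re s))"
      unfolding e Gamma_mellin_gaussian(2)[OF r0 c[of n]] ex by (simp add: mult_ac)
    finally have "norm (complex_of_real (\<integral>u. norm (f n u) \<partial>lborel)) = norm (of_real pi powr (- of_real (Re s) / 2) * Gamma (of_real (Re s) / 2) / 2 :: complex) * norm (1 / of_nat (Suc n) powr (of_real (Re s)) :: complex)"
      by (simp only: norm_mult)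
    moreover have "norm (1 / of_nat (Suc n) powr (of_real (Re s)) :: complex) = norm (1 / of_nat (Suc n) powr s :: complex)"
      by (simp add: norm_divide norm_of_nat_Suc_powr del: of_nat_Suc)
    moreover have "(\<integral>u. norm (f n u) \<partial>lborel) \<ge> 0" by (rule Bochner_Integration.integral_nonneg) auto
    ultimately show ?thesis by (simp only: norm_of_real abs_of_nonneg)
  qed
  have sms: "summable (\<lambda>n. \<integral>u. norm (f n u) \<partial>lborel)"
    unfolding nint by (intro summable_mult summable_dirichlet_norm s)
  have th: "(\<lambda>n. exp (- c n * exp (2 * u))) sums half_theta (exp (2 * u))" for u
  proof -
    have "summable (\<lambda>n. exp (- pi * exp (2 * u) * (real (Suc n))\<^sup>2))"
      using summable_theta[of "exp (2 * u)" 1] by (simp add: add.commute)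
    then have "(\<lambda>n. exp (- pi * exp (2 * u) * (real (Suc n))\<^sup>2)) sums half_theta (exp (2 * u))"
      unfolding half_theta_def by (rule summable_sums)
    then show ?thesis by (simp add: c_def mult_ac)
  qed
  have fsum: "(\<lambda>n. f n u) sums (of_real (half_theta (exp (2 * u))) * exp (of_real u * s))" for u
    unfolding f_def using sums_mult[OF sums_of_real[OF th[of u]], of "exp (of_real u * s)"] by (simp add: mult.commute)
  have aes: "AE u in lborel. summable (\<lambda>n. norm (f n u))"
  proof (intro AE_I2)
    fix u
    have "summable (\<lambda>n. norm (exp (of_real u * s)) * exp (- c n * exp (2 * u)))"
      using th by (intro summable_mult) (auto simp: sums_iff)
    then show "summable (\<lambda>n. norm (f n u))" by (simp add: f_def norm_mult)
  qed
  have e: "(\<Sum>n. f n u) = of_real (half_theta (exp (2 * u))) * exp (of_real u * s)" for u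
    using fsum by (simp add: sums_iff)
  show "integrable lborel (\<lambda>u. of_real (half_theta (exp (2 * u))) * exp (of_real u * s))"
    using integrable_suminf[OF fi aes sms] by (simp only: e)
  have "(\<integral>u. of_real (half_theta (exp (2 * u))) * exp (of_real u * s) \<partial>lborel) = (\<Sum>n. \<integral>u. f n u \<partial>lborel)"
    using integral_suminf[OF fi aes sms] by (simp only: e)
  also have "\<dots> = of_real pi powr (- s / 2) * Gamma (s / 2) / 2 * (\<Sum>n. 1 / of_nat (Suc n) powr s)"
    unfolding fint by (rule suminf_mult[OF summable_norm_cancel[OF summable_dirichlet_norm[OF s]]])
  finally show "(\<integral>u. of_real (half_theta (exp (2 * u))) * exp (of_real u * s) \<partial>lborel) =
      of_real pi powr (- s / 2) * Gamma (s / 2) / 2 * (\<Sum>n. 1 / of_nat (Suc n) powr s)" .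
qed

text \<open>The inversion x -> 1/x is the reflection u -> - u.\<close>

lemma half_theta_exp_minus:
  "half_theta (exp (2 * (- u))) = exp u * half_theta (exp (2 * u)) + (exp u - 1) / 2"
proof -
  have "sqrt (exp (2 * (- u))) = exp (- u)"
    by (rule real_sqrt_unique) (simp_all add: power2_eq_square exp_add[symmetric])
  then have "1 + 2 * half_theta (exp (2 * (- u))) = (1 + 2 * half_theta (exp (2 * u))) * exp u"
    using half_theta_transformation[of "exp (2 * (- u))"] by (simp add: exp_minus divide_inverse)
  moreover have "a = e * b + (e - 1) / 2" if "1 + 2 * a = (1 + 2 * b) * e" for a b e :: real
    using that by (simp add: field_simps)
  ultimately show ?thesis by blast
qed

text \<open>Riemann's splitting at x = 1. Reflecting the half line u < 0 turns psi into exp u * psi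
  plus the elementary term (exp u - 1) / 2, whose Laplace integrals are the pole terms at 1 and 0;
  the first of them needs Re s > 1.\<close>

lemma half_theta_mellin_split:
  assumes s: "Re s > 1"
  shows "(\<integral>u. of_real (half_theta (exp (2 * u))) * exp (of_real u * s) \<partial>lborel) =
     theta_laplace s + theta_laplace (1 - s) + (1 / (s - 1) - 1 / s) / 2"
proof -
  define H where "H u = complex_of_real (half_theta (exp (2 * u))) * exp (of_real u * s)" for u
  define A where "A u = complex_of_real (theta_kernel u) * exp (of_real u * s)" for u
  define B where "B u = complex_of_real (theta_kernel u) * exp (of_real u * (1 - s))" for u
  define E where "E z u = indicator {0..} u *\<^sub>R exp (- (of_real u * z))" for z :: complex and u :: real
  have iA: "integrable lborel A" and iB: "integrable lborel B"
    unfolding A_def B_def by (rule theta_laplace_integrable)+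
  have iE: "integrable lborel (E (s - 1))" "(\<integral>u. E (s - 1) u \<partial>lborel) = 1 / (s - 1)"
    "integrable lborel (E s)" "(\<integral>u. E s u \<partial>lborel) = 1 / s"
    unfolding E_def using integral_exp_half_line[of "s - 1"] integral_exp_half_line[of s] s by auto
  have iH: "integrable lborel H" unfolding H_def by (rule half_theta_mellin(1)[OF s])
  have iHA: "integrable lborel (\<lambda>u. H u - A u)" by (intro Bochner_Integration.integrable_diff iH iA)
  have "(\<integral>u. H u - A u \<partial>lborel) = (\<integral>u. H (0 + (-1) * u) - A (0 + (-1) * u) \<partial>lborel)"
    by (subst lborel_integral_real_affine[of "-1" _ 0]) auto
  also have "\<dots> = (\<integral>u. B u + (E (s - 1) u - E s u) / 2 \<partial>lborel)"
  proof (rule integral_cong_AE)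
    have "AE u in lborel. u \<noteq> (0::real)" by (rule AE_lborel_singleton)
    then show "AE u in lborel. H (0 + (-1) * u) - A (0 + (-1) * u) = B u + (E (s - 1) u - E s u) / 2"
    proof eventually_elim
      case (elim u)
      show ?case
      proof (cases "u > 0")
        case True
        have e1: "exp (- (of_real u * s)) * complex_of_real (exp u) = exp (of_real u * (1 - s))"
          by (simp add: exp_of_real[symmetric] exp_add[symmetric] algebra_simps del: exp_of_real)
        have e2: "exp (- (of_real u * (s - 1))) = exp (of_real u * (1 - s))" by (simp add: algebra_simps)
        have "H (- u) = exp (- (of_real u * s)) * of_real (exp u * half_theta (exp (2 * u)) + (exp u - 1) / 2)"
          unfolding H_def half_theta_exp_minus by simp
        also have "\<dots> = (exp (- (of_real u * s)) * complex_of_real (exp u)) * of_real (half_theta (exp (2 * u)))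
            + ((exp (- (of_real u * s)) * complex_of_real (exp u)) - exp (- (of_real u * s))) / 2"
          by (simp add: algebra_simps diff_divide_distrib)
        also have "\<dots> = B u + (E (s - 1) u - E s u) / 2"
          unfolding e1 using True by (simp add: B_def E_def theta_kernel_def e2 mult.commute)
        finally show ?thesis using True by (simp add: A_def theta_kernel_def)
      next
        case False
        then show ?thesis using elim by (simp add: A_def B_def E_def H_def theta_kernel_def)
      qed
    qed
    show "(\<lambda>u. H (0 + (-1) * u) - A (0 + (-1) * u)) \<in> borel_measurable lborel" unfolding H_def A_def by measurable
    show "(\<lambda>u. B u + (E (s - 1) u - E s u) / 2) \<in> borel_measurable lborel" unfolding B_def E_def by measurable
  qed
  also have "\<dots> = theta_laplace (1 - s) + (1 / (s - 1) - 1 / s) / 2"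
    using iB iE by (simp add: theta_laplace_def B_def[symmetric])
  finally have "(\<integral>u. H u \<partial>lborel) - (\<integral>u. A u \<partial>lborel) = theta_laplace (1 - s) + (1 / (s - 1) - 1 / s) / 2"
    using iH iA by simp
  moreover have "(\<integral>u. A u \<partial>lborel) = theta_laplace s" by (simp add: A_def theta_laplace_def)
  ultimately show ?thesis unfolding H_def by (simp add: algebra_simps)
qed

text \<open>\<open>rGamma (s / 2 + 1) / 2\<close> is \<open>rGamma (s / 2) / s\<close> without the singularity at 0.\<close>
definition zeta_explicit :: "complex \<Rightarrow> complex" where
  "zeta_explicit s = (if s = 1 then 0 else exp (s / 2 * of_real (ln pi)) *
     (rGamma (s / 2) * (2 * (theta_laplace s + theta_laplace (1 - s)) + 1 / (s - 1)) - rGamma (s / 2 + 1) / 2))"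

lemma zeta_explicit_holomorphic: "zeta_explicit holomorphic_on (- {1})"
proof (rule holomorphic_transform)
  show "(\<lambda>s. exp (s / 2 * of_real (ln pi)) *
     (rGamma (s / 2) * (2 * (theta_laplace s + theta_laplace (1 - s)) + 1 / (s - 1)) - rGamma (s / 2 + 1) / 2)) holomorphic_on - {1}"
    by (intro holomorphic_intros theta_laplace_holomorphic theta_laplace_reflect_holomorphic) auto
qed (auto simp: zeta_explicit_def)

lemma pi_powr_exp: "of_real pi powr z = exp (z * of_real (ln pi))" for z :: complex
  by (simp add: powr_def Ln_of_real)

section \<open>Identification of zeta and xi with the explicit formulas\<close>

text \<open>The second assumption keeps away from the poles of the Gamma factor, where
  \<open>Gamma\<close> has the default value 0 and the product would vanish for the wrong
  reason.\<close>

lemma zeta_explicit_Xi: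
  assumes "s \<noteq> 1" "s / 2 \<notin> \<int>\<^sub>\<le>\<^sub>0"
  shows "1 / 2 * a_fun s * zeta_explicit s = Xi s"
proof -
  have s0: "s \<noteq> 0" using assms by auto
  have rG: "rGamma (s / 2 + 1) = rGamma (s / 2) * (2 / s)"
    using rGamma_plus1[of "s / 2"] s0 by (simp add: field_simps)
  have GG: "Gamma (s / 2) * rGamma (s / 2) = 1"
    using assms by (simp add: rGamma_inverse_Gamma Gamma_eq_zero_iff)
  have PP: "of_real pi powr (- s / 2) * exp (s / 2 * of_real (ln pi)) = (1 :: complex)"
    by (simp add: pi_powr_exp exp_add[symmetric])
  have "1 / 2 * a_fun s * zeta_explicit s = (of_real pi powr (- s / 2) * exp (s / 2 * of_real (ln pi))) * (Gamma (s / 2) * rGamma (s / 2))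
      * (1 / 2 * s * (s - 1) * (2 * (theta_laplace s + theta_laplace (1 - s)) + 1 / (s - 1) - 1 / s))"
  proof -
    have "E * (R * (2 * T + 1 / (s - 1)) - R * (2 / s) / 2) = E * R * (2 * T + 1 / (s - 1) - 1 / s)" for E R T
      by (simp add: algebra_simps)
    note i = this
    show ?thesis using assms(1) unfolding a_fun_def zeta_explicit_def rG
      by (simp only: if_False i) (simp only: mult_ac)
  qed
  also have "\<dots> = Xi s" unfolding GG PP Xi_def using s0 assms(1) by (simp add: field_simps)
  finally show ?thesis .
qed

lemma zeta_explicit_dirichlet:
  assumes s: "Re s > 1"
  shows "zeta_explicit s = (\<Sum>n. 1 / of_nat (Suc n) powr s)"
proof -
  have s0: "s \<noteq> 0" "s \<noteq> 1" using s by auto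
  have ni: "s / 2 \<notin> \<int>\<^sub>\<le>\<^sub>0" using s by (auto elim!: nonpos_Ints_cases' simp: complex_eq_iff)
  have "a_fun s * zeta_explicit s = 2 * Xi s" using zeta_explicit_Xi[OF s0(2) ni] by simp
  also have "\<dots> = 2 * s * (s - 1) * (theta_laplace s + theta_laplace (1 - s) + (1 / (s - 1) - 1 / s) / 2)"
    unfolding Xi_def using s0 by (simp add: field_simps)
  also have "\<dots> = 2 * s * (s - 1) * (of_real pi powr (- s / 2) * Gamma (s / 2) / 2 * (\<Sum>n. 1 / of_nat (Suc n) powr s))"
    unfolding half_theta_mellin_split[OF s, symmetric] half_theta_mellin(2)[OF s] by simp
  also have "\<dots> = a_fun s * (\<Sum>n. 1 / of_nat (Suc n) powr s)" by (simp add: a_fun_def)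
  finally have "a_fun s * zeta_explicit s = a_fun s * (\<Sum>n. 1 / of_nat (Suc n) powr s)" .
  moreover have "a_fun s \<noteq> 0" using s0 ni by (simp add: a_fun_def Gamma_eq_zero_iff)
  ultimately show ?thesis by simp
qed

text \<open>The plane without the point 1 is connected, so the identity theorem propagates agreement
  from the half plane Re s > 1 and makes the description unique.\<close>

lemma zeta_eq_explicit: "zeta = zeta_explicit"
  unfolding zeta_def
proof (rule the_equality)
  show "zeta_explicit holomorphic_on (- {1}) \<and>
     (\<forall>s. Re s > 1 \<longrightarrow> zeta_explicit s = (\<Sum>n. 1 / of_nat (Suc n) powr s)) \<and> zeta_explicit 1 = 0"
    using zeta_explicit_holomorphic zeta_explicit_dirichlet by (simp add: zeta_explicit_def)
  fix g assume g: "g holomorphic_on (- {1}) \<and>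
     (\<forall>s. Re s > 1 \<longrightarrow> g s = (\<Sum>n. 1 / of_nat (Suc n) powr s)) \<and> g 1 = 0"
  show "g = zeta_explicit"
  proof
    fix s
    show "g s = zeta_explicit s"
    proof (cases "s = 1")
      case True then show ?thesis using g by (simp add: zeta_explicit_def)
    next
      case False
      show ?thesis
      proof (rule analytic_continuation_open[of "{s. Re s > 1}" "- {1}" g zeta_explicit])
        show "open {s. Re s > 1}" by (rule open_halfspace_Re_gt)
        have "(2::complex) \<in> {s. Re s > 1}" by simp
        then show "{s. Re s > 1} \<noteq> {}" by blast
        show "connected (- {1::complex})" by (rule connected_punctured_universe) simp
      qed (use g zeta_explicit_holomorphic zeta_explicit_dirichlet False in auto)
    qed
  qed
qed

lemma zeta_holomorphic: "zeta holomorphic_on (- {1})"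
  unfolding zeta_eq_explicit by (rule zeta_explicit_holomorphic)

lemma zeta_dirichlet: "Re s > 1 \<Longrightarrow> zeta s = (\<Sum>n. 1 / of_nat (Suc n) powr s)"
  unfolding zeta_eq_explicit by (rule zeta_explicit_dirichlet)

text \<open>The defining product agrees with \<open>Xi\<close> off a set of integers, which is
  discrete; so the limits taken by \<open>remove_sings\<close> are the values of
  \<open>Xi\<close>.\<close>

lemma xi_eq_Xi: "xi = Xi"
proof
  fix z
  define S :: "complex set" where "S = insert 1 {s. s / 2 \<in> \<int>\<^sub>\<le>\<^sub>0}"
  have "\<forall>\<^sub>F s in at z. s \<notin> S"
  proof -
    have "{s::complex. s / 2 \<in> \<int>\<^sub>\<le>\<^sub>0} \<subseteq> \<int>"
    proof
      fix s :: complex assume "s \<in> {s. s / 2 \<in> \<int>\<^sub>\<le>\<^sub>0}"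
      then obtain n where "s / 2 = - of_nat n" by (auto elim!: nonpos_Ints_cases')
      then have "s = - of_nat n * 2" by (metis nonzero_divide_eq_eq zero_neq_numeral)
      then show "s \<in> \<int>" by (simp only:) auto
    qed
    then have "S \<subseteq> \<int>" by (auto simp: S_def)
    moreover have "\<forall>\<^sub>F s in nhds z. s \<in> - (\<int> - {z})"
    proof (rule eventually_nhds_in_open)
      have "closed (\<int> - {z})" by (rule closed_subset_Ints) blast
      then show "open (- (\<int> - {z}))" by (rule open_Compl)
    qed simp
    then have "\<forall>\<^sub>F s in at z. s \<notin> \<int>"
      unfolding eventually_at_filter by (rule eventually_mono) auto
    ultimately show ?thesis by (auto elim!: eventually_mono)
  qed
  then have "\<forall>\<^sub>F s in at z. Xi s = 1 / 2 * a_fun s * zeta s"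
  proof eventually_elim
    case (elim s)
    then show ?case using zeta_explicit_Xi[of s] by (simp add: S_def zeta_eq_explicit)
  qed
  moreover have "Xi \<midarrow>z\<rightarrow> Xi z"
    using Xi_holomorphic[of UNIV] by (metis holomorphic_on_imp_continuous_on continuous_on_eq_continuous_at open_UNIV UNIV_I isCont_def)
  ultimately have "(\<lambda>s. 1 / 2 * a_fun s * zeta s) \<midarrow>z\<rightarrow> Xi z"
    by (rule Lim_transform_eventually[rotated])
  then show "xi z = Xi z" unfolding xi_def by (rule remove_sings_eqI)
qed

lemma xi_eq_mult_zeta:
  assumes "Im s \<noteq> 0 \<or> Re s > 1"
  shows "xi s = 1 / 2 * a_fun s * zeta s" "a_fun s \<noteq> 0"
proof -
  have s: "s \<noteq> 1" "s \<noteq> 0" using assms by auto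
  have ni: "s / 2 \<notin> \<int>\<^sub>\<le>\<^sub>0" using assms by (auto elim!: nonpos_Ints_cases' simp: complex_eq_iff)
  show "xi s = 1 / 2 * a_fun s * zeta s"
    using zeta_explicit_Xi[OF s(1) ni] by (simp add: xi_eq_Xi zeta_eq_explicit)
  show "a_fun s \<noteq> 0" using s ni by (simp add: a_fun_def Gamma_eq_zero_iff)
qed

section \<open>A lower bound for the Gamma function\<close>

text \<open>y / (y^2 + t^2) is the real part of 1 / (y + i t), a term of the Digamma series. Over a
  unit step its primitive differs from it by a quantity that is summable along y, y + 1, y + 2 and
  so on.\<close>

lemma harmonic_step:
  fixes y t :: real assumes "y \<ge> 0" "t > 0"
  shows "\<bar>(ln ((y+1)\<^sup>2 + t\<^sup>2) / 2 - ln (y\<^sup>2 + t\<^sup>2) / 2) - y / (y\<^sup>2 + t\<^sup>2)\<bar> \<le> 1 / (y\<^sup>2 + t\<^sup>2)"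
proof -
  have d: "((\<lambda>v. ln (v\<^sup>2 + t\<^sup>2) / 2) has_real_derivative v / (v\<^sup>2 + t\<^sup>2)) (at v)" for v
  proof -
    have "v\<^sup>2 + t\<^sup>2 > 0" using assms by (simp add: add_nonneg_pos)
    moreover have "((\<lambda>v. v\<^sup>2 + t\<^sup>2) has_real_derivative 2 * v) (at v)"
      by (auto intro!: derivative_eq_intros)
    ultimately have "((\<lambda>v. ln (v\<^sup>2 + t\<^sup>2) / 2) has_real_derivative inverse (v\<^sup>2 + t\<^sup>2) * (2 * v) / 2) (at v)"
      by (intro DERIV_cdivide DERIV_chain2[OF DERIV_ln])
    moreover have "inverse w * (2 * v) / 2 = v / w" for w by (cases "w = 0") (auto simp: field_simps)
    ultimately show ?thesis by (simp only:)
  qed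
  have "\<exists>a>y. a < y + 1 \<and>
      ln ((y+1)\<^sup>2 + t\<^sup>2) / 2 - ln (y\<^sup>2 + t\<^sup>2) / 2 = (y + 1 - y) * (a / (a\<^sup>2 + t\<^sup>2))"
    by (rule MVT2[OF _ d]) simp
  then obtain a where a: "y < a" "a < y + 1"
    "ln ((y+1)\<^sup>2 + t\<^sup>2) / 2 - ln (y\<^sup>2 + t\<^sup>2) / 2 = (y + 1 - y) * (a / (a\<^sup>2 + t\<^sup>2))"
    by blast
  have p: "a\<^sup>2 + t\<^sup>2 > 0" "y\<^sup>2 + t\<^sup>2 > 0" using assms by (simp_all add: add_nonneg_pos)
  have "a / (a\<^sup>2 + t\<^sup>2) - y / (y\<^sup>2 + t\<^sup>2) = (a - y) * (t\<^sup>2 - a * y) / ((a\<^sup>2 + t\<^sup>2) * (y\<^sup>2 + t\<^sup>2))"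
    using p by (subst diff_frac_eq) (auto simp: algebra_simps power2_eq_square)
  moreover have "\<bar>(a - y) * (t\<^sup>2 - a * y)\<bar> \<le> 1 * (a\<^sup>2 + t\<^sup>2)"
    unfolding abs_mult
  proof (rule mult_mono)
    have "a * y \<le> a * a" using a assms by (intro mult_left_mono) auto
    moreover have "a * y \<ge> 0" using a assms by auto
    ultimately show "\<bar>t\<^sup>2 - a * y\<bar> \<le> a\<^sup>2 + t\<^sup>2"
      using zero_le_square[of a] zero_le_square[of t] unfolding power2_eq_square by linarith
  qed (use a in auto)
  ultimately have "\<bar>a / (a\<^sup>2 + t\<^sup>2) - y / (y\<^sup>2 + t\<^sup>2)\<bar> \<le> (a\<^sup>2 + t\<^sup>2) / ((a\<^sup>2 + t\<^sup>2) * (y\<^sup>2 + t\<^sup>2))"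
    using mult_pos_pos[OF p] by (simp only: abs_divide abs_of_pos) (intro divide_right_mono, auto)
  moreover have n: "a\<^sup>2 + t\<^sup>2 \<noteq> 0" using p by linarith
  ultimately show ?thesis
    using nonzero_mult_divide_mult_cancel_left[OF n, of 1 "y\<^sup>2 + t\<^sup>2"] a(3)
    by (simp only: mult_1_right mult_1_left add_diff_cancel_left')
qed

text \<open>The sum is compared with the integral step by step. The range of \<sigma> is that of
  (1/2 + Re s) / 2 for 0 <= Re s <= 2, the argument at which Gamma enters n.\<close>

lemma Re_Digamma_approx_ln:
  "\<exists>C\<ge>0. \<forall>\<sigma> t. 1/4 \<le> \<sigma> \<and> \<sigma> \<le> 5/4 \<and> t \<ge> 1/2 \<longrightarrow> \<bar>Re (Digamma (Complex \<sigma> t)) - ln t\<bar> \<le> C"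
proof -
  have sq: "summable (\<lambda>n. 4 / (real n + 1)\<^sup>2)"
    using summable_mult[OF sums_summable[OF inverse_squares_sums], of 4] by (simp add: add.commute)
  define S where "S = (\<Sum>n. 4 / (real n + 1)\<^sup>2)"
  have S0: "S \<ge> 0" unfolding S_def by (intro suminf_nonneg sq) auto
  have main: "\<bar>Re (Digamma (Complex \<sigma> t)) - ln t\<bar> \<le> S + 13"
    if st: "1/4 \<le> \<sigma>" "\<sigma> \<le> 5/4" "t \<ge> 1/2" for \<sigma> t
  proof -
    define Q where "Q y = ln (y\<^sup>2 + t\<^sup>2) / 2" for y
    define q where "q y = y / (y\<^sup>2 + t\<^sup>2)" for y
    have t0: "t > 0" using st by auto
    have nz: "Complex \<sigma> t \<noteq> 0" using t0 by (simp add: complex_eq_iff)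
    have "(\<lambda>m. Re (of_real (ln (real m)) - (\<Sum>n<m. inverse (Complex \<sigma> t + of_nat n)))) \<longlonglongrightarrow> Re (Digamma (Complex \<sigma> t))"
      by (intro tendsto_Re Digamma_LIMSEQ nz)
    then have l1: "(\<lambda>m. ln (real m) - (\<Sum>n<m. q (\<sigma> + real n))) \<longlonglongrightarrow> Re (Digamma (Complex \<sigma> t))"
      by (simp add: q_def)
    \<comment> \<open>Exchanging ln m for \<open>Q (\<sigma> + real m)\<close> does not change the
      limit and lets the comparison telescope.\<close>
    have l2: "(\<lambda>m. Q (\<sigma> + real m) - ln (real m)) \<longlonglongrightarrow> 0"
      unfolding Q_def by real_asymp
    have l3: "(\<lambda>m. Q (\<sigma> + real m) - (\<Sum>n<m. q (\<sigma> + real n))) \<longlonglongrightarrow> Re (Digamma (Complex \<sigma> t))"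
      using tendsto_add[OF l1 l2] by simp
    have l4: "(\<lambda>m. (Q (\<sigma> + real m) - (\<Sum>n<m. q (\<sigma> + real n))) - Q \<sigma>) \<longlonglongrightarrow> Re (Digamma (Complex \<sigma> t)) - Q \<sigma>"
      by (intro tendsto_intros l3)
    have b: "\<bar>(Q (\<sigma> + real m) - (\<Sum>n<m. q (\<sigma> + real n))) - Q \<sigma>\<bar> \<le> S" for m
    proof -
      have "(\<Sum>n<m. Q (\<sigma> + real (Suc n)) - Q (\<sigma> + real n)) = Q (\<sigma> + real m) - Q (\<sigma> + real 0)"
        by (rule sum_lessThan_telescope)
      then have "(Q (\<sigma> + real m) - (\<Sum>n<m. q (\<sigma> + real n))) - Q \<sigma>
        = (\<Sum>n<m. (Q (\<sigma> + real (Suc n)) - Q (\<sigma> + real n)) - q (\<sigma> + real n))"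
        by (simp add: sum_subtractf)
      also have "\<bar>\<dots>\<bar> \<le> (\<Sum>n<m. \<bar>(Q (\<sigma> + real (Suc n)) - Q (\<sigma> + real n)) - q (\<sigma> + real n)\<bar>)"
        by (rule sum_abs)
      also have "\<dots> \<le> (\<Sum>n<m. 4 / (real n + 1)\<^sup>2)"
      proof (rule sum_mono)
        fix n
        have e: "\<sigma> + real (Suc n) = (\<sigma> + real n) + 1" by simp
        have "\<bar>(Q (\<sigma> + real (Suc n)) - Q (\<sigma> + real n)) - q (\<sigma> + real n)\<bar> \<le> 1 / ((\<sigma> + real n)\<^sup>2 + t\<^sup>2)"
          unfolding Q_def q_def e by (rule harmonic_step) (use st in auto)
        also have "\<dots> \<le> 1 / ((real n)\<^sup>2 + (1/2)\<^sup>2)"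
          using st by (intro divide_left_mono add_mono power_mono mult_pos_pos add_nonneg_pos) auto
        also have "\<dots> \<le> 4 / (real n + 1)\<^sup>2"
        proof -
          have "real n * (3 * real n - 2) \<ge> 0" by (cases n) auto
          then have "(real n + 1)\<^sup>2 \<le> 4 * ((real n)\<^sup>2 + (1/2)\<^sup>2)"
            by (simp add: power2_eq_square algebra_simps)
          moreover have "(real n)\<^sup>2 + (1/2)\<^sup>2 > 0" by (intro add_nonneg_pos) auto
          ultimately show ?thesis by (simp add: divide_simps)
        qed
        finally show "\<bar>(Q (\<sigma> + real (Suc n)) - Q (\<sigma> + real n)) - q (\<sigma> + real n)\<bar> \<le> 4 / (real n + 1)\<^sup>2" .
      qed
      also have "\<dots> \<le> S" unfolding S_def by (rule sum_le_suminf[OF sq]) auto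
      finally show ?thesis .
    qed
    have b1: "\<bar>Re (Digamma (Complex \<sigma> t)) - Q \<sigma>\<bar> \<le> S"
      by (rule LIMSEQ_le_const2[OF tendsto_rabs[OF l4]]) (use b in auto)
    have "Q \<sigma> - ln t = ln (1 + (\<sigma>/t)\<^sup>2) / 2"
    proof -
      have "\<sigma>\<^sup>2 + t\<^sup>2 = t\<^sup>2 * (1 + (\<sigma>/t)\<^sup>2)" using t0 by (simp add: power_divide field_simps)
      moreover have "ln (t\<^sup>2 * (1 + (\<sigma>/t)\<^sup>2)) = ln (t\<^sup>2) + ln (1 + (\<sigma>/t)\<^sup>2)"
        using t0 by (intro ln_mult_pos add_pos_nonneg) auto
      moreover have "ln (t\<^sup>2) = 2 * ln t" using t0 by (simp add: ln_realpow)
      ultimately show ?thesis unfolding Q_def by (simp only:) (simp add: field_simps)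
    qed
    moreover have "ln (1 + (\<sigma>/t)\<^sup>2) \<le> (\<sigma>/t)\<^sup>2" by (rule ln_add_one_self_le_self) auto
    moreover have "(\<sigma>/t)\<^sup>2 \<le> (5/2)\<^sup>2"
      using st by (intro power_mono) (auto simp: field_simps)
    moreover have "ln (1 + (\<sigma>/t)\<^sup>2) \<ge> 0" by (intro ln_ge_zero) auto
    moreover have "(5/2)\<^sup>2 = (25/4 :: real)" by (simp add: power2_eq_square)
    ultimately have "\<bar>Q \<sigma> - ln t\<bar> \<le> 13" by linarith
    with b1 show ?thesis by linarith
  qed
  show ?thesis by (rule exI[of _ "S+13"]) (use main S0 in auto)
qed

lemma norm_Gamma_half_line:
  "(cmod (Gamma (Complex (1/2) t)))\<^sup>2 = pi / cosh (pi * t)"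
proof -
  let ?z = "Complex (1/2) t"
  have e: "1 - ?z = cnj ?z" by (simp add: complex_eq_iff)
  have "Gamma ?z * cnj (Gamma ?z) = of_real pi / sin (of_real pi * ?z)"
    using Gamma_reflection_complex[of ?z] by (simp only: e cnj_Gamma)
  moreover have "sin (of_real pi * ?z) = of_real (cosh (pi * t))"
  proof -
    have "of_real pi * ?z = of_real pi / 2 - (- (\<i> * of_real (pi * t)))"
      by (simp add: complex_eq_iff)
    then have "sin (of_real pi * ?z) = cos (- (\<i> * of_real (pi * t)))"
      by (metis sin_cos_eq[of "of_real pi / 2 - (- (\<i> * of_real (pi * t)))"] add_diff_cancel_left' cos_minus diff_minus_eq_add minus_diff_eq cos_sin_eq)
    then show ?thesis
      by (simp add: cos_exp_eq cosh_def exp_of_real[symmetric] scaleR_conv_of_real)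
  qed
  ultimately have "Gamma ?z * cnj (Gamma ?z) = of_real (pi / cosh (pi * t))" by simp
  then have "of_real ((cmod (Gamma ?z))\<^sup>2) = (of_real (pi / cosh (pi * t)) :: complex)"
    by (simp only: complex_norm_square)
  then show ?thesis by (simp only: of_real_eq_iff)
qed

text \<open>A substitute for Stirling's formula: start from the exact modulus on Re = 1/2 and move
  horizontally. The derivative of log |Gamma| in that direction is the real part of Digamma, that is
  ln t up to a bounded error, and the distance is at most 1.\<close>

lemma norm_Gamma_lower_bound:
  "\<exists>c>0. \<forall>\<sigma> t. 1/4 \<le> \<sigma> \<and> \<sigma> \<le> 5/4 \<and> t \<ge> 1/2 \<longrightarrow>
     cmod (Gamma (Complex \<sigma> t)) \<ge> c * t powr (\<sigma> - 1/2) * exp (- pi * t / 2)"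
proof -
  obtain C where C: "C \<ge> 0" and CD: "\<And>\<sigma> t. 1/4 \<le> \<sigma> \<Longrightarrow> \<sigma> \<le> 5/4 \<Longrightarrow> t \<ge> 1/2 \<Longrightarrow> \<bar>Re (Digamma (Complex \<sigma> t)) - ln t\<bar> \<le> C"
    using Re_Digamma_approx_ln by blast
  have main: "cmod (Gamma (Complex \<sigma> t)) \<ge> exp (-C) * t powr (\<sigma> - 1/2) * exp (- pi * t / 2)"
    if st: "1/4 \<le> \<sigma>" "\<sigma> \<le> 5/4" "t \<ge> 1/2" for \<sigma> t
  proof -
    have t0: "t > 0" using st by auto
    define \<phi> where "\<phi> x = Re (ln_Gamma (Complex x t))" for x
    have nn: "Complex x t \<notin> \<real>\<^sub>\<le>\<^sub>0" for x using t0 by (auto simp: complex_nonpos_Reals_iff)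
    have G: "cmod (Gamma (Complex x t)) = exp (\<phi> x)" for x
    proof -
      have "Complex x t \<notin> \<int>\<^sub>\<le>\<^sub>0" using nn nonpos_Ints_subset_nonpos_Reals by blast
      then have "exp (ln_Gamma (Complex x t)) = Gamma (Complex x t)" by (simp add: Gamma_complex_altdef)
      then show ?thesis unfolding \<phi>_def by (metis norm_exp_eq_Re)
    qed
    have D: "(\<phi> has_real_derivative Re (Digamma (Complex x t))) (at x)" for x
    proof -
      have "((\<lambda>x. Complex x t) has_vector_derivative 1) (at x)"
        unfolding Complex_eq by (auto intro!: derivative_eq_intros)
      then have "(ln_Gamma \<circ> (\<lambda>x. Complex x t) has_vector_derivative 1 * Digamma (Complex x t)) (at x)"
        by (rule field_vector_diff_chain_at) (intro has_field_derivative_ln_Gamma_complex nn)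
      then have "((\<lambda>x. Re ((ln_Gamma \<circ> (\<lambda>x. Complex x t)) x)) has_vector_derivative Re (1 * Digamma (Complex x t))) (at x)"
        by (rule bounded_linear.has_vector_derivative[OF bounded_linear_Re])
      then show ?thesis by (simp add: \<phi>_def[abs_def] o_def has_real_derivative_iff_has_vector_derivative)
    qed
    have key: "\<phi> \<sigma> - \<phi> (1/2) \<ge> (\<sigma> - 1/2) * ln t - C"
    proof (cases "\<sigma> = 1/2")
      case True then show ?thesis using C by (simp only:) simp
    next
      case False
      obtain z where z: "z \<ge> 1/4" "z \<le> 5/4" "\<phi> \<sigma> - \<phi> (1/2) = (\<sigma> - 1/2) * Re (Digamma (Complex z t))"
      proof (cases "\<sigma> < 1/2")
        case True
        have "\<exists>z>\<sigma>. z < 1/2 \<and> \<phi> (1/2) - \<phi> \<sigma> = (1/2 - \<sigma>) * Re (Digamma (Complex z t))"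
          by (rule MVT2[OF True D])
        then obtain z where "\<sigma> < z" "z < 1/2" "\<phi> (1/2) - \<phi> \<sigma> = (1/2 - \<sigma>) * Re (Digamma (Complex z t))"
          by blast
        then show ?thesis using st True by (intro that[of z]) (auto simp: algebra_simps)
      next
        case F: False
        then have l: "1/2 < \<sigma>" using False by auto
        have "\<exists>z>1/2. z < \<sigma> \<and> \<phi> \<sigma> - \<phi> (1/2) = (\<sigma> - 1/2) * Re (Digamma (Complex z t))"
          by (rule MVT2[OF l D])
        then obtain z where "1/2 < z" "z < \<sigma>" "\<phi> \<sigma> - \<phi> (1/2) = (\<sigma> - 1/2) * Re (Digamma (Complex z t))"
          by blast
        then show ?thesis using st l by (intro that[of z]) auto
      qed
      have "\<bar>(\<sigma> - 1/2) * (Re (Digamma (Complex z t)) - ln t)\<bar> \<le> 1 * C"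
        unfolding abs_mult by (rule mult_mono) (use CD[of z t] z st in auto)
      then show ?thesis using z by (simp add: algebra_simps)
    qed
    have h: "exp (\<phi> (1/2)) \<ge> exp (- pi * t / 2)"
    proof -
      have "cosh (pi * t) \<le> exp (pi * t)" using t0 by (simp add: cosh_def)
      then have "pi / exp (pi * t) \<le> pi / cosh (pi * t)" by (intro divide_left_mono) (auto intro: mult_pos_pos cosh_real_pos)
      then have "(exp (\<phi> (1/2)))\<^sup>2 \<ge> pi * exp (- (pi * t))"
        unfolding G[symmetric] norm_Gamma_half_line by (simp add: exp_minus divide_inverse)
      moreover have "pi * exp (- (pi * t)) \<ge> 1 * exp (- (pi * t))"
        using pi_gt3 by (intro mult_right_mono) auto
      moreover have "exp (- (pi * t)) = (exp (- pi * t / 2))\<^sup>2"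
        by (simp add: power2_eq_square exp_add[symmetric])
      ultimately have "(exp (- pi * t / 2))\<^sup>2 \<le> (exp (\<phi> (1/2)))\<^sup>2" by linarith
      then show ?thesis by (rule power2_le_imp_le) auto
    qed
    have "exp (-C) * t powr (\<sigma> - 1/2) * exp (- pi * t / 2) \<le> exp ((\<sigma> - 1/2) * ln t - C) * exp (\<phi> (1/2))"
    proof -
      have eq: "exp (-C) * t powr (\<sigma> - 1/2) = exp ((\<sigma> - 1/2) * ln t - C)"
        using t0 by (simp add: powr_def exp_add[symmetric])
      show ?thesis unfolding eq by (rule mult_left_mono[OF h]) simp
    qed
    also have "\<dots> \<le> exp (\<phi> \<sigma> - \<phi> (1/2)) * exp (\<phi> (1/2))" using key by (intro mult_right_mono) auto
    also have "\<dots> = cmod (Gamma (Complex \<sigma> t))" by (simp add: G exp_add[symmetric])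
    finally show ?thesis .
  qed
  show ?thesis by (rule exI[of _ "exp (-C)"]) (use main in auto)
qed

section \<open>Entire functions with finitely many zeros\<close>

text \<open>The map g -> g / (2 A - g) carries the half plane Re g < A into the unit disc and fixes
  0. The Schwarz lemma bounds the image, and solving for g gives the estimate.\<close>

lemma borel_caratheodory:
  assumes hol: "f holomorphic_on ball c R" and A: "A > 0" and R: "R > 0"
    and le: "\<And>z. z \<in> ball c R \<Longrightarrow> Re (f z - f c) < A" and z: "z \<in> ball c R"
  shows "cmod (f z - f c) \<le> 2 * A * dist c z / (R - dist c z)"
proof -
  define g where "g w = f (c + of_real R * w) - f c" for w
  define h where "h w = g w / (2 * of_real A - g w)" for w
  have inb: "c + of_real R * w \<in> ball c R" if "cmod w < 1" for w
    using that R by (simp add: dist_norm norm_mult)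
  have Reg: "Re (g w) < A" if "cmod w < 1" for w
    unfolding g_def by (rule le[OF inb[OF that]])
  have nz: "2 * of_real A - g w \<noteq> 0" if "cmod w < 1" for w
  proof
    assume "2 * of_real A - g w = 0"
    then have "Re (2 * of_real A - g w) = 0" by simp
    then show False using Reg[OF that] A by simp
  qed
  have holg: "g holomorphic_on ball 0 1"
    unfolding g_def
    by (intro holomorphic_intros holomorphic_on_compose_gen[OF _ hol, unfolded o_def]) (auto intro!: inb)
  have holh: "h holomorphic_on ball 0 1"
    unfolding h_def by (intro holomorphic_intros holg) (use nz in auto)
  have h0: "h 0 = 0" by (simp add: h_def g_def)
  have hlt: "cmod (h w) < 1" if "cmod w < 1" for w
  proof -
    have "(cmod (g w))\<^sup>2 < (cmod (2 * of_real A - g w))\<^sup>2"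
      unfolding cmod_power2 using Reg[OF that] A
      by (simp add: power2_eq_square algebra_simps)
    then have "cmod (g w) < cmod (2 * of_real A - g w)" by (rule power2_less_imp_less) auto
    then show ?thesis by (simp add: h_def norm_divide divide_simps)
  qed
  define w where "w = (z - c) / of_real R"
  have w: "cmod w < 1" "z = c + of_real R * w" "dist c z = R * cmod w"
    using z R by (auto simp: w_def norm_divide dist_norm norm_minus_commute)
  have hw: "cmod (h w) \<le> cmod w"
    by (rule Schwarz_Lemma(1)[OF holh h0 hlt w(1)])
  have "g w * (1 + h w) = 2 * of_real A * h w"
    using nz[OF w(1)] by (simp add: h_def field_simps)
  then have "cmod (g w) * cmod (1 + h w) = 2 * A * cmod (h w)"
    using A by (metis (no_types) norm_mult norm_of_real abs_of_pos norm_numeral)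
  moreover have "cmod (1 + h w) \<ge> 1 - cmod w"
  proof -
    have "1 \<le> cmod (1 + h w) + cmod (h w)" using norm_triangle_ineq4[of "1 + h w" "h w"] by simp
    then show ?thesis using hw by linarith
  qed
  ultimately have "cmod (g w) * (1 - cmod w) \<le> 2 * A * cmod w"
    by (smt (verit) hw A mult_left_mono norm_ge_zero)
  then have "cmod (g w) \<le> 2 * A * cmod w / (1 - cmod w)" using w by (simp add: field_simps)
  also have "\<dots> = 2 * A * (R * cmod w) / (R - R * cmod w)"
  proof -
    have "R - R * cmod w = R * (1 - cmod w)" by (simp add: algebra_simps)
    then show ?thesis using R by simp
  qed
  finally show ?thesis using w by (simp add: g_def)
qed

lemma entire_divide_zero:
  fixes f :: "complex \<Rightarrow> complex"
  assumes "f holomorphic_on UNIV" "f a = 0" "f b \<noteq> 0"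
  obtains n g where "g holomorphic_on UNIV" "g a \<noteq> 0" "\<And>z. f z = (z - a) ^ n * g z"
proof -
  have nc: "\<not> f constant_on UNIV" using assms by (metis constant_on_def UNIV_I)
  obtain g0 r n where n: "0 < n" "0 < r" and g0: "g0 holomorphic_on ball a r"
     "\<And>w. w \<in> ball a r \<Longrightarrow> f w = (w - a) ^ n * g0 w" "\<And>w. w \<in> ball a r \<Longrightarrow> g0 w \<noteq> 0"
    using holomorphic_factor_zero_nonconstant[OF assms(1) open_UNIV connected_UNIV UNIV_I assms(2) nc] by metis
  define g where "g z = (if z \<in> ball a r then g0 z else f z / (z - a) ^ n)" for z
  have eq: "g z = f z / (z - a) ^ n" if "z \<noteq> a" for z
    using that g0(2)[of z] by (auto simp: g_def)
  have "g holomorphic_on ball a r"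
    using g0(1) by (rule holomorphic_transform) (auto simp: g_def)
  moreover have "g holomorphic_on (- {a})"
  proof (rule holomorphic_transform)
    show "(\<lambda>z. f z / (z - a) ^ n) holomorphic_on (- {a})"
      by (intro holomorphic_intros holomorphic_on_subset[OF assms(1)]) auto
  qed (use eq in auto)
  ultimately have "g holomorphic_on (ball a r \<union> - {a})" by (rule holomorphic_on_Un) auto
  moreover have "ball a r \<union> - {a} = UNIV" using n by auto
  ultimately have "g holomorphic_on UNIV" by simp
  moreover have "g a \<noteq> 0" using g0(3)[of a] n by (simp add: g_def)
  moreover have "f z = (z - a) ^ n * g z" for z
    using g0(2)[of a] n eq[of z] by (cases "z = a") (auto simp: assms(2))
  ultimately show ?thesis using that by blast
qed

lemma entire_finite_zeros_factor:
  fixes f :: "complex \<Rightarrow> complex"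
  assumes "finite Z" "f holomorphic_on UNIV" "Z = {z. f z = 0}"
  shows "\<exists>n g. g holomorphic_on UNIV \<and> (\<forall>z. g z \<noteq> 0) \<and> (\<forall>z. f z = (\<Prod>a\<in>Z. (z - a) ^ n a) * g z)"
  using assms
proof (induction Z arbitrary: f rule: finite_induct)
  case empty
  then show ?case by (intro exI[of _ "\<lambda>_. 0"] exI[of _ f]) auto
next
  case (insert a Z)
  have "f a = 0" using insert.prems by auto
  moreover have "infinite (UNIV :: complex set)" by (rule infinite_UNIV_char_0)

  then obtain b where "b \<notin> insert a Z" using insert.hyps by (metis ex_new_if_finite finite_insert)
  then have "f b \<noteq> 0" using insert.prems by auto
  ultimately obtain m g where g: "g holomorphic_on UNIV" "g a \<noteq> 0" "\<And>z. f z = (z - a) ^ m * g z"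
    using entire_divide_zero insert.prems(1) by metis
  have m: "m > 0" using g(2) g(3)[of a] \<open>f a = 0\<close> by (cases m) auto
  have "f z = 0 \<longleftrightarrow> z = a \<or> g z = 0" for z using g(3)[of z] m by auto
  then have "insert a Z = insert a {z. g z = 0}" using insert.prems by auto
  then have "Z = {z. g z = 0}"
    by (rule insert_ident[THEN iffD1, rotated 2]) (use insert.hyps g(2) in auto)
  then obtain n h where h: "h holomorphic_on UNIV" "\<forall>z. h z \<noteq> 0" "\<forall>z. g z = (\<Prod>a\<in>Z. (z - a) ^ n a) * h z"
    using insert.IH[OF g(1)] by blast
  have "f z = (\<Prod>b\<in>insert a Z. (z - b) ^ (n(a := m)) b) * h z" for z
  proof -
    have "(\<Prod>b\<in>Z. (z - b) ^ (n(a := m)) b) = (\<Prod>b\<in>Z. (z - b) ^ n b)"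
      using insert.hyps by (intro prod.cong) auto
    then show ?thesis using insert.hyps g(3)[of z] h(3) by (simp add: mult.assoc)
  qed
  then show ?case using h(1,2) by blast
qed

text \<open>In the product of the values at a + i t and a - i t the linear exponents add up to a
  constant, so the exponential factors contribute the fixed number \<open>E\<close>, which is not 0,
  while the polynomial factors are at least 1 in modulus for large t. The exponent 3/2 is one choice
  strictly between the order 1 of \<open>Xi\<close> and 2.\<close>

lemma entire_infinite_zeros:
  fixes f :: "complex \<Rightarrow> complex"
  assumes hol: "f holomorphic_on UNIV"
    and growth: "\<And>z. cmod z \<ge> 1 \<Longrightarrow> cmod (f z) \<le> exp (C * cmod z powr (3/2))"
    and decay: "((\<lambda>t. f (Complex a t) * f (Complex a (-t))) \<longlongrightarrow> 0) at_top"
  shows "infinite {z. f z = 0}"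
proof
  assume fin: "finite {z. f z = 0}"
  define Z where "Z = {z. f z = 0}"
  obtain n g where g: "g holomorphic_on UNIV" "\<And>z. g z \<noteq> 0" "\<And>z. f z = (\<Prod>a\<in>Z. (z - a) ^ n a) * g z"
    using entire_finite_zeros_factor[of Z f] hol fin Z_def by blast
  have finZ: "finite Z" using fin by (simp add: Z_def)
  obtain h where h: "h holomorphic_on UNIV" "\<And>z. g z = exp (h z)"
    using contractible_imp_holomorphic_log[OF g(1), of thesis] g(2) convex_imp_contractible[OF convex_UNIV] by auto
  \<comment> \<open>Circles of radius at least r keep distance at least 1 from all zeros. There the
    polynomial factor is at least 1 in modulus, so \<open>f\<close> dominates \<open>g\<close>, and
    the maximum principle extends the bound to the disc.\<close>
  obtain r where r: "r \<ge> 1" "\<And>a. a \<in> Z \<Longrightarrow> cmod a \<le> r - 1"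
  proof -
    obtain B where "\<forall>a\<in>Z. cmod a \<le> B" using finite_imp_bounded[OF finZ] by (auto simp: bounded_iff)
    then show ?thesis by (intro that[of "max 1 (B + 1)"]) auto
  qed
  define K where "K = max C 0"
  have P1: "cmod (\<Prod>a\<in>Z. (z - a) ^ n a) \<ge> 1" if "\<And>a. a \<in> Z \<Longrightarrow> cmod (z - a) \<ge> 1" for z
    unfolding prod_norm[symmetric] norm_power by (intro prod_ge_1 one_le_power that)
  have Reh: "Re (h z) \<le> K * \<rho> powr (3/2)" if z: "cmod z \<le> \<rho>" and \<rho>: "\<rho> \<ge> r" for z \<rho>
  proof -
    have "cmod (g z) \<le> exp (K * \<rho> powr (3/2))"
    proof (rule maximum_modulus_frontier[of g "cball 0 \<rho>"])
      show "z \<in> cball 0 \<rho>" using z by simp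
      fix w :: complex assume "w \<in> frontier (cball 0 \<rho>)"
      then have w: "cmod w = \<rho>" using r \<rho> by (simp add: dist_norm)
      have "cmod (w - a) \<ge> 1" if "a \<in> Z" for a
        using r(2)[OF that] w \<rho> norm_triangle_ineq2[of w a] by linarith
      then have 1: "cmod (\<Prod>a\<in>Z. (w - a) ^ n a) \<ge> 1" by (rule P1)
      have "cmod (g w) \<le> cmod (\<Prod>a\<in>Z. (w - a) ^ n a) * cmod (g w)"
        using mult_right_mono[OF 1, of "cmod (g w)"] by simp
      also have "\<dots> = cmod (f w)" by (simp add: g(3) norm_mult)
      also have "\<dots> \<le> exp (C * \<rho> powr (3/2))" using growth[of w] w \<rho> r by simp
      also have "\<dots> \<le> exp (K * \<rho> powr (3/2))" by (simp add: K_def mult_right_mono)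
      finally show "cmod (g w) \<le> exp (K * \<rho> powr (3/2))" .
    qed (auto intro: holomorphic_on_subset[OF g(1)] holomorphic_on_imp_continuous_on)
    then show ?thesis by (simp add: h(2))
  qed
  define H where "H z = h z - h 0" for z
  have Hbd: "cmod (H z) \<le> 2 * (K * (2 * \<rho>) powr (3/2) + \<bar>Re (h 0)\<bar> + 1)"
    if z: "cmod z = \<rho>" and \<rho>: "\<rho> \<ge> r" for z \<rho>
  proof -
    let ?A = "K * (2 * \<rho>) powr (3/2) + \<bar>Re (h 0)\<bar> + 1"
    have "cmod (h z - h 0) \<le> 2 * ?A * dist 0 z / (2 * \<rho> - dist 0 z)"
    proof (rule borel_caratheodory[where R = "2 * \<rho>"])
      show "?A > 0" by (intro add_nonneg_pos add_nonneg_nonneg mult_nonneg_nonneg) (auto simp: K_def)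
      fix w :: complex assume "w \<in> ball 0 (2 * \<rho>)"
      then have "Re (h w) \<le> K * (2 * \<rho>) powr (3/2)" using r \<rho> by (intro Reh) auto
      then show "Re (h w - h 0) < ?A" by simp
    qed (use z \<rho> r in \<open>auto intro: holomorphic_on_subset[OF h(1)]\<close>)
    also have "\<dots> = 2 * ?A" using z \<rho> r by (simp add: field_simps)
    finally show ?thesis by (simp add: H_def)
  qed
  have holH: "H holomorphic_on UNIV" unfolding H_def by (intro holomorphic_intros h(1))
  \<comment> \<open>Cauchy's inequality compares growth \<rho>^(3/2) with \<rho>^k; for k >= 2 the
    bound tends to 0 as \<rho> grows.\<close>
  have d0: "(deriv ^^ k) H 0 = 0" if k: "k \<ge> 2" for k
  proof -
    have lim: "((\<lambda>\<rho>. fact k * (2 * (K * (2 * \<rho>) powr (3/2) + \<bar>Re (h 0)\<bar> + 1)) / \<rho> ^ 2) \<longlongrightarrow> 0) at_top"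
      by real_asymp
    have ev: "\<forall>\<^sub>F \<rho> in at_top. cmod ((deriv ^^ k) H 0) \<le> fact k * (2 * (K * (2 * \<rho>) powr (3/2) + \<bar>Re (h 0)\<bar> + 1)) / \<rho> ^ 2"
      using eventually_ge_at_top[of r]
    proof eventually_elim
      case (elim \<rho>)
      let ?B = "2 * (K * (2 * \<rho>) powr (3/2) + \<bar>Re (h 0)\<bar> + 1)"
      have "cmod ((deriv ^^ k) H 0) \<le> fact k * ?B / \<rho> ^ k"
        by (rule Cauchy_inequality)
          (use elim r Hbd in \<open>auto intro: holomorphic_on_subset[OF holH] holomorphic_on_imp_continuous_on simp del: distrib_left_numeral\<close>)
      also have "\<dots> \<le> fact k * ?B / \<rho> ^ 2"
        using k elim r by (intro divide_left_mono power_increasing mult_nonneg_nonneg)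
          (auto simp: K_def intro!: add_nonneg_nonneg mult_nonneg_nonneg mult_pos_pos)
      finally show ?case .
    qed
    have "cmod ((deriv ^^ k) H 0) \<le> 0"
      by (rule tendsto_lowerbound[OF lim ev]) simp
    then show ?thesis by simp
  qed
  define b where "b = deriv H 0"
  have Hlin: "H z = b * z" for z
  proof -
    have "((\<lambda>n. (deriv ^^ n) H 0 / fact n * (z - 0) ^ n) sums H z)"
      by (rule holomorphic_power_series[of H 0 "cmod z + 1"]) (auto intro: holomorphic_on_subset[OF holH])
    moreover have "(\<lambda>n. (deriv ^^ n) H 0 / fact n * (z - 0) ^ n) = (\<lambda>n. if n = 1 then b * z else 0)"
    proof
      fix n :: nat
      consider "n = 0" | "n = 1" | "n \<ge> 2" by linarith
      then show "(deriv ^^ n) H 0 / fact n * (z - 0) ^ n = (if n = 1 then b * z else 0)"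
        by cases (use d0 in \<open>auto simp: H_def b_def\<close>)
    qed
    ultimately have "(\<lambda>n. if n = 1 then b * z else 0) sums H z" by simp
    moreover have "(\<lambda>n. if n = 1 then b * z else 0) sums (b * z)" using sums_single[of 1 "\<lambda>_. b * z"] by simp
    ultimately show ?thesis using sums_unique2 by blast
  qed
  define E where "E = exp (2 * h 0 + 2 * a * b)"
  have ge: "cmod E \<le> cmod (f (Complex a t) * f (Complex a (-t)))" if t: "t \<ge> r" for t
  proof -
    have 1: "cmod (\<Prod>z\<in>Z. (Complex a s - z) ^ n z) \<ge> 1" if s: "\<bar>s\<bar> \<ge> r" for s
    proof (rule P1)
      fix z assume "z \<in> Z"
      then have "\<bar>Im z\<bar> \<le> r - 1" using r(2) abs_Im_le_cmod order_trans by blast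
      then have "\<bar>Im (Complex a s - z)\<bar> \<ge> 1" using s by simp
      then show "cmod (Complex a s - z) \<ge> 1" using abs_Im_le_cmod order_trans by blast
    qed
    have "g (Complex a t) * g (Complex a (-t)) = E"
    proof -
      have "h z = h 0 + b * z" for z using Hlin[of z] by (simp add: H_def algebra_simps)
      then have "h (Complex a t) + h (Complex a (-t)) = 2 * h 0 + b * (Complex a t + Complex a (-t))"
        by (metis (no_types, lifting) add.assoc add.left_commute distrib_left mult_2)
      also have "Complex a t + Complex a (-t) = 2 * a" by (simp add: complex_eq_iff)
      finally show ?thesis by (simp add: h(2) exp_add[symmetric] E_def mult_ac)
    qed
    then have "f (Complex a t) * f (Complex a (-t)) =
       (\<Prod>z\<in>Z. (Complex a t - z) ^ n z) * (\<Prod>z\<in>Z. (Complex a (-t) - z) ^ n z) * E"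
      by (simp add: g(3) mult_ac)
    then have "cmod (f (Complex a t) * f (Complex a (-t))) =
       (cmod (\<Prod>z\<in>Z. (Complex a t - z) ^ n z) * cmod (\<Prod>z\<in>Z. (Complex a (-t) - z) ^ n z)) * cmod E"
      by (simp only: norm_mult)
    moreover have "cmod (\<Prod>z\<in>Z. (Complex a t - z) ^ n z) * cmod (\<Prod>z\<in>Z. (Complex a (-t) - z) ^ n z) \<ge> 1 * 1"
      by (intro mult_mono 1) (use t r in auto)
    ultimately show ?thesis
      using mult_right_mono[of 1 _ "cmod E"] by fastforce
  qed
  have "cmod E \<le> cmod 0"
    by (rule tendsto_lowerbound[OF tendsto_norm[OF decay]]) (use eventually_mono[OF eventually_ge_at_top[of r] ge] in auto)
  then show False by (simp add: E_def)
qed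

section \<open>Growth and zeros of xi\<close>

text \<open>The summand 2 covers both transforms at once: \<bar>Re (1 - s)\<bar> + 1 is at most
  \<bar>Re s\<bar> + 2.\<close>

lemma norm_Xi_le:
  assumes "\<bar>Re s\<bar> + 2 \<le> R"
  shows "cmod (Xi s) \<le> 1/2 + 4 * cmod s * cmod (s - 1) * exp (R * ln R)"
proof -
  have mono: "A * ln A \<le> R * ln R" if "1 \<le> A" "A \<le> R" for A
    using that by (intro mult_mono) auto
  have "cmod (theta_laplace s) \<le> 2 * exp (R * ln R)"
    using norm_theta_laplace_le[of s] mono[of "\<bar>Re s\<bar> + 1"] assms by (auto intro: order_trans)
  moreover have "cmod (theta_laplace (1 - s)) \<le> 2 * exp (R * ln R)"
    using norm_theta_laplace_le[of "1 - s"] mono[of "\<bar>Re (1 - s)\<bar> + 1"] assms by (auto intro: order_trans)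
  ultimately have T: "cmod (theta_laplace s + theta_laplace (1 - s)) \<le> 4 * exp (R * ln R)"
    using norm_triangle_ineq[of "theta_laplace s" "theta_laplace (1 - s)"] by linarith
  have "cmod (Xi s) \<le> cmod (1/2) + cmod (s * (s - 1) * (theta_laplace s + theta_laplace (1 - s)))"
    unfolding Xi_def by (rule norm_triangle_ineq)
  also have "\<dots> = 1/2 + cmod s * cmod (s - 1) * cmod (theta_laplace s + theta_laplace (1 - s))"
    by (simp add: norm_mult)
  also have "\<dots> \<le> 1/2 + cmod s * cmod (s - 1) * (4 * exp (R * ln R))"
    using T by (intro add_left_mono mult_left_mono) auto
  finally show ?thesis by (simp add: mult_ac)
qed

lemma Xi_growth:
  assumes z: "cmod z \<ge> 1"
  shows "cmod (Xi z) \<le> exp (63 * cmod z powr (3/2))"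
proof -
  define R where "R = cmod z + 2"
  have R: "R \<ge> 3" "R \<le> 3 * cmod z" using z by (auto simp: R_def)
  have "cmod (Xi z) \<le> 1/2 + 4 * cmod z * cmod (z - 1) * exp (R * ln R)"
    by (rule norm_Xi_le) (use abs_Re_le_cmod[of z] in \<open>simp add: R_def\<close>)
  also have "\<dots> \<le> 1/2 + 4 * R * R * exp (R * ln R)"
    using norm_triangle_ineq4[of z 1] by (intro add_left_mono mult_right_mono mult_mono) (auto simp: R_def)
  also have "\<dots> \<le> R * R * exp (R * ln R) + 4 * R * R * exp (R * ln R)"
  proof -
    have "1 * 1 \<le> R * R" "1 \<le> exp (R * ln R)" using R mult_mono[of 1 R 1 R] by auto
    then have "1 * 1 \<le> R * R * exp (R * ln R)" by (intro mult_mono) auto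
    then show ?thesis by simp
  qed
  also have "\<dots> = 5 * (R * R) * exp (R * ln R)" by (simp add: algebra_simps)
  also have "\<dots> \<le> exp 4 * (exp R * exp R) * exp (R * ln R)"
  proof -
    have "5 \<le> exp (4::real)" using exp_ge_add_one_self[of 4] by simp
    moreover have "R \<le> exp R" using exp_ge_add_one_self[of R] by linarith
    ultimately show ?thesis using R by (intro mult_right_mono mult_mono) auto
  qed
  also have "\<dots> = exp (4 + 2 * R + R * ln R)" by (simp add: exp_add[symmetric])
  also have "\<dots> \<le> exp (63 * cmod z powr (3/2))"
  proof -
    have p: "R powr (3/2) = R * sqrt R"
    proof -
      have "R powr (3/2) = R powr (1 + 1/2)" by simp
      also have "\<dots> = R powr 1 * R powr (1/2)" by (rule powr_add)
      finally show ?thesis using R by (simp add: powr_half_sqrt)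
    qed
    have s: "sqrt R \<ge> 1" using R by simp
    have "ln R = 2 * ln (sqrt R)" using R by (simp add: ln_sqrt)
    also have "ln (sqrt R) \<le> sqrt R" using s ln_bound[of "sqrt R"] by simp
    finally have l: "R * ln R \<le> 2 * (R * sqrt R)" using R by (simp add: mult_left_mono mult.assoc)
    have "R * 1 \<le> R * sqrt R" using s R by (intro mult_left_mono) auto
    then have "4 + 2 * R + R * ln R \<le> 7 * (R * sqrt R)" using l R by linarith
    also have "\<dots> = 7 * R powr (3/2)" using p by simp
    also have "R powr (3/2) \<le> (3 * cmod z) powr (3/2)" using R by (intro powr_mono2) auto
    also have "\<dots> = 3 powr (3/2) * cmod z powr (3/2)" by (rule powr_mult)
    \<comment> \<open>The constant 63 is 7 times 9: the 7 collects the terms of the exponent, and 3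
      powr (3/2), which comes from R <= 3 |z|, is rounded up to 9.\<close>
    also have "3 powr (3/2) \<le> 3 powr (2::real)" by (intro powr_mono) auto
    finally show ?thesis by (simp add: mult_right_mono)
  qed
  finally show ?thesis .
qed

lemma norm_sin_bounds:
  "cmod (sin z) \<ge> (exp \<bar>Im z\<bar> - exp (- \<bar>Im z\<bar>)) / 2"
  "cmod (sin z) \<le> exp \<bar>Im z\<bar>"
proof -
  have a: "cmod (exp (\<i> * z)) = exp (- Im z)" "cmod (exp (- (\<i> * z))) = exp (Im z)" by simp_all
  have n: "cmod (sin z) = cmod (exp (\<i> * z) - exp (- (\<i> * z))) / 2"
    by (simp add: sin_exp_eq norm_divide norm_mult)
  have "\<bar>exp (- Im z) - exp (Im z)\<bar> \<le> cmod (exp (\<i> * z) - exp (- (\<i> * z)))"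
    using norm_triangle_ineq3[of "exp (\<i> * z)" "exp (- (\<i> * z))"] a by simp
  moreover have "exp \<bar>Im z\<bar> - exp (- \<bar>Im z\<bar>) \<le> \<bar>exp (- Im z) - exp (Im z)\<bar>"
    by (cases "Im z \<ge> 0") (auto simp: abs_if)
  ultimately have "exp \<bar>Im z\<bar> - exp (- \<bar>Im z\<bar>) \<le> cmod (exp (\<i> * z) - exp (- (\<i> * z)))" by (rule order_trans[rotated])
  then show "cmod (sin z) \<ge> (exp \<bar>Im z\<bar> - exp (- \<bar>Im z\<bar>)) / 2" unfolding n by (rule divide_right_mono) simp
  have "cmod (exp (\<i> * z) - exp (- (\<i> * z))) \<le> exp (- Im z) + exp (Im z)"
    using norm_triangle_ineq4[of "exp (\<i> * z)" "exp (- (\<i> * z))"] a by simp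
  also have "\<dots> \<le> exp \<bar>Im z\<bar> + exp \<bar>Im z\<bar>" by (intro add_mono) auto
  finally show "cmod (sin z) \<le> exp \<bar>Im z\<bar>" unfolding n by simp
qed

lemma norm_dirichlet_le:
  assumes "Re s > 1"
  shows "cmod (zeta s) \<le> (\<Sum>n. real (Suc n) powr (- Re s))"
proof -
  have e: "norm (1 / of_nat (Suc n) powr s :: complex) = real (Suc n) powr (- Re s)" for n
    by (simp add: norm_divide norm_of_nat_Suc_powr powr_minus divide_inverse norm_inverse del: of_nat_Suc)
  show ?thesis
    unfolding zeta_dirichlet[OF assms] using summable_norm[OF summable_dirichlet_norm[OF assms]] by (simp only: e)
qed

text \<open>Re s = 5/2 is the edge Re = 2 of the strip moved by 1/2. For n >= 2 the term n^(-5/2) is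
  at most (1 / (n - 1) - 1 / n) / sqrt 2; the telescoping tail sums to 1 / sqrt 2, which is less
  than the first term 1.\<close>

lemma norm_zeta_ge:
  assumes "Re s = 5/2"
  shows "cmod (zeta s) \<ge> 1 - 1 / sqrt 2"
proof -
  have s: "Re s > 1" using assms by simp
  define f where "f n = (1 / of_nat (Suc n) powr s :: complex)" for n
  have sf: "summable (\<lambda>n. norm (f n))" unfolding f_def by (rule summable_dirichlet_norm[OF s])
  have "norm (f n) = real (Suc n) powr (- Re s)" for n
    by (simp add: f_def norm_divide norm_of_nat_Suc_powr powr_minus divide_inverse norm_inverse del: of_nat_Suc)
  moreover have "- Re s = - 5/2" using assms by simp
  ultimately have e: "norm (f n) = real (Suc n) powr (- 5/2)" for n by (simp only:)
  have "zeta s = (\<Sum>n. f (Suc n)) + f 0"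
    unfolding zeta_dirichlet[OF s] f_def[symmetric] suminf_split_head[OF summable_norm_cancel[OF sf]] by (simp only: diff_add_cancel)
  moreover have "f 0 = 1" by (simp add: f_def)
  ultimately have z: "zeta s = (\<Sum>n. f (Suc n)) + 1" by (simp only:)
  have tel: "(\<lambda>n. 1 / real (Suc n) - 1 / real (Suc (Suc n))) sums (1 / real (Suc 0) - 0)"
  proof (rule telescope_sums')
    show "(\<lambda>n. 1 / real (Suc n)) \<longlonglongrightarrow> 0" using LIMSEQ_inverse_real_of_nat by (simp only: inverse_eq_divide)
  qed
  have le: "norm (f (Suc n)) \<le> (1 / real (Suc n) - 1 / real (Suc (Suc n))) * (1 / sqrt 2)" for n
  proof -
    define m where "m = real (Suc (Suc n))"
    have m: "m \<ge> 2" by (simp add: m_def)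
    have "m powr (- 2 + - 1/2) = m powr (- 2) * m powr (- 1/2)" by (rule powr_add)
    moreover have "- 2 + - 1/2 = (- 5/2 :: real)" by simp
    ultimately have "m powr (- 5/2) = m powr (- 2) * m powr (- 1/2)" by (simp only:)
    also have "m powr (- 2) = 1 / m\<^sup>2" using powr_minus[of m 2] m by (simp add: inverse_eq_divide)
    also have "m powr (- 1/2) = 1 / sqrt m" using powr_minus[of m "1/2"] powr_half_sqrt[of m] m by (simp add: inverse_eq_divide)
    also have "1 / m\<^sup>2 * (1 / sqrt m) \<le> (1 / (m - 1) - 1 / m) * (1 / sqrt 2)"
    proof (rule mult_mono)
      have "1 / (m - 1) - 1 / m = 1 / ((m - 1) * m)" using m by (simp add: field_simps)
      moreover have "(m - 1) * m \<le> m\<^sup>2" using m by (simp add: power2_eq_square)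
      ultimately show "1 / m\<^sup>2 \<le> 1 / (m - 1) - 1 / m" using m by (simp add: frac_le)
      show "1 / sqrt m \<le> 1 / sqrt 2" using m by (simp add: frac_le)
      show "1 / (m - 1) - 1 / m \<ge> 0" using m by (simp add: field_simps)
    qed (use m in auto)
    finally show ?thesis using e[of "Suc n"] by (simp add: m_def)
  qed
  have sf': "summable (\<lambda>n. norm (f (Suc n)))" using sf by (subst summable_Suc_iff)
  have "norm (\<Sum>n. f (Suc n)) \<le> (\<Sum>n. norm (f (Suc n)))" by (rule summable_norm[OF sf'])
  also have "\<dots> \<le> (\<Sum>n. (1 / real (Suc n) - 1 / real (Suc (Suc n))) * (1 / sqrt 2))"
    by (rule suminf_le[OF le sf' sums_summable[OF sums_mult2[OF tel]]])
  also have "\<dots> = 1 / sqrt 2" using sums_mult2[OF tel, of "1 / sqrt 2"] by (simp add: sums_iff)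
  finally have "norm (\<Sum>n. f (Suc n)) \<le> 1 / sqrt 2" .
  moreover have "1 \<le> norm (zeta s) + norm (\<Sum>n. f (Suc n))"
    using norm_triangle_ineq4[of "zeta s" "\<Sum>n. f (Suc n)"] z by simp
  ultimately show ?thesis by linarith
qed

text \<open>For Re s = 3 the real part of s / 2 is 1/2 + 1, so a single use of the recurrence
  reduces Gamma to the line on which its modulus is known exactly. Its exponential decay beats the
  polynomial factors, and the Dirichlet series is bounded.\<close>

lemma Xi_decay: "((\<lambda>t. Xi (Complex 3 t) * Xi (Complex 3 (- t))) \<longlongrightarrow> 0) at_top"
proof (rule Lim_null_comparison)
  define D where "D = (\<Sum>n. real (Suc n) powr (- 3))"
  have "cmod (zeta (Complex 3 0)) \<le> D" using norm_dirichlet_le[of "Complex 3 0"] by (simp add: D_def)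
  then have D0: "D \<ge> 0" using norm_ge_zero order_trans by blast
  define B where "B t = (3 + t) * (3 + t) * (3 + t) * D" for t :: real
  show "\<forall>\<^sub>F t in at_top. norm (Xi (Complex 3 t) * Xi (Complex 3 (- t))) \<le> (B t)\<^sup>2 * (pi / cosh (pi * (t / 2)))"
    using eventually_ge_at_top[of 0]
  proof eventually_elim
    case (elim t)
    define s where "s = Complex 3 t"
    have s1: "Re s > 1" by (simp add: s_def)
    have z: "cmod (zeta s) \<le> D" using norm_dirichlet_le[OF s1] by (simp add: D_def s_def)
    have cs: "cmod (Complex a b) \<le> a + \<bar>b\<bar>" if "a \<ge> 0" for a b
      using cmod_le[of "Complex a b"] that by simp
    have "Gamma (s / 2) = Complex (1/2) (t/2) * Gamma (Complex (1/2) (t/2))"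
    proof -
      have "s / 2 = Complex (1/2) (t/2) + 1" by (simp add: s_def complex_eq_iff)
      moreover have "Complex (1/2) (t/2) \<notin> \<int>\<^sub>\<le>\<^sub>0" by (auto elim!: nonpos_Ints_cases' simp: complex_eq_iff)
      ultimately show ?thesis using Gamma_plus1 by metis
    qed
    then have G: "cmod (Gamma (s / 2)) \<le> (3 + t) * cmod (Gamma (Complex (1/2) (t/2)))"
      using cs[of "1/2" "t/2"] elim by (simp add: norm_mult mult_right_mono)
    have P: "cmod (of_real pi powr (- s / 2)) \<le> 1"
    proof -
      have "cmod (of_real pi powr (- s / 2)) = exp (- (3/2) * ln pi)" by (simp add: pi_powr_exp s_def)
      moreover have "ln pi \<ge> 0" using pi_gt3 by simp
      ultimately show ?thesis by simp
    qed
    have "cmod s \<le> 3 + t" "cmod (s - 1) \<le> 3 + t"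
      using cs[of 3 t] cs[of 2 t] elim by (auto simp: s_def Complex_eq algebra_simps)
    then have "cmod (a_fun s) \<le> 1 * (3 + t) * ((3 + t) * cmod (Gamma (Complex (1/2) (t/2)))) * (3 + t)"
      unfolding a_fun_def norm_mult using P G elim by (intro mult_mono mult_nonneg_nonneg) auto
    then have "cmod (a_fun s) * cmod (zeta s) \<le> (1 * (3 + t) * ((3 + t) * cmod (Gamma (Complex (1/2) (t/2)))) * (3 + t)) * D"
      using z elim by (intro mult_mono mult_nonneg_nonneg) auto
    moreover have "cmod (Xi s) = 1 / 2 * (cmod (a_fun s) * cmod (zeta s))"
    proof -
      have "Xi s = 1 / 2 * a_fun s * zeta s" using xi_eq_mult_zeta(1)[of s] s1 by (simp add: xi_eq_Xi)
      then show ?thesis by (simp only: norm_mult) simp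
    qed
    ultimately have "2 * cmod (Xi s) \<le> B t * cmod (Gamma (Complex (1/2) (t/2)))"
      unfolding B_def by (simp add: mult_ac)
    then have X: "cmod (Xi s) \<le> B t * cmod (Gamma (Complex (1/2) (t/2)))"
      using norm_ge_zero[of "Xi s"] by linarith
    have "Xi (Complex 3 (- t)) = cnj (Xi s)" by (simp add: Xi_cnj[symmetric] s_def complex_cnj)
    then have "norm (Xi (Complex 3 t) * Xi (Complex 3 (- t))) = (cmod (Xi s))\<^sup>2"
      by (simp add: s_def[symmetric] norm_mult power2_eq_square)
    also have "\<dots> \<le> (B t * cmod (Gamma (Complex (1/2) (t/2))))\<^sup>2" using X by (intro power_mono) auto
    also have "\<dots> = (B t)\<^sup>2 * (pi / cosh (pi * (t / 2)))"
      using norm_Gamma_half_line[of "t/2"] by (simp add: power_mult_distrib)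
    finally show ?case .
  qed
  show "((\<lambda>t. (B t)\<^sup>2 * (pi / cosh (pi * (t / 2)))) \<longlongrightarrow> 0) at_top"
  proof -
    have "((\<lambda>t::real. ((3 + t) * (3 + t) * (3 + t))\<^sup>2 * (pi / cosh (pi * (t / 2)))) \<longlongrightarrow> 0) at_top"
      unfolding cosh_field_def by real_asymp
    from tendsto_mult[OF tendsto_const[of "D\<^sup>2"] this] show ?thesis
      by (simp add: B_def power_mult_distrib mult_ac)
  qed
qed

section \<open>Zeros of xi and the set of ordinates\<close>

lemma Xi_infinite_zeros: "infinite {z. Xi z = 0}"
  by (rule entire_infinite_zeros[OF Xi_holomorphic Xi_growth Xi_decay])

lemma Xi_not_constant: "\<not> Xi constant_on UNIV"
proof
  assume "Xi constant_on UNIV"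
  then obtain c where c: "\<And>z. Xi z = c" by (auto simp: constant_on_def)
  have "Xi 0 = 1/2" by (simp add: Xi_def)
  then have "{z. Xi z = 0} = {}" using c by auto
  then show False using Xi_infinite_zeros by simp
qed

text \<open>On the real axis outside (0, 1) the factor s (s - 1) is nonnegative, as are both
  transforms. Thus the real zeros of \<open>Xi\<close> are confined to a compact interval; the
  quadratic growth serves the coefficients c(4w).\<close>

lemma Xi_real_pos:
  assumes "r \<ge> 1 \<or> r \<le> (0::real)"
  shows "Re (Xi (of_real r)) \<ge> 1/2" "Im (Xi (of_real r)) = 0"
    "r \<ge> 1 \<Longrightarrow> Re (Xi (of_real r)) \<ge> r * (r - 1) * Re (theta_laplace 0)"
proof -
  have e: "theta_laplace (of_real r) = of_real (\<integral>u. theta_kernel u * exp (r * u) \<partial>lborel)" for r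
    unfolding theta_laplace_def
    by (subst integral_complex_of_real[symmetric]) (simp add: exp_of_real[symmetric] mult.commute)
  have nn: "(\<integral>u. theta_kernel u * exp (r * u) \<partial>lborel) \<ge> 0" for r
    by (intro Bochner_Integration.integral_nonneg mult_nonneg_nonneg theta_kernel_nonneg) auto
  define T where "T = (\<integral>u. theta_kernel u * exp (r * u) \<partial>lborel) + (\<integral>u. theta_kernel u * exp ((1 - r) * u) \<partial>lborel)"
  have T0: "T \<ge> 0" using nn[of r] nn[of "1 - r"] by (simp add: T_def)
  have X: "Xi (of_real r) = of_real (1/2 + r * (r - 1) * T)"
    using e[of r] e[of "1 - r"] by (simp add: Xi_def T_def)
  have p: "r * (r - 1) \<ge> 0" using assms by (auto simp: zero_le_mult_iff)
  show "Re (Xi (of_real r)) \<ge> 1/2" "Im (Xi (of_real r)) = 0"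
    unfolding X using p T0 by simp_all
  assume r: "r \<ge> 1"
  have "T \<ge> Re (theta_laplace 0)"
    using Re_theta_laplace_ge(1)[of r] r nn[of "1 - r"] e[of r] by (simp add: T_def)
  then have "r * (r - 1) * T \<ge> r * (r - 1) * Re (theta_laplace 0)" using p by (rule mult_left_mono)
  then show "Re (Xi (of_real r)) \<ge> r * (r - 1) * Re (theta_laplace 0)" unfolding X by simp
qed

lemma Xi_zero_iff_zeta:
  assumes "Im s \<noteq> 0"
  shows "Xi s = 0 \<longleftrightarrow> zeta s = 0"
  using xi_eq_mult_zeta[of s] assms by (auto simp: xi_eq_Xi)

lemma finite_Xi_zeros_compact:
  assumes "compact K"
  shows "finite {z \<in> K. Xi z = 0}"
  using holomorphic_compact_finite_zeros[OF Xi_holomorphic open_UNIV connected_UNIV assms _ Xi_not_constant] by simp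

lemma pos_ordinates_RH:
  assumes "RH"
  shows "pos_ordinates = {t. t > 0 \<and> zeta (1/2 + \<i> * of_real t) = 0}"
proof -
  have "z = 1/2 + \<i> * of_real (Im z)" if "zeta z = 0" "Im z > 0" for z
    using assms that by (auto simp: RH_def complex_eq_iff)
  then show ?thesis unfolding pos_ordinates_def by (auto intro!: exI[of _ "1/2 + \<i> * of_real _"])
qed

text \<open>Of the infinitely many zeros of \<open>Xi\<close> only finitely many are real, since
  these lie in a compact interval; the others are nonreal zeros of zeta, and conjugation moves those
  below the axis above it.\<close>

lemma infinite_pos_ordinates:
  assumes "RH"
  shows "infinite pos_ordinates"
proof
  assume fin: "finite pos_ordinates"
  have "{z. Xi z = 0} \<subseteq> {z \<in> of_real ` {0..1}. Xi z = 0} \<union> (\<lambda>t. 1/2 + \<i> * of_real t) ` pos_ordinates \<union> (\<lambda>t. 1/2 - \<i> * of_real t) ` pos_ordinates"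
  proof
    fix z assume "z \<in> {z. Xi z = 0}"
    then have z: "Xi z = 0" by simp
    consider "Im z = 0" | "Im z > 0" | "Im z < 0" by linarith
    then show "z \<in> {z \<in> of_real ` {0..1}. Xi z = 0} \<union> (\<lambda>t. 1/2 + \<i> * of_real t) ` pos_ordinates \<union> (\<lambda>t. 1/2 - \<i> * of_real t) ` pos_ordinates"
    proof cases
      case 1
      then have e: "z = of_real (Re z)" by (simp add: complex_eq_iff)
      then have "\<not> (Re z \<ge> 1 \<or> Re z \<le> 0)" using Xi_real_pos(1)[of "Re z"] z by auto
      then show ?thesis using e z by (auto intro!: image_eqI[of _ _ "Re z"])
    next
      case 2
      then have "zeta z = 0" using Xi_zero_iff_zeta[of z] z by simp
      then have "z = 1/2 + \<i> * of_real (Im z)" "Im z \<in> pos_ordinates"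
        using 2 assms by (auto simp: RH_def complex_eq_iff pos_ordinates_def)
      then show ?thesis by blast
    next
      case 3
      have "Xi (cnj z) = 0" using z by (simp add: Xi_cnj)
      then have z0: "zeta (cnj z) = 0" using Xi_zero_iff_zeta[of "cnj z"] 3 by simp
      then have "Re (cnj z) = 1/2" using assms 3 by (auto simp: RH_def)
      then have "z = 1/2 - \<i> * of_real (- Im z)" "- Im z \<in> pos_ordinates"
        using 3 z0 by (auto simp: complex_eq_iff pos_ordinates_def intro!: exI[of _ "cnj z"])
      then show ?thesis by blast
    qed
  qed
  moreover have "finite {z \<in> complex_of_real ` {0..1}. Xi z = 0}"
    by (intro finite_Xi_zeros_compact compact_continuous_image continuous_intros) auto
  ultimately have "finite {z. Xi z = 0}" using fin by (meson finite_UnI finite_imageI finite_subset)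
  then show False using Xi_infinite_zeros by simp
qed

lemma finite_pos_ordinates_le:
  assumes "RH"
  shows "finite {t \<in> pos_ordinates. t \<le> T}"
proof -
  define K where "K = (\<lambda>t. 1/2 + \<i> * complex_of_real t) ` {0..T}"
  have "compact K" unfolding K_def by (intro compact_continuous_image continuous_intros) auto
  then have "finite {z \<in> K. Xi z = 0}" by (rule finite_Xi_zeros_compact)
  then have "finite (Im ` {z \<in> K. Xi z = 0})" by (rule finite_imageI)
  moreover have "{t \<in> pos_ordinates. t \<le> T} \<subseteq> Im ` {z \<in> K. Xi z = 0}"
  proof
    fix t assume t: "t \<in> {t \<in> pos_ordinates. t \<le> T}"
    then have "t > 0" "zeta (1/2 + \<i> * of_real t) = 0" by (auto simp: pos_ordinates_RH[OF assms])
    then have "1/2 + \<i> * of_real t \<in> {z \<in> K. Xi z = 0}" using t Xi_zero_iff_zeta[of "1/2 + \<i> * of_real t"] by (auto simp: K_def)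
    then show "t \<in> Im ` {z \<in> K. Xi z = 0}" by (intro image_eqI[of _ _ "1/2 + \<i> * of_real t"]) auto
  qed
  ultimately show ?thesis using finite_subset by blast
qed

section \<open>The function n\<close>

lemma Xi_shift_holomorphic: "(\<lambda>s. Xi (1 / 2 + s)) holomorphic_on A"
  by (rule holomorphic_on_compose[of "\<lambda>s. 1 / 2 + s" A Xi, unfolded o_def])
    (intro Xi_holomorphic holomorphic_intros)+

lemma n_fun_holomorphic: "n_fun holomorphic_on A"
  unfolding n_fun_def[abs_def] xi_eq_Xi by (intro holomorphic_intros Xi_shift_holomorphic) auto

lemma n_fun_minus: "n_fun (- s) = - n_fun s"
proof -
  have "Xi (1 / 2 + - s) = Xi (1 - (1 / 2 + s))" by simp
  also have "\<dots> = Xi (1 / 2 + s)" by (rule Xi_reflect)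
  finally show ?thesis by (simp add: n_fun_def xi_eq_Xi)
qed

lemma sin_cnj: "sin (cnj z) = cnj (sin z)"
proof -
  have "cnj (sin z) = (exp (cnj (\<i> * z)) - exp (cnj (- (\<i> * z)))) / cnj (2 * \<i>)"
    unfolding sin_exp_eq by (simp only: complex_cnj_divide complex_cnj_diff exp_cnj)
  also have "\<dots> = (exp (- (\<i> * cnj z)) - exp (\<i> * cnj z)) / - (2 * \<i>)" by simp
  also have "\<dots> = (exp (\<i> * cnj z) - exp (- (\<i> * cnj z))) / (2 * \<i>)"
    by (metis minus_diff_eq minus_divide_left minus_divide_right)
  finally show ?thesis by (simp only: sin_exp_eq)
qed

lemma n_fun_cnj: "n_fun (cnj s) = cnj (n_fun s)"
proof -
  have "Xi (1 / 2 + cnj s) = cnj (Xi (1 / 2 + s))" using Xi_cnj[of "1 / 2 + s"] by simp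
  moreover have "sin (of_real pi * cnj s / 4) = cnj (sin (of_real pi * s / 4))"
    using sin_cnj[of "of_real pi * s / 4"] by simp
  ultimately show ?thesis by (simp add: n_fun_def xi_eq_Xi)
qed

lemma n_fun_eq:
  assumes "Im s \<noteq> 0"
  shows "n_fun s = sin (of_real pi * s / 4) * a_fun (1 / 2 + s) * zeta (1 / 2 + s)"
proof -
  have e: "xi (1 / 2 + s) = 1 / 2 * a_fun (1 / 2 + s) * zeta (1 / 2 + s)"
    by (rule xi_eq_mult_zeta(1)) (use assms in simp)
  show ?thesis unfolding n_fun_def e by simp
qed

lemma sin_pi_quarter_nonzero:
  assumes "Im s \<noteq> 0"
  shows "sin (of_real pi * s / 4) \<noteq> 0"
proof -
  let ?z = "of_real pi * s / 4"
  have "\<bar>Im ?z\<bar> > 0" using assms by simp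
  then have "(exp \<bar>Im ?z\<bar> - exp (- \<bar>Im ?z\<bar>)) / 2 > 0" by simp
  then show ?thesis using norm_sin_bounds(1)[of ?z] by auto
qed

lemma n_fun_zero_iff:
  assumes "Im s \<noteq> 0"
  shows "n_fun s = 0 \<longleftrightarrow> zeta (1 / 2 + s) = 0"
  using n_fun_eq[OF assms] sin_pi_quarter_nonzero[OF assms] xi_eq_mult_zeta(2)[of "1 / 2 + s"] assms by simp

text \<open>The exponentials of the sine and of Gamma cancel. The remaining power of t is smallest
  at Re s = 0, where Gamma contributes t^(-1/4) and the two linear factors contribute t
  each.\<close>

lemma sin_a_fun_lower_bound:
  "\<exists>c>0. \<forall>s. 0 \<le> Re s \<and> Re s \<le> 2 \<and> Im s \<ge> 1 \<longrightarrow>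
     c * Im s powr (7/4) \<le> cmod (sin (of_real pi * s / 4) * a_fun (1 / 2 + s))"
proof -
  obtain c where c: "c > 0" and Gc: "\<And>\<sigma> t. 1/4 \<le> \<sigma> \<Longrightarrow> \<sigma> \<le> 5/4 \<Longrightarrow> t \<ge> 1/2 \<Longrightarrow>
     cmod (Gamma (Complex \<sigma> t)) \<ge> c * t powr (\<sigma> - 1/2) * exp (- pi * t / 2)"
    using norm_Gamma_lower_bound by blast
  \<comment> \<open>The modulus of the power of pi is smallest at Re s = 2, where its exponent is -
    (1/2 + 2) / 2 = - 5/4.\<close>
  define P where "P = exp (- (5/4) * ln pi)"
  have P: "P > 0" by (simp add: P_def)
  define D where "D = 1/4 * (P * (c * 2 powr (-1)))"
  have D: "D > 0" using P c by (simp add: D_def)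
  have main: "D * Im s powr (7/4) \<le> cmod (sin (of_real pi * s / 4) * a_fun (1 / 2 + s))"
    if s: "0 \<le> Re s" "Re s \<le> 2" "Im s \<ge> 1" for s
  proof -
    define t where "t = Im s"
    define x where "x = Re s"
    have t: "t \<ge> 1" and x: "0 \<le> x" "x \<le> 2" using s by (auto simp: t_def x_def)
    have sn: "cmod (sin (of_real pi * s / 4)) \<ge> 1/4 * exp (pi * t / 4)"
    proof -
      have e: "\<bar>Im (of_real pi * s / 4)\<bar> = pi * t / 4" using t by (simp add: t_def)
      have "exp (pi * t / 4) \<ge> 1 + pi * t / 4" by (rule exp_ge_add_one_self)
      moreover have "3 * 1 \<le> pi * t" using pi_gt3 t by (intro mult_mono) auto
      ultimately have "exp (pi * t / 4) \<ge> 3/2" by linarith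
      then have "3/2 * (3/2) \<le> exp (pi * t / 4) * exp (pi * t / 4)" by (intro mult_mono) auto
      then have "exp (- (pi * t / 4)) \<le> exp (pi * t / 4) / 2"
        by (simp add: exp_minus field_simps)
      moreover have "1/4 * X \<le> S" if "Y \<le> X / 2" "(X - Y) / 2 \<le> S" for X Y S :: real using that by simp
      ultimately show ?thesis using norm_sin_bounds(1)[of "of_real pi * s / 4"] unfolding e by blast
    qed
    have pw: "cmod (of_real pi powr (- (1 / 2 + s) / 2)) \<ge> P"
    proof -
      have "cmod (of_real pi powr (- (1 / 2 + s) / 2)) = exp (- (1/2 + x) / 2 * ln pi)"
        by (simp add: pi_powr_exp x_def)
      moreover have "ln pi \<ge> 0" using pi_gt3 by simp
      then have "- (5/4) * ln pi \<le> - (1/2 + x) / 2 * ln pi" using x by (intro mult_right_mono) auto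
      ultimately show ?thesis by (simp add: P_def)
    qed
    have n1: "cmod (1 / 2 + s) \<ge> t" "cmod (1 / 2 + s - 1) \<ge> t"
      using abs_Im_le_cmod[of "1 / 2 + s"] abs_Im_le_cmod[of "1 / 2 + s - 1"] by (auto simp: t_def)
    have G: "cmod (Gamma ((1 / 2 + s) / 2)) \<ge> c * 2 powr (-1) * t powr (-1/4) * exp (- (pi * t / 4))"
    proof -
      have e: "(1 / 2 + s) / 2 = Complex (1/4 + x/2) (t/2)" by (simp add: complex_eq_iff x_def t_def)
      have "cmod (Gamma ((1 / 2 + s) / 2)) \<ge> c * (t/2) powr ((1/4 + x/2) - 1/2) * exp (- pi * (t/2) / 2)"
        unfolding e by (rule Gc) (use x t in auto)
      moreover have "(t/2) powr ((1/4 + x/2) - 1/2) \<ge> 2 powr (-1) * t powr (-1/4)"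
      proof -
        have "(t/2) powr ((1/4 + x/2) - 1/2) = t powr (x/2 - 1/4) * 2 powr (1/4 - x/2)"
          using t by (simp add: powr_divide powr_diff algebra_simps)
        moreover have "t powr (x/2 - 1/4) \<ge> t powr (-1/4)" using t x by (intro powr_mono) auto
        moreover have "2 powr (1/4 - x/2) \<ge> 2 powr (-1::real)" using x by (intro powr_mono) auto
        ultimately show ?thesis
          using mult_mono[of "2 powr (-1)" "2 powr (1/4 - x/2)" "t powr (-1/4)" "t powr (x/2 - 1/4)"] by (simp only: mult.commute) simp
      qed
      then have "c * (2 powr (-1) * t powr (-1/4)) * exp (- pi * (t/2) / 2) \<le> c * (t/2) powr ((1/4 + x/2) - 1/2) * exp (- pi * (t/2) / 2)"
        using c by (intro mult_right_mono mult_left_mono) auto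
      ultimately show ?thesis by (simp add: mult.assoc)
    qed
    have tp: "t * t * t powr (-1/4) = t powr (7/4)"
    proof -
      have "t powr (1 + 1 + -1/4) = t powr 1 * t powr 1 * t powr (-1/4)" by (simp only: powr_add)
      moreover have "1 + 1 + -1/4 = (7/4::real)" by simp
      ultimately show ?thesis using t by (simp only: powr_one)
    qed
    have "D * t powr (7/4) = 1/4 * exp (pi * t / 4) * (P * t * (c * 2 powr (-1) * t powr (-1/4) * exp (- (pi * t / 4))) * t)"
      unfolding D_def tp[symmetric] by (simp add: exp_minus field_simps)
    also have "\<dots> \<le> cmod (sin (of_real pi * s / 4)) * cmod (a_fun (1 / 2 + s))"
      unfolding a_fun_def norm_mult
      using sn pw n1 G P c t by (intro mult_mono mult_nonneg_nonneg) auto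
    finally show ?thesis by (simp add: norm_mult t_def)
  qed
  show ?thesis by (rule exI[of _ D]) (use main D in auto)
qed

text \<open>The width 4 accommodates discs of radius 2 about points with real part 2. A crude
  exponential bound suffices, because only the real part of a logarithm of n is needed.\<close>

lemma n_fun_strip_upper_bound:
  "\<exists>C>0. \<forall>s. 0 \<le> Re s \<and> Re s \<le> 4 \<and> Im s \<ge> 1 \<longrightarrow> cmod (n_fun s) \<le> exp (C * Im s)"
proof -
  \<comment> \<open>Here \<bar>Re (1/2 + s)\<bar> + 2 is at most 13/2, hence at most 7.\<close>
  define E where "E = exp ((7::real) * ln 7)"
  have E: "E \<ge> 1" by (simp add: E_def)
  define D where "D = 1 + 400 * E"
  have D: "D \<ge> 1" using E by (simp add: D_def)
  have main: "cmod (n_fun s) \<le> exp ((4 + D) * Im s)" if s: "0 \<le> Re s" "Re s \<le> 4" "Im s \<ge> 1" for s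
  proof -
    define t where "t = Im s"
    have t: "t \<ge> 1" using s by (simp add: t_def)
    have X: "cmod (Xi (1 / 2 + s)) \<le> 1/2 + 4 * cmod (1 / 2 + s) * cmod (1 / 2 + s - 1) * E"
      unfolding E_def by (rule norm_Xi_le) (use s in auto)
    have b: "cmod (1 / 2 + s) \<le> 6 * t" "cmod (1 / 2 + s - 1) \<le> 6 * t"
      using cmod_le[of "1 / 2 + s"] cmod_le[of "1 / 2 + s - 1"] s by (auto simp: t_def)
    have "cmod (1 / 2 + s) * cmod (1 / 2 + s - 1) \<le> (6 * t) * (6 * t)"
      using b t by (intro mult_mono) auto
    then have "4 * cmod (1 / 2 + s) * cmod (1 / 2 + s - 1) * E \<le> 4 * ((6 * t) * (6 * t)) * E"
    proof -
      have "4 * A * B * E \<le> 4 * M * E" if "A * B \<le> M" for A B M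
        using that E by (simp add: mult.assoc)
      then show ?thesis using \<open>cmod (1 / 2 + s) * cmod (1 / 2 + s - 1) \<le> (6 * t) * (6 * t)\<close> by blast
    qed
    from order_trans[OF X add_left_mono[OF this]]
    have X2: "2 * cmod (Xi (1 / 2 + s)) \<le> 1 + 288 * (t * t) * E" by simp
    have "1 * 1 \<le> t * t" using t by (intro mult_mono) auto
    then have "1 * E \<le> t * t * E" using E by (intro mult_right_mono) auto
    moreover have "a \<le> D * m" if "1 * E \<le> m * E" "a \<le> 1 + 288 * m * E" "1 * 1 \<le> m" for a m
    proof -
      have "D * m = m + 400 * (m * E)" by (simp add: D_def algebra_simps)
      moreover have "a \<le> 1 + 288 * (m * E)" using that(2) by (simp only: mult.assoc)
      ultimately show ?thesis using that E by linarith
    qed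
    ultimately have "2 * cmod (Xi (1 / 2 + s)) \<le> D * (t * t)" using X2 \<open>1 * 1 \<le> t * t\<close> by blast
    also have "\<dots> \<le> exp D * (exp t * exp t)"
    proof -
      have "D \<le> exp D" "t \<le> exp t" using exp_ge_add_one_self[of D] exp_ge_add_one_self[of t] by linarith+
      then show ?thesis using D t by (intro mult_mono) auto
    qed
    finally have X3: "2 * cmod (Xi (1 / 2 + s)) \<le> exp (D + 2 * t)" by (simp add: exp_add[symmetric])
    have "\<bar>Im (of_real pi * s / 4)\<bar> \<le> t"
    proof -
      have "pi * t \<le> 4 * t" using pi_less_4 t by (intro mult_right_mono) auto
      then show ?thesis using t by (simp add: t_def)
    qed
    then have "cmod (sin (of_real pi * s / 4)) \<le> exp t"
      using norm_sin_bounds(2)[of "of_real pi * s / 4"] by (auto intro: order_trans)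
    then have "cmod (n_fun s) \<le> exp t * exp (D + 2 * t)"
      unfolding n_fun_def xi_eq_Xi norm_mult using X3 by (intro mult_mono) auto
    also have "\<dots> = exp (D * 1 + 3 * t)" by (simp add: exp_add[symmetric])
    also have "\<dots> \<le> exp ((4 + D) * t)"
    proof -
      have "D * 1 \<le> D * t" using D t by (intro mult_left_mono) auto
      moreover have "(4 + D) * t = 4 * t + D * t" by (rule distrib_right)
      ultimately have "D * 1 + 3 * t \<le> (4 + D) * t" using t by linarith
      then show ?thesis by simp
    qed
    finally show ?thesis by (simp add: t_def)
  qed
  show ?thesis by (rule exI[of _ "4 + D"]) (use main D in auto)
qed

lemma deriv_n_fun_zero:
  assumes "Im z \<noteq> 0" "zeta (1 / 2 + z) = 0"
  shows "deriv n_fun z = sin (of_real pi * z / 4) * a_fun (1 / 2 + z) * deriv zeta (1 / 2 + z)"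
proof -
  define h :: "complex \<Rightarrow> complex" where "h s = sin (of_real pi * s / 4) * (of_real pi powr (- (1 / 2 + s) / 2) * (1 / 2 + s) * Gamma ((1 / 2 + s) / 2) * (1 / 2 + s - 1))" for s
  define U where "U = {s. Im s \<noteq> 0}"
  have "U = {s. Im s < 0} \<union> {s. Im s > 0}" by (auto simp: U_def)
  then have "open U" using open_Un[OF open_halfspace_Im_lt[of 0] open_halfspace_Im_gt[of 0]] by (simp only:)
  have h: "h field_differentiable at z"
  proof -
    have "Gamma w = 1 / rGamma w" for w :: complex by (simp add: Gamma_def inverse_eq_divide)
    moreover have "rGamma ((1 / 2 + s) / 2) \<noteq> 0" if "s \<in> U" for s
    proof -
      have "(1 / 2 + s) / 2 \<notin> \<int>\<^sub>\<le>\<^sub>0"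
        using that by (auto simp: U_def elim!: nonpos_Ints_cases' simp: complex_eq_iff)
      then show ?thesis by (simp add: rGamma_eq_zero_iff)
    qed
    ultimately have "h holomorphic_on U"
      unfolding h_def[abs_def] by (simp only:) (intro holomorphic_intros, auto)
    then show ?thesis
      using \<open>open U\<close> assms(1) by (auto simp: U_def intro: holomorphic_on_imp_differentiable_at)
  qed
  have Z: "(\<lambda>s. zeta (1 / 2 + s)) field_differentiable at z" "deriv (\<lambda>s. zeta (1 / 2 + s)) z = deriv zeta (1 / 2 + z)"
  proof -
    have "1 / 2 + z \<in> - {1}" using assms(1) by (auto simp: complex_eq_iff)
    then have d: "(zeta has_field_derivative deriv zeta (1 / 2 + z)) (at (1 / 2 + z))"
      by (intro holomorphic_derivI[OF zeta_holomorphic]) auto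
    have i: "((\<lambda>s. 1 / 2 + s) has_field_derivative 1) (at z)" by (auto intro!: derivative_eq_intros)
    have "((\<lambda>s. zeta (1 / 2 + s)) has_field_derivative deriv zeta (1 / 2 + z) * 1) (at z)"
      by (rule DERIV_chain2[OF d i])
    then show "(\<lambda>s. zeta (1 / 2 + s)) field_differentiable at z" "deriv (\<lambda>s. zeta (1 / 2 + s)) z = deriv zeta (1 / 2 + z)"
      by (auto simp: field_differentiable_def intro: DERIV_imp_deriv)
  qed
  have "\<forall>\<^sub>F s in nhds z. s \<in> U" using \<open>open U\<close> assms(1) by (intro eventually_nhds_in_open) (auto simp: U_def)
  then have "\<forall>\<^sub>F s in nhds z. n_fun s = h s * zeta (1 / 2 + s)"
    by eventually_elim (auto simp: U_def n_fun_eq h_def a_fun_def)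
  then have "deriv n_fun z = deriv (\<lambda>s. h s * zeta (1 / 2 + s)) z" by (intro deriv_cong_ev) auto
  also have "\<dots> = h z * deriv zeta (1 / 2 + z) + deriv h z * zeta (1 / 2 + z)"
    using deriv_mult[OF h Z(1)] Z(2) by simp
  finally show ?thesis using assms(2) by (simp add: h_def a_fun_def)
qed

lemma deriv_n_fun_real_zero:
  "deriv n_fun (4 * of_nat w) = of_real pi / 2 * (-1) ^ w * Xi (1 / 2 + 4 * of_nat w)"
proof -
  let ?z = "4 * of_nat w :: complex"
  have e: "of_real pi * ?z / 4 = of_real (pi * real w)" by simp
  have sz: "sin (of_real pi * ?z / 4) = 0" unfolding e by (simp only: sin_of_real sin_npi2 of_real_0)
  have cz: "cos (of_real pi * ?z / 4) = (-1) ^ w" unfolding e by (simp only: cos_of_real cos_npi2) simp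
  have "((\<lambda>s. sin (of_real pi * s / 4)) has_field_derivative cos (of_real pi * ?z / 4) * (of_real pi / 4)) (at ?z)"
    by (auto intro!: derivative_eq_intros)
  moreover have "(\<lambda>s. 2 * Xi (1 / 2 + s)) holomorphic_on UNIV"
    by (intro holomorphic_intros Xi_shift_holomorphic)
  then have "((\<lambda>s. 2 * Xi (1 / 2 + s)) has_field_derivative deriv (\<lambda>s. 2 * Xi (1 / 2 + s)) ?z) (at ?z)"
    by (intro holomorphic_derivI) auto
  ultimately have "((\<lambda>s. sin (of_real pi * s / 4) * (2 * Xi (1 / 2 + s))) has_field_derivative
      cos (of_real pi * ?z / 4) * (of_real pi / 4) * (2 * Xi (1 / 2 + ?z)) + deriv (\<lambda>s. 2 * Xi (1 / 2 + s)) ?z * sin (of_real pi * ?z / 4)) (at ?z)"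
    by (rule DERIV_mult)
  then have "(n_fun has_field_derivative cos (of_real pi * ?z / 4) * (of_real pi / 4) * (2 * Xi (1 / 2 + ?z))) (at ?z)"
    unfolding sz by (simp add: n_fun_def[abs_def] xi_eq_Xi)
  then show ?thesis unfolding cz by (auto dest!: DERIV_imp_deriv)
qed

text \<open>Only the factor s (s - 1) of the real values of \<open>Xi\<close> is exploited;
  quadratic decay already makes the coefficients summable.\<close>

lemma c_coeff_real_bound:
  "\<exists>C>0. \<forall>w::nat. cmod (c_coeff (4 * of_nat (Suc w))) \<le> C / (real w + 1)\<^sup>2"
proof -
  define T where "T = Re (theta_laplace 0)"
  have T: "T > 0" unfolding T_def by (rule Re_theta_laplace_ge(2)[of 0]) simp
  define C where "C = 1 / (pi / 2 * T)"
  have C: "C > 0" using T by (simp add: C_def)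
  have main: "cmod (c_coeff (4 * of_nat (Suc w))) \<le> C / (real w + 1)\<^sup>2" for w
  proof -
    define r where "r = 1/2 + 4 * (real w + 1)"
    have r: "r \<ge> 1" "r - 1 \<ge> real w + 1" "r \<ge> real w + 1" by (auto simp: r_def)
    have "(real w + 1) * (real w + 1) \<le> r * (r - 1)" using r by (intro mult_mono) auto
    then have "(real w + 1)\<^sup>2 * T \<le> r * (r - 1) * T"
      using T by (simp add: power2_eq_square)
    also have "\<dots> \<le> Re (Xi (of_real r))" unfolding T_def using Xi_real_pos(3)[of r] r by simp
    also have "\<dots> \<le> cmod (Xi (of_real r))" by (rule complex_Re_le_cmod)
    finally have X: "(real w + 1)\<^sup>2 * T \<le> cmod (Xi (of_real r))" .
    have e: "1 / 2 + 4 * of_nat (Suc w) = (of_real r :: complex)" by (simp add: r_def)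
    have "cmod (deriv n_fun (4 * of_nat (Suc w))) = pi / 2 * cmod (Xi (of_real r))"
      unfolding deriv_n_fun_real_zero e by (simp add: norm_mult norm_divide norm_power)
    also have "\<dots> \<ge> pi / 2 * ((real w + 1)\<^sup>2 * T)" using X by (intro mult_left_mono) auto
    finally have d: "pi / 2 * T * (real w + 1)\<^sup>2 \<le> cmod (deriv n_fun (4 * of_nat (Suc w)))" by (simp add: mult_ac)
    have "cmod (c_coeff (4 * of_nat (Suc w))) = 1 / cmod (deriv n_fun (4 * of_nat (Suc w)))"
      by (simp add: c_coeff_def norm_divide)
    also have "\<dots> \<le> 1 / (pi / 2 * T * (real w + 1)\<^sup>2)"
    proof -
      have p: "pi / 2 * T * (real w + 1)\<^sup>2 > 0" using T by simp
      show ?thesis by (intro divide_left_mono d mult_pos_pos p less_le_trans[OF p d]) simp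
    qed
    also have "\<dots> = C / (real w + 1)\<^sup>2" by (simp add: C_def)
    finally show ?thesis .
  qed
  show ?thesis by (rule exI[of _ C]) (use main C in auto)
qed

section \<open>The ordinates of the zeros\<close>

declare nth_ordinate.simps(2) [simp del]

text \<open>\<open>LEAST\<close> over the reals says something only where a minimum exists. It does
  here: there is an ordinate above the current one because there are infinitely many, and only
  finitely many lie below that one.\<close>

lemma nth_ordinate_Suc:
  assumes RH
  shows "nth_ordinate (Suc n) \<in> pos_ordinates" "nth_ordinate n < nth_ordinate (Suc n)"
    "\<And>t. t \<in> pos_ordinates \<Longrightarrow> nth_ordinate n < t \<Longrightarrow> nth_ordinate (Suc n) \<le> t"
proof -
  let ?x = "nth_ordinate n"
  let ?P = "\<lambda>t. t \<in> pos_ordinates \<and> ?x < t"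
  have "\<not> pos_ordinates \<subseteq> {t \<in> pos_ordinates. t \<le> ?x}"
    using infinite_pos_ordinates[OF assms] finite_pos_ordinates_le[OF assms, of ?x] finite_subset by blast
  then obtain t0 where t0: "t0 \<in> pos_ordinates" "?x < t0" using linorder_not_le by blast
  define A where "A = {t \<in> pos_ordinates. ?x < t \<and> t \<le> t0}"
  have "finite A" "A \<noteq> {}"
    using t0 by (auto simp: A_def intro: finite_subset[OF _ finite_pos_ordinates_le[OF assms, of t0]])
  then have m: "Min A \<in> A" "\<And>t. t \<in> A \<Longrightarrow> Min A \<le> t" by auto
  have least: "Min A \<le> t" if "?P t" for t
    using that m(2)[of t] m(1) by (cases "t \<le> t0") (auto simp: A_def)
  have e: "nth_ordinate (Suc n) = Min A"
    unfolding nth_ordinate.simps by (rule Least_equality) (use m(1) least in \<open>auto simp: A_def\<close>)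
  show "nth_ordinate (Suc n) \<in> pos_ordinates" "nth_ordinate n < nth_ordinate (Suc n)"
    using m(1) e by (auto simp: A_def)
  show "\<And>t. t \<in> pos_ordinates \<Longrightarrow> nth_ordinate n < t \<Longrightarrow> nth_ordinate (Suc n) \<le> t"
    using least e by auto
qed

lemma nth_ordinate_strict_mono:
  assumes RH
  shows "strict_mono nth_ordinate"
  using nth_ordinate_Suc(2)[OF assms] by (rule strict_monoI_Suc)

lemma nth_ordinate_at_top:
  assumes RH
  shows "filterlim nth_ordinate at_top sequentially"
proof -
  have "\<exists>n. T \<le> nth_ordinate n" for T
  proof (rule ccontr)
    assume "\<not> (\<exists>n. T \<le> nth_ordinate n)"
    then have "range (\<lambda>n. nth_ordinate (Suc n)) \<subseteq> {t \<in> pos_ordinates. t \<le> T}"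
      using nth_ordinate_Suc(1)[OF assms] by (auto simp: not_le intro: less_imp_le)
    moreover have "inj (\<lambda>n. nth_ordinate (Suc n))"
      by (rule injI) (use strict_mono_eq[OF nth_ordinate_strict_mono[OF assms]] in auto)
    then have "infinite (range (\<lambda>n. nth_ordinate (Suc n)))" by (rule range_inj_infinite)
    ultimately show False using finite_pos_ordinates_le[OF assms, of T] finite_subset by blast
  qed
  then show ?thesis unfolding filterlim_at_top eventually_sequentially
    by (meson order_trans strict_mono_less_eq[OF nth_ordinate_strict_mono[OF assms]])
qed

lemma pos_ordinate_imp_nth:
  assumes RH "t \<in> pos_ordinates"
  obtains n where "n \<ge> 1" "nth_ordinate n = t"
proof -
  have t: "t > 0" using assms(2) by (auto simp: pos_ordinates_def)
  obtain m where m: "t \<le> nth_ordinate m"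
    using nth_ordinate_at_top[OF assms(1)] unfolding filterlim_at_top eventually_sequentially by blast
  define n where "n = (LEAST n. t \<le> nth_ordinate n)"
  have n: "t \<le> nth_ordinate n" unfolding n_def by (rule LeastI[of _ m]) (rule m)
  have "n \<noteq> 0" using n t by (cases n) auto
  then obtain k where k: "n = Suc k" by (cases n) auto
  have "\<not> t \<le> nth_ordinate k" using not_less_Least[of k "\<lambda>n. t \<le> nth_ordinate n"] k by (simp add: n_def)
  then have "nth_ordinate n \<le> t" using nth_ordinate_Suc(3)[OF assms(1,2), of k] k by simp
  then show ?thesis using that[of n] n k by simp
qed

lemma gamma_of_nat: "\<gamma> (int n) = nth_ordinate n"
  by (simp add: \<gamma>_def)

lemma gamma_less:
  assumes RH "0 \<le> j" "j < k"
  shows "\<gamma> j < \<gamma> k"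
  using strict_mono_less[OF nth_ordinate_strict_mono[OF assms(1)], of "nat j" "nat k"] assms by (simp add: \<gamma>_def)

lemma gamma_pos:
  assumes RH "k \<ge> 1"
  shows "\<gamma> k > 0"
  using gamma_less[OF assms(1), of 0 k] assms(2) by (simp add: \<gamma>_def)

lemma gamma_zero:
  assumes RH "k \<ge> 1"
  shows "zeta (1 / 2 + \<i> * of_real (\<gamma> k)) = 0"
proof -
  have "\<gamma> k \<in> pos_ordinates"
    using nth_ordinate_Suc(1)[OF assms(1), of "nat k - 1"] assms(2) by (simp add: \<gamma>_def Suc_diff_Suc)
  then show ?thesis unfolding pos_ordinates_RH[OF assms(1)] by simp
qed

lemma zero_imp_gamma:
  assumes RH "zeta (1 / 2 + s) = 0" "Im s > 0"
  obtains k where "k \<ge> 1" "s = \<i> * of_real (\<gamma> k)"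
proof -
  have "Re (1 / 2 + s) = 1 / 2" using assms by (auto simp: RH_def)
  then have s: "s = \<i> * of_real (Im s)" by (simp add: complex_eq_iff)
  have "Im s \<in> pos_ordinates" using assms s by (auto simp: pos_ordinates_RH)
  then obtain n where "n \<ge> 1" "nth_ordinate n = Im s" using pos_ordinate_imp_nth[OF assms(1)] by blast
  then show ?thesis using that[of "int n"] s by (simp add: gamma_of_nat)
qed

lemma delta_le_gap:
  assumes RH "j \<ge> 1" "k \<ge> 1" "j \<noteq> k"
  shows "\<delta> k \<le> \<bar>\<gamma> k - \<gamma> j\<bar>"
proof (cases "j > k")
  case True
  have "\<gamma> (k + 1) \<le> \<gamma> j" using gamma_less[OF assms(1), of "k+1" j] True assms by (cases "k + 1 = j") auto
  moreover have "\<gamma> k < \<gamma> (k + 1)" using gamma_less[OF assms(1), of k "k+1"] assms by simp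
  moreover have "next_index k = k + 1" using assms by (simp add: next_index_def)
  ultimately show ?thesis by (simp add: \<delta>_def)
next
  case False
  then have jk: "j < k" using assms by simp
  then have "prev_index k = k - 1" using assms by (simp add: prev_index_def)
  moreover have "\<gamma> j \<le> \<gamma> (k - 1)" using gamma_less[OF assms(1), of j "k - 1"] jk assms by (cases "j = k - 1") auto
  moreover have "\<gamma> (k - 1) < \<gamma> k" using gamma_less[OF assms(1), of "k - 1" k] jk assms by simp
  ultimately show ?thesis by (simp add: \<delta>_def)
qed

text \<open>The factor 2 is caused by k = 1, whose left neighbour is - \<gamma> 1. The bound later
  keeps discs of radius \<delta> / 2 about the zeros inside the upper half plane.\<close>

lemma delta_le_gamma:
  assumes RH "k \<ge> 1"
  shows "\<delta> k \<le> 2 * \<gamma> k"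
proof (cases "k = 1")
  case True
  then have "\<delta> k \<le> \<bar>\<gamma> 1 - \<gamma> (- 1)\<bar>" by (simp add: \<delta>_def prev_index_def)
  then show ?thesis using True gamma_pos[OF assms(1), of 1] by (simp add: \<gamma>_def)
next
  case False
  then show ?thesis
    using delta_le_gap[OF assms(1), of 1 k] gamma_less[OF assms(1), of 1 k] gamma_pos[OF assms(1), of 1] gamma_pos[OF assms] assms(2)
    by simp
qed

text \<open>The infimum is attained because membership already allows an arbitrary loss \<sigma>:
  half of it pays for the distance to a member d near the infimum.\<close>

lemma least_exponent_mem:
  assumes RH "lower_exponents q \<noteq> {}"
  shows "least_exponent q \<in> lower_exponents q"
proof -
  let ?A = "lower_exponents q"
  have bdd: "bdd_below ?A" by (rule bdd_belowI[of _ 0]) (auto simp: lower_exponents_def)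
  define e where "e = Inf ?A"
  have e0: "e \<ge> 0" unfolding e_def by (rule cInf_greatest[OF assms(2)]) (auto simp: lower_exponents_def)
  have g1: "\<gamma> 1 > 0" using gamma_pos[OF assms(1)] by simp
  have "e \<in> ?A"
    unfolding lower_exponents_def
  proof (intro CollectI conjI e0 allI impI)
    fix s :: real assume s: "s > 0"
    have "Inf ?A < e + s / 2" using s by (simp add: e_def)
    then obtain d where d: "d \<in> ?A" "d < e + s / 2" using cInf_lessD[OF assms(2)] by blast
    then obtain K where K: "K > 0" "\<And>k. k \<ge> 1 \<Longrightarrow> q k > K * \<gamma> k powr (- (d + s / 2))"
      using s unfolding lower_exponents_def by (auto dest!: spec[of _ "s / 2"])
    define h where "h = e + s - (d + s / 2)"
    have h: "h > 0" using d by (simp add: h_def)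
    show "\<exists>K>0. \<forall>k\<ge>1. q k > K * \<gamma> k powr (- (e + s))"
    \<comment> \<open>The exponent gained is h > 0, and \<gamma> 1 powr h is its smallest
      contribution over all k; \<gamma> 1 is not assumed to be at least 1.\<close>
    proof (intro exI[of _ "K * \<gamma> 1 powr h"] conjI allI impI)
      show "K * \<gamma> 1 powr h > 0" using K g1 by simp
      fix k :: int assume k: "k \<ge> 1"
      have gk: "\<gamma> k \<ge> \<gamma> 1" "\<gamma> k > 0"
        using gamma_less[OF assms(1), of 1 k] gamma_pos[OF assms(1) k] k by (cases "k = 1"; auto)+
      have "K * \<gamma> 1 powr h * \<gamma> k powr (- (e + s)) \<le> K * \<gamma> k powr h * \<gamma> k powr (- (e + s))"
        using K gk g1 h by (intro mult_right_mono mult_left_mono powr_mono2) auto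
      also have "\<dots> = K * \<gamma> k powr (- (d + s / 2))"
      proof -
        have "h + - (e + s) = - (d + s / 2)" by (simp add: h_def)
        then have "\<gamma> k powr h * \<gamma> k powr (- (e + s)) = \<gamma> k powr (- (d + s / 2))" by (metis powr_add)
        then show ?thesis by (simp only: mult.assoc)
      qed
      also have "\<dots> < q k" using K(2)[OF k] by simp
      finally show "K * \<gamma> 1 powr h * \<gamma> k powr (- (e + s)) < q k" .
    qed
  qed
  moreover have "e \<le> d" if "d \<in> ?A" for d unfolding e_def by (rule cInf_lower[OF that bdd])
  ultimately have "least_exponent q = e" unfolding least_exponent_def by (intro Least_equality) auto
  then show ?thesis using \<open>e \<in> ?A\<close> by simp
qed

lemma C3_lower_bounds:
  assumes RH C3
  obtains a b K where "a > 0" "b > 0" "a + b < 3/4" "K > 0" "K \<le> 1"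
    "\<And>k. k \<ge> 1 \<Longrightarrow> zeta'_abs k > K * \<gamma> k powr (- a)" "\<And>k. k \<ge> 1 \<Longrightarrow> \<delta> k > K * \<gamma> k powr (- b)"
proof -
  define e1 where "e1 = least_exponent zeta'_abs"
  define e2 where "e2 = least_exponent \<delta>"
  have e: "e1 \<in> lower_exponents zeta'_abs" "e2 \<in> lower_exponents \<delta>" "e1 + e2 < 3/4"
    using assms least_exponent_mem[OF assms(1)] by (auto simp: C3_def e1_def e2_def)
  \<comment> \<open>Each exponent is raised by a quarter of the slack. Half of the slack survives,
    and both exponents become positive even if the least ones are 0.\<close>
  define s where "s = (3/4 - (e1 + e2)) / 4"
  have s: "s > 0" using e by (simp add: s_def)
  obtain K1 where K1: "K1 > 0" "\<And>k. k \<ge> 1 \<Longrightarrow> zeta'_abs k > K1 * \<gamma> k powr (- (e1 + s))"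
    using e(1) s unfolding lower_exponents_def by blast
  obtain K2 where K2: "K2 > 0" "\<And>k. k \<ge> 1 \<Longrightarrow> \<delta> k > K2 * \<gamma> k powr (- (e2 + s))"
    using e(2) s unfolding lower_exponents_def by blast
  have e0: "e1 \<ge> 0" "e2 \<ge> 0" using e by (auto simp: lower_exponents_def)
  define K where "K = min 1 (min K1 K2)"
  have "(e1 + s) + (e2 + s) < 3/4" using e(3) by (simp add: s_def field_simps)
  show ?thesis
  proof (rule that[of "e1 + s" "e2 + s" K])
    show "(e1 + s) + (e2 + s) < 3/4" by fact
    show "K * \<gamma> k powr (- (e1 + s)) < zeta'_abs k" if "k \<ge> 1" for k
      by (rule le_less_trans[OF _ K1(2)[OF that]]) (auto simp: K_def intro!: mult_right_mono)
    show "K * \<gamma> k powr (- (e2 + s)) < \<delta> k" if "k \<ge> 1" for k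
      by (rule le_less_trans[OF _ K2(2)[OF that]]) (auto simp: K_def intro!: mult_right_mono)
  qed (use e0 s K1 K2 in \<open>auto simp: K_def\<close>)
qed

section \<open>Counting and summation by means of the gaps\<close>

text \<open>Half-open cells of length d contain at most one point each.\<close>

lemma card_separated_le:
  fixes A :: "real set"
  assumes d: "d > 0" and sep: "\<And>x y. x \<in> A \<Longrightarrow> y \<in> A \<Longrightarrow> x \<noteq> y \<Longrightarrow> d \<le> \<bar>x - y\<bar>"
    and sub: "A \<subseteq> {u..u + l}" and l: "l \<ge> 0"
  shows "finite A" "real (card A) \<le> l / d + 1"
proof -
  define h where "h x = nat \<lfloor>(x - u) / d\<rfloor>" for x
  have nn: "(x - u) / d \<ge> 0" if "x \<in> A" for x using that sub d by auto
  have inj: "inj_on h A"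
  proof (rule inj_onI, rule ccontr)
    fix x y assume xy: "x \<in> A" "y \<in> A" "h x = h y" "x \<noteq> y"
    then have "\<lfloor>(x - u) / d\<rfloor> = \<lfloor>(y - u) / d\<rfloor>"
      using nn[of x] nn[of y] by (simp only: h_def) (subst (asm) eq_nat_nat_iff, auto)
    then have "\<bar>(x - u) / d - (y - u) / d\<bar> < 1" by linarith
    then have "\<bar>x - y\<bar> < d" using d by (simp add: diff_divide_distrib[symmetric] abs_divide)
    then show False using sep[of x y] xy by simp
  qed
  have rng: "h ` A \<subseteq> {..nat \<lfloor>l / d\<rfloor>}"
  proof
    fix z assume "z \<in> h ` A"
    then obtain x where x: "x \<in> A" "z = h x" by auto
    have "(x - u) / d \<le> l / d" using x sub d by (intro divide_right_mono) auto
    then show "z \<in> {..nat \<lfloor>l / d\<rfloor>}" using x by (auto simp: h_def intro!: nat_mono floor_mono)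
  qed
  show "finite A" using finite_imageD[OF finite_subset[OF rng] inj] by simp
  have "card A \<le> card {..nat \<lfloor>l / d\<rfloor>}" by (rule card_inj_on_le[OF inj rng]) simp
  then have "real (card A) \<le> real (nat \<lfloor>l / d\<rfloor>) + 1" by simp
  also have "real (nat \<lfloor>l / d\<rfloor>) \<le> l / d" using l d by (simp add: of_nat_nat)
  finally show "real (card A) \<le> l / d + 1" by simp
qed

text \<open>A right-end rectangle lies below the graph of the decreasing function x^(-\<eta> - 1),
  whose primitive is - x^(-\<eta>) / \<eta>.\<close>

lemma powr_gap_bound:
  fixes u v \<eta> :: real
  assumes "0 < u" "u < v" "\<eta> > 0"
  shows "(v - u) * v powr (- \<eta> - 1) \<le> (u powr (- \<eta>) - v powr (- \<eta>)) / \<eta>"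
proof -
  have D: "((\<lambda>x. x powr (- \<eta>)) has_real_derivative (- \<eta>) * x powr (- \<eta> - 1)) (at x)" if "u \<le> x" for x
    using that assms by (intro has_real_derivative_powr) auto
  obtain z where z: "u < z" "z < v" "v powr (- \<eta>) - u powr (- \<eta>) = (v - u) * ((- \<eta>) * z powr (- \<eta> - 1))"
  proof -
    have "\<exists>z>u. z < v \<and> v powr (- \<eta>) - u powr (- \<eta>) = (v - u) * ((- \<eta>) * z powr (- \<eta> - 1))"
      by (rule MVT2[OF assms(2)]) (rule D)
    then show ?thesis using that by blast
  qed
  have "v powr (- \<eta> - 1) \<le> z powr (- \<eta> - 1)" using z assms by (intro powr_mono2') auto
  then have "(v - u) * v powr (- \<eta> - 1) \<le> (v - u) * z powr (- \<eta> - 1)" using assms by (intro mult_left_mono) auto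
  also have "\<dots> = (u powr (- \<eta>) - v powr (- \<eta>)) / \<eta>" using z(3) assms by (simp add: field_simps)
  finally show ?thesis .
qed

text \<open>A lower Riemann sum of a function integrable at infinity, with the ordinates as
  partition points: it converges whatever their density.\<close>

lemma summable_gap_powr:
  assumes RH and "\<eta> > 0"
  shows "summable (\<lambda>n. (nth_ordinate (Suc (Suc n)) - nth_ordinate (Suc n)) * nth_ordinate (Suc (Suc n)) powr (- \<eta> - 1))"
proof (rule summable_comparison_test')
  have pos: "nth_ordinate (Suc n) > 0" for n
    using gamma_pos[OF assms(1), of "int (Suc n)"] by (simp only: gamma_of_nat)
  have "(\<lambda>n. nth_ordinate (Suc n) powr (- \<eta>)) \<longlonglongrightarrow> 0"
  proof -
    have "((\<lambda>x::real. x powr (- \<eta>)) \<longlongrightarrow> 0) at_top" using assms(2) by (intro tendsto_neg_powr filterlim_ident) auto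
    moreover have "filterlim (\<lambda>n. nth_ordinate (Suc n)) at_top sequentially"
      using filterlim_compose[OF nth_ordinate_at_top[OF assms(1)] filterlim_Suc] by (simp add: o_def)
    ultimately show ?thesis by (rule filterlim_compose)
  qed
  then have "(\<lambda>n. nth_ordinate (Suc n) powr (- \<eta>) - nth_ordinate (Suc (Suc n)) powr (- \<eta>)) sums (nth_ordinate (Suc 0) powr (- \<eta>) - 0)"
    by (rule telescope_sums')
  then show "summable (\<lambda>n. (nth_ordinate (Suc n) powr (- \<eta>) - nth_ordinate (Suc (Suc n)) powr (- \<eta>)) / \<eta>)"
    by (intro summable_divide sums_summable)
  fix n
  have l: "nth_ordinate (Suc n) < nth_ordinate (Suc (Suc n))" by (rule nth_ordinate_Suc(2)[OF assms(1)])
  then have "norm ((nth_ordinate (Suc (Suc n)) - nth_ordinate (Suc n)) * nth_ordinate (Suc (Suc n)) powr (- \<eta> - 1)) =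
    (nth_ordinate (Suc (Suc n)) - nth_ordinate (Suc n)) * nth_ordinate (Suc (Suc n)) powr (- \<eta> - 1)"
    by (simp add: abs_mult)
  also have "\<dots> \<le> (nth_ordinate (Suc n) powr (- \<eta>) - nth_ordinate (Suc (Suc n)) powr (- \<eta>)) / \<eta>"
    by (rule powr_gap_bound[OF pos l assms(2)])
  finally show "norm ((nth_ordinate (Suc (Suc n)) - nth_ordinate (Suc n)) * nth_ordinate (Suc (Suc n)) powr (- \<eta> - 1)) \<le> (nth_ordinate (Suc n) powr (- \<eta>) - nth_ordinate (Suc (Suc n)) powr (- \<eta>)) / \<eta>" .
qed

section \<open>A Phragmen-Lindelof bound for 1/n\<close>

lemma C1_lower_bound:
  assumes "C1 \<alpha>"
  obtains \<epsilon> c where "\<epsilon> < 3/4" "c > 0" "\<And>t. t > t1 \<alpha> \<Longrightarrow> cmod (zeta (1 / 2 + s_path \<alpha> t)) > c * t powr (- \<epsilon>)"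
proof -
  obtain \<epsilon> where "\<epsilon> \<in> C1_exponents \<alpha>" "\<epsilon> < 3/4"
    using assms cInf_lessD unfolding C1_def by blast
  then show ?thesis using that unfolding C1_exponents_def by blast
qed

lemma ordinate_disc_unique:
  assumes RH and \<alpha>: "0 < \<alpha>" "\<alpha> < 1/2" and jk: "j \<ge> 1" "k \<ge> 1"
    and t: "\<bar>t - \<gamma> j\<bar> \<le> \<alpha> * \<delta>' j" "\<bar>t - \<gamma> k\<bar> \<le> \<alpha> * \<delta>' k"
  shows "j = k"
proof (rule ccontr)
  assume ne: "j \<noteq> k"
  have d: "\<delta>' i \<le> \<delta> i" for i by (simp add: \<delta>'_def)
  define g where "g = \<bar>\<gamma> k - \<gamma> j\<bar>"
  have g: "\<delta> k \<le> g" "\<delta> j \<le> g"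
    using delta_le_gap[OF assms(1) jk(1,2) ne] delta_le_gap[OF assms(1) jk(2,1)] ne by (auto simp: g_def abs_minus_commute)
  have "\<gamma> j \<noteq> \<gamma> k"
    using gamma_less[OF assms(1), of j k] gamma_less[OF assms(1), of k j] jk ne by (cases "j < k") auto
  then have g0: "g > 0" by (simp add: g_def)
  have "\<alpha> * \<delta>' i \<le> \<alpha> * g" if "i = j \<or> i = k" for i
    using that d[of i] g \<alpha> by (intro mult_left_mono) (auto intro: order_trans)
  then have "g \<le> \<alpha> * g + \<alpha> * g" using t unfolding g_def by (smt (verit))
  also have "\<dots> < 1/2 * g + 1/2 * g" using \<alpha> g0 by (intro add_strict_mono mult_strict_right_mono) auto
  finally show False by simp
qed

text \<open>The path of C1 is the left boundary of the half strip with the discs removed: the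
  imaginary axis between the discs and the right half circles. A boundary point of that region is
  thus recovered from its imaginary part.\<close>

lemma s_path_eqI:
  assumes RH and \<alpha>: "0 < \<alpha>" "\<alpha> < 1/2" and s: "Re s \<ge> 0"
    and out: "\<And>k. k \<ge> 1 \<Longrightarrow> \<alpha> * \<delta>' k \<le> cmod (s - \<i> * of_real (\<gamma> k))"
    and bd: "Re s = 0 \<or> (\<exists>k\<ge>1. cmod (s - \<i> * of_real (\<gamma> k)) = \<alpha> * \<delta>' k)"
  shows "s = s_path \<alpha> (Im s)"
proof -
  let ?P = "\<lambda>k. k \<ge> 1 \<and> \<bar>Im s - \<gamma> k\<bar> \<le> \<alpha> * \<delta>' k"
  have im: "\<bar>Im s - \<gamma> k\<bar> \<le> cmod (s - \<i> * of_real (\<gamma> k))" for k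
    using abs_Im_le_cmod[of "s - \<i> * of_real (\<gamma> k)"] by simp
  have sq: "(cmod (s - \<i> * of_real (\<gamma> k)))\<^sup>2 = (Re s)\<^sup>2 + (Im s - \<gamma> k)\<^sup>2" for k
    by (simp add: cmod_power2)
  have "x_path \<alpha> (Im s) = Re s"
  proof (cases "\<exists>k. ?P k")
    case False
    then have "\<not> (\<exists>k\<ge>1. cmod (s - \<i> * of_real (\<gamma> k)) = \<alpha> * \<delta>' k)" using im by metis
    then have "Re s = 0" using bd by blast
    moreover have "\<not> (\<exists>k\<ge>1. \<bar>Im s - \<gamma> k\<bar> \<le> \<alpha> * \<delta>' k)" using False by blast
    ultimately show ?thesis unfolding x_path_def by (simp only: if_False)
  next
    case True
    then obtain k where k: "?P k" by blast
    have the: "(THE k. ?P k) = k"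
    proof (rule the_equality)
      show "?P k" by (rule k)
      show "j = k" if "?P j" for j using that k ordinate_disc_unique[OF assms(1) \<alpha>] by blast
    qed
    have eq: "cmod (s - \<i> * of_real (\<gamma> k)) = \<alpha> * \<delta>' k"
    proof (cases "Re s = 0")
      case True
      then have "cmod (s - \<i> * of_real (\<gamma> k)) = \<bar>Im s - \<gamma> k\<bar>" by (simp add: cmod_eq_Im)
      then show ?thesis using k out[of k] by simp
    next
      case False
      then obtain j where j: "j \<ge> 1" "cmod (s - \<i> * of_real (\<gamma> j)) = \<alpha> * \<delta>' j" using bd by blast
      then have "j = k" using ordinate_disc_unique[OF assms(1) \<alpha>, of j k "Im s"] im[of j] k by simp
      then show ?thesis using j by simp
    qed
    have "x_path \<alpha> (Im s) = sqrt ((\<alpha> * \<delta>' k)\<^sup>2 - (Im s - \<gamma> k)\<^sup>2)"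
      unfolding x_path_def Let_def the using True by auto
    also have "\<dots> = sqrt ((Re s)\<^sup>2)" using sq[of k] eq by simp
    also have "\<dots> = Re s" using s by simp
    finally show ?thesis .
  qed
  then show ?thesis by (simp add: s_path_def complex_eq_iff)
qed

text \<open>The disc of radius 2 about 2 + i t is tangent to the imaginary axis, and a point at the
  height of the centre has distance Re s from its boundary; this is the denominator. RH keeps zeros
  out of the disc, and at the centre |n| is bounded below since zeta is there in the range of
  absolute convergence.\<close>

lemma n_fun_log_lower_bound:
  assumes RH
  shows "\<exists>M>0. \<forall>s. Im s \<ge> 3 \<and> 0 < Re s \<and> Re s \<le> 2 \<longrightarrow> cmod (f_fun s) \<le> exp (M * Im s / Re s)"
proof -
  obtain c where c: "c > 0" and sa: "\<And>s. 0 \<le> Re s \<Longrightarrow> Re s \<le> 2 \<Longrightarrow> Im s \<ge> 1 \<Longrightarrow>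
     c * Im s powr (7/4) \<le> cmod (sin (of_real pi * s / 4) * a_fun (1 / 2 + s))"
    using sin_a_fun_lower_bound by blast
  obtain C where C: "C > 0" and nC: "\<And>s. 0 \<le> Re s \<Longrightarrow> Re s \<le> 4 \<Longrightarrow> Im s \<ge> 1 \<Longrightarrow> cmod (n_fun s) \<le> exp (C * Im s)"
    using n_fun_strip_upper_bound by blast
  define c' where "c' = c * (1 - 1 / sqrt 2)"
  have c': "c' > 0" using c by (simp add: c'_def)
  define L where "L = \<bar>ln c'\<bar>"
  define D where "D = 2 * C + L + 1"
  have L: "L \<ge> 0" and D: "D > 0" using C by (auto simp: D_def L_def)
  have main: "cmod (f_fun s) \<le> exp ((2 * L + 4 * D) * Im s / Re s)" if s: "Im s \<ge> 3" "0 < Re s" "Re s \<le> 2" for s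
  proof -
    define t where "t = Im s"
    define x where "x = Re s"
    define z0 where "z0 = Complex 2 t"
    have t: "t \<ge> 3" and x: "0 < x" "x \<le> 2" using s by (auto simp: t_def x_def)
    have inb: "0 < Re z \<and> Re z < 4 \<and> 1 \<le> Im z \<and> Im z \<le> t + 2" if "z \<in> ball z0 2" for z
    proof -
      have "\<bar>Re (z0 - z)\<bar> < 2" "\<bar>Im (z0 - z)\<bar> < 2"
        using that abs_Re_le_cmod[of "z0 - z"] abs_Im_le_cmod[of "z0 - z"] by (auto simp: dist_norm)
      then show ?thesis using t by (auto simp: z0_def)
    qed
    have nz: "n_fun z \<noteq> 0" if "z \<in> ball z0 2" for z
    proof
      assume "n_fun z = 0"
      then have "zeta (1 / 2 + z) = 0" using n_fun_zero_iff[of z] inb[OF that] by auto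
      then have "Re (1 / 2 + z) = 1 / 2" using assms inb[OF that] by (auto simp: RH_def)
      then show False using inb[OF that] by simp
    qed
    obtain g where g: "g holomorphic_on ball z0 2" "\<And>z. z \<in> ball z0 2 \<Longrightarrow> n_fun z = exp (g z)"
      using contractible_imp_holomorphic_log[OF n_fun_holomorphic[of "ball z0 2"] convex_imp_contractible[OF convex_ball]] nz by blast
    have z0: "z0 \<in> ball z0 2" by simp
    have "c * t powr (7/4) \<le> cmod (sin (of_real pi * z0 / 4) * a_fun (1 / 2 + z0))"
      using sa[of z0] t by (simp add: z0_def)
    moreover have "1 - 1 / sqrt 2 \<le> cmod (zeta (1 / 2 + z0))" by (rule norm_zeta_ge) (simp add: z0_def)
    ultimately have "(c * t powr (7/4)) * (1 - 1 / sqrt 2) \<le> cmod (sin (of_real pi * z0 / 4) * a_fun (1 / 2 + z0)) * cmod (zeta (1 / 2 + z0))"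
      by (intro mult_mono) auto
    also have "\<dots> = cmod (n_fun z0)" using n_fun_eq[of z0] t by (simp add: norm_mult z0_def)
    finally have "c' * t powr (7/4) \<le> cmod (n_fun z0)" by (simp add: c'_def mult_ac)
    moreover have "c' * 1 \<le> c' * t powr (7/4)" using c' t by (intro mult_left_mono ge_one_powr_ge_zero) auto
    ultimately have "c' \<le> exp (Re (g z0))" using g(2)[OF z0] by simp
    then have "ln c' \<le> Re (g z0)" using c' by (metis ln_exp ln_le_cancel_iff exp_gt_zero)
    then have gz0: "Re (g z0) \<ge> - L" by (simp add: L_def)
    have Reg: "Re (g z) \<le> C * (t + 2)" if "z \<in> ball z0 2" for z
    proof -
      have "exp (Re (g z)) \<le> exp (C * Im z)" using nC[of z] inb[OF that] g(2)[OF that] by simp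
      then have "Re (g z) \<le> C * Im z" by simp
      also have "\<dots> \<le> C * (t + 2)" using inb[OF that] C by (intro mult_left_mono) auto
      finally show ?thesis .
    qed
    define A where "A = C * (t + 2) + L + 1"
    have A: "A > 0" using C L t by (simp add: A_def add_nonneg_pos)
    have ds: "dist z0 s = 2 - x"
    proof -
      have "z0 - s = of_real (2 - x)" by (simp add: complex_eq_iff z0_def t_def x_def)
      then show ?thesis unfolding dist_norm using x by (simp only: norm_of_real)
    qed
    have sb: "s \<in> ball z0 2" using ds x by simp
    have "cmod (g s - g z0) \<le> 2 * A * dist z0 s / (2 - dist z0 s)"
    proof (rule borel_caratheodory[OF g(1) A _ _ sb])
      show "Re (g z - g z0) < A" if "z \<in> ball z0 2" for z using Reg[OF that] gz0 by (simp add: A_def)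
    qed simp
    also have "\<dots> = 2 * A * (2 - x) / x" using ds by simp
    also have "\<dots> \<le> 2 * A * 2 / x" using A x by (intro divide_right_mono mult_left_mono) auto
    finally have "- Re (g s) \<le> 4 * A / x - Re (g z0)"
      using abs_Re_le_cmod[of "g s - g z0"] by simp
    also have "\<dots> \<le> 4 * A / x + L" using gz0 by simp
    also have "\<dots> \<le> 4 * (D * t) / x + 2 * L * t / x"
    proof (rule add_mono)
      have "C * (t + 2) \<le> 2 * C * t" using C t mult_left_mono[of 2 t C] by (simp add: algebra_simps)
      moreover have "L + 1 \<le> (L + 1) * t" using L t mult_left_mono[of 1 t "L + 1"] by simp
      moreover have "D * t = 2 * C * t + (L + 1) * t" by (simp add: D_def algebra_simps)
      ultimately have "A \<le> D * t" unfolding A_def by linarith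
      then show "4 * A / x \<le> 4 * (D * t) / x" using x by (intro divide_right_mono) auto
      have "L * x \<le> L * (2 * t)" using L x t by (intro mult_left_mono) auto
      then show "L \<le> 2 * L * t / x" using x by (simp add: pos_le_divide_eq mult_ac)
    qed
    also have "\<dots> = (2 * L + 4 * D) * t / x" by (simp add: add_divide_distrib[symmetric] algebra_simps)
    finally have "- Re (g s) \<le> (2 * L + 4 * D) * t / x" .
    moreover have "cmod (f_fun s) = exp (- Re (g s))"
      using g(2)[OF sb] by (simp add: f_fun_def norm_divide exp_minus inverse_eq_divide)
    ultimately show ?thesis by (simp add: t_def x_def)
  qed
  show ?thesis by (rule exI[of _ "2 * L + 4 * D"]) (use main L D in auto)
qed

text \<open>Centring the strip at Re s = 1 gives |Re s - 1| <= 1 < pi / 3, so the cosine in the real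
  part of the inner exponential is at least 1/2 and the factor decays doubly exponentially.\<close>

lemma norm_phragmen_lindelof_factor:
  assumes "0 \<le> Re s" "Re s \<le> 2" "\<eta> > 0"
  shows "cmod (exp (- of_real \<eta> * exp (- \<i> * (s - 1)))) \<le> exp (- \<eta> * exp (Im s) / 2)"
    "cmod (exp (- of_real \<eta> * exp (- \<i> * (s - 1)))) = exp (- \<eta> * Re (exp (- \<i> * (s - 1))))"
proof -
  have "\<bar>Re s - 1\<bar> \<le> 1" using assms by (auto simp: abs_le_iff)
  then have "\<bar>Re s - 1\<bar> \<le> pi / 3" using pi_gt3 by linarith
  then have "cos \<bar>Re s - 1\<bar> \<ge> cos (pi / 3)"
    using pi_gt3 by (intro cos_monotone_0_pi_le) auto
  then have "cos (Re s - 1) \<ge> 1/2" by (simp add: cos_60)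
  then have "exp (Im s) * (1/2) \<le> exp (Im s) * cos (Re s - 1)" by (intro mult_left_mono) auto
  moreover have "Re (exp (- \<i> * (s - 1))) = exp (Im s) * cos (Re s - 1)"
  proof -
    have "cos (1 - Re s) = cos (Re s - 1)" by (metis cos_minus minus_diff_eq)
    then show ?thesis by (simp add: Re_exp)
  qed
  ultimately have r: "Re (exp (- \<i> * (s - 1))) \<ge> exp (Im s) / 2" by simp
  show e: "cmod (exp (- of_real \<eta> * exp (- \<i> * (s - 1)))) = exp (- \<eta> * Re (exp (- \<i> * (s - 1))))"
    by simp
  have "- \<eta> * Re (exp (- \<i> * (s - 1))) \<le> - \<eta> * (exp (Im s) / 2)" using r assms(3) by (intro mult_left_mono_neg) auto
  then show "cmod (exp (- of_real \<eta> * exp (- \<i> * (s - 1)))) \<le> exp (- \<eta> * exp (Im s) / 2)"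
    unfolding e by simp
qed

text \<open>On the vertical boundary s f is bounded because n grows at least linearly; on the
  horizontal edges only the logarithmic bound is available. The maximum principle on truncated
  regions with a damping factor, followed by the removal of that factor, yields a bound uniform in
  the height.\<close>

lemma f_fun_quadrant_bound:
  assumes RH and \<alpha>: "0 < \<alpha>" "\<alpha> < 1/2" and "C1 \<alpha>"
    and K: "K > 0" "K \<le> 1" and b: "b > 0" "b < 1"
    and dK: "\<And>k. k \<ge> 1 \<Longrightarrow> \<delta> k > K * \<gamma> k powr (- b)"
  obtains B T where "\<And>s. 0 \<le> Re s \<Longrightarrow> Re s \<le> 2 \<Longrightarrow> Im s \<ge> T \<Longrightarrow>
      (\<And>k. k \<ge> 1 \<Longrightarrow> \<alpha> * \<delta>' k \<le> cmod (s - \<i> * of_real (\<gamma> k))) \<Longrightarrow> cmod (s * f_fun s) \<le> B"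
proof -
  obtain \<epsilon> l where l: "\<epsilon> < 3/4" "l > 0" and path: "\<And>t. t > t1 \<alpha> \<Longrightarrow> cmod (zeta (1 / 2 + s_path \<alpha> t)) > l * t powr (- \<epsilon>)"
    using C1_lower_bound[OF assms(4)] by blast
  obtain c where c: "c > 0" and sa: "\<And>s. 0 \<le> Re s \<Longrightarrow> Re s \<le> 2 \<Longrightarrow> Im s \<ge> 1 \<Longrightarrow>
     c * Im s powr (7/4) \<le> cmod (sin (of_real pi * s / 4) * a_fun (1 / 2 + s))"
    using sin_a_fun_lower_bound by blast
  obtain M where M: "M > 0" and fM: "\<And>s. Im s \<ge> 3 \<Longrightarrow> 0 < Re s \<Longrightarrow> Re s \<le> 2 \<Longrightarrow> cmod (f_fun s) \<le> exp (M * Im s / Re s)"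
    using n_fun_log_lower_bound[OF assms(1)] by blast
  have "\<forall>\<^sub>F n in sequentially. max 3 (t1 \<alpha> + 1) \<le> nth_ordinate n"
    using nth_ordinate_at_top[OF assms(1)] unfolding filterlim_at_top by blast
  then obtain k0 where k0: "k0 \<ge> 1" "max 3 (t1 \<alpha> + 1) \<le> nth_ordinate k0"
    unfolding eventually_sequentially by (metis le_add2 le_add1 nat_le_linear)
  define g where "g n = \<gamma> (int n)" for n
  define r where "r n = \<alpha> * \<delta>' (int n)" for n
  define T where "T = g k0"
  have T: "T \<ge> 3" "T > t1 \<alpha>" using k0 by (auto simp: T_def g_def gamma_of_nat)
  have gm: "g m < g n" if "m < n" for m n using gamma_less[OF assms(1), of "int m" "int n"] that by (simp add: g_def)
  have gle: "g m \<le> g n" if "m \<le> n" for m n using gm[of m n] that by (cases "m = n") auto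
  have dpos: "\<delta> (int n) > 0" if "n \<ge> 1" for n
    using dK[of "int n"] gamma_pos[OF assms(1), of "int n"] K that by (smt (verit) mult_nonneg_nonneg powr_ge_zero of_nat_1 of_nat_le_iff)
  \<comment> \<open>Both members of the minimum in \<delta>' are at least K / g n: the one because
    ln x <= x, the other because b < 1. This crude radius suffices here.\<close>
  have rlow: "r n \<ge> \<alpha> * K / g n" if n: "n \<ge> k0" for n
  proof -
    have gn: "g n \<ge> 3" using gle[OF n] T by (simp add: T_def)
    have n1: "int n \<ge> 1" using n k0 by simp
    have "ln (g n) \<le> g n" "ln (g n) > 0" using gn ln_le_minus_one[of "g n"] by auto
    then have "1 / g n \<le> 1 / ln (g n)" by (simp add: frac_le)
    moreover have "K / g n \<le> 1 / g n" using K gn by (intro divide_right_mono) auto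
    ultimately have 1: "K / g n \<le> 1 / ln \<bar>g n\<bar>" using gn by simp
    have "g n powr (- 1) \<le> g n powr (- b)" using gn b by (intro powr_mono) auto
    then have "K * g n powr (- 1) \<le> K * g n powr (- b)" using K by (intro mult_left_mono) auto
    also have "\<dots> \<le> \<delta> (int n)" using dK[OF n1] by (simp add: g_def)
    finally have "K / g n \<le> \<delta> (int n)" using gn by (simp add: powr_minus_divide)
    then have "K / g n \<le> \<delta>' (int n)" using 1 by (simp add: \<delta>'_def g_def)
    then have "\<alpha> * (K / g n) \<le> \<alpha> * \<delta>' (int n)" using \<alpha> by (intro mult_left_mono) auto
    then show ?thesis by (simp add: r_def)
  qed
  have rpos: "r n > 0" if "n \<ge> k0" for n
  proof -
    have "g n \<ge> 3" using gle[OF that] T by (simp add: T_def)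
    then have "\<alpha> * K / g n > 0" using \<alpha> K by simp
    then show ?thesis using rlow[OF that] by linarith
  qed
  define M' where "M' = M / (\<alpha> * K)"
  have M'pos: "M' > 0" using M \<alpha> K by (simp add: M'_def)
  \<comment> \<open>\<open>B1\<close> belongs to the path, \<open>B2\<close> to the edge Re s = 2
    and \<open>B0\<close> to the bottom edge; the damping pushes the top edge below
    \<open>B0\<close>. The 3 comes from |s| <= 3 Im s.\<close>
  define B1 where "B1 = 3 / (c * l)"
  define B2 where "B2 = 3 / (c * (1 - 1 / sqrt 2))"
  define B0 where "B0 = (2 + T) * exp (M' * T\<^sup>2)"
  define B where "B = max B0 (max B1 B2)"
  have B0: "B0 > 0" using T by (simp add: B0_def)
  have edge: "cmod (s * f_fun s) \<le> 3 / (c * m)"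
    if s: "0 \<le> Re s" "Re s \<le> 2" "Im s \<ge> 3" and m: "m > 0" "cmod (zeta (1 / 2 + s)) \<ge> m * Im s powr (- \<beta>)" "\<beta> \<le> 3/4" for s m \<beta>
  proof -
    define t where "t = Im s"
    have t: "t \<ge> 3" using s by (simp add: t_def)
    have "(c * t powr (7/4)) * (m * t powr (- \<beta>)) \<le> cmod (sin (of_real pi * s / 4) * a_fun (1 / 2 + s)) * cmod (zeta (1 / 2 + s))"
      using sa[of s] s m by (intro mult_mono) (auto simp: t_def)
    also have "\<dots> = cmod (n_fun s)" using n_fun_eq[of s] s by (simp add: norm_mult)
    finally have n: "c * m * (t powr (7/4) * t powr (- \<beta>)) \<le> cmod (n_fun s)" by (simp add: mult_ac)
    \<comment> \<open>Here the threshold 3/4 is used: 7/4 - \<beta> >= 1.\<close>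
    have "t powr 1 \<le> t powr (7/4 + - \<beta>)" using t m by (intro powr_mono) auto
    then have "t \<le> t powr (7/4) * t powr (- \<beta>)" using t unfolding powr_add by simp
    then have "c * m * t \<le> c * m * (t powr (7/4) * t powr (- \<beta>))" using c m by (intro mult_left_mono) auto
    then have n2: "c * m * t \<le> cmod (n_fun s)" using n by linarith
    have p: "c * m * t > 0" using c m t by simp
    have "cmod s \<le> 3 * t" using cmod_le[of s] s t by (auto simp: t_def)
    then have "cmod s / cmod (n_fun s) \<le> 3 * t / (c * m * t)" using n2 p t by (intro frac_le) auto
    also have "\<dots> = 3 / (c * m)" using t by simp
    finally show ?thesis by (simp add: f_fun_def norm_divide)
  qed
  have horiz: "cmod (s * f_fun s) \<le> (2 + g n) * exp (M' * (g n)\<^sup>2)"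
    if s: "Im s = g n" "r n \<le> Re s" "Re s \<le> 2" and n: "n \<ge> k0" for s n
  proof -
    have gn: "g n \<ge> 3" using gle[OF n] T by (simp add: T_def)
    have x: "Re s > 0" using s rpos[OF n] by simp
    have "\<alpha> * K / g n \<le> Re s" using rlow[OF n] s by simp
    then have "M * g n / Re s \<le> M * g n / (\<alpha> * K / g n)"
      using M gn \<alpha> K x by (intro divide_left_mono mult_pos_pos divide_pos_pos) auto
    also have "\<dots> = M' * (g n)\<^sup>2" by (simp add: M'_def power2_eq_square)
    finally have "exp (M * Im s / Re s) \<le> exp (M' * (g n)\<^sup>2)" using s by simp
    moreover have "cmod (f_fun s) \<le> exp (M * Im s / Re s)" using fM[of s] s x gn by simp
    ultimately have "cmod (f_fun s) \<le> exp (M' * (g n)\<^sup>2)" by (rule order_trans[rotated])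
    moreover have "cmod s \<le> 2 + g n" using cmod_le[of s] s x gn by simp
    ultimately show ?thesis unfolding norm_mult using gn by (intro mult_mono) auto
  qed
  have main: "cmod (s0 * f_fun s0) \<le> B"
    if s0: "0 \<le> Re s0" "Re s0 \<le> 2" "Im s0 \<ge> T"
      and out: "\<And>k. k \<ge> 1 \<Longrightarrow> \<alpha> * \<delta>' k \<le> cmod (s0 - \<i> * of_real (\<gamma> k))" for s0
  proof -
    define w where "w = Re (exp (- \<i> * (s0 - 1)))"
    have step: "cmod (s0 * f_fun s0) * exp (- \<eta> * w) \<le> B" if \<eta>: "\<eta> > 0" for \<eta>
    proof -
      \<comment> \<open>For fixed \<eta> the damping beats exp (M' x^2), so the top edge can be
        placed at an ordinate above s0 where the damped bound is below \<open>B0\<close>.\<close>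
      have "((\<lambda>x::real. (2 + x) * exp (M' * x\<^sup>2) * exp (- \<eta> * exp x / 2)) \<longlongrightarrow> 0) at_top"
        using \<eta> M'pos by real_asymp
      then have "\<forall>\<^sub>F x in at_top. (2 + x) * exp (M' * x\<^sup>2) * exp (- \<eta> * exp x / 2) < B0"
        using B0 by (rule order_tendstoD(2))
      then have "\<forall>\<^sub>F n in sequentially. (2 + g n) * exp (M' * (g n)\<^sup>2) * exp (- \<eta> * exp (g n) / 2) < B0"
        using nth_ordinate_at_top[OF assms(1)] unfolding g_def gamma_of_nat filterlim_iff by blast
      moreover have "\<forall>\<^sub>F n in sequentially. Im s0 \<le> g n"
        using nth_ordinate_at_top[OF assms(1)] unfolding g_def gamma_of_nat filterlim_at_top by blast
      moreover have "\<forall>\<^sub>F n in sequentially. k0 \<le> n" by (rule eventually_ge_at_top)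
      ultimately have "\<forall>\<^sub>F n in sequentially. (2 + g n) * exp (M' * (g n)\<^sup>2) * exp (- \<eta> * exp (g n) / 2) < B0 \<and> Im s0 \<le> g n \<and> k0 \<le> n"
        by eventually_elim auto
      then obtain k where k: "(2 + g k) * exp (M' * (g k)\<^sup>2) * exp (- \<eta> * exp (g k) / 2) < B0" "Im s0 \<le> g k" "k0 \<le> k"
        unfolding eventually_sequentially by blast
      \<comment> \<open>Only finitely many discs are removed, so \<open>S\<close> is closed, and
        \<open>U\<close>, the same region with strict inequalities, is open. A frontier point lies
        in \<open>S\<close> but not in \<open>U\<close> and therefore attains one of the
        equalities.\<close>
      define S where "S = {s. 0 \<le> Re s} \<inter> {s. Re s \<le> 2} \<inter> {s. T \<le> Im s} \<inter> {s. Im s \<le> g k} \<inter>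
          (\<Inter>j\<in>{k0..k}. {s. r j \<le> cmod (s - \<i> * of_real (g j))})"
      define U where "U = {s. 0 < Re s} \<inter> {s. Re s < 2} \<inter> {s. T < Im s} \<inter> {s. Im s < g k} \<inter>
          (\<Inter>j\<in>{k0..k}. {s. r j < cmod (s - \<i> * of_real (g j))})"
      have "closed S" unfolding S_def
        by (intro closed_Int closed_INT closed_halfspace_Re_ge closed_halfspace_Re_le closed_halfspace_Im_ge closed_halfspace_Im_le)
          (auto intro!: closed_Collect_le continuous_intros)
      have "open U" unfolding U_def
        by (intro open_Int open_INT open_halfspace_Re_gt open_halfspace_Re_lt open_halfspace_Im_gt open_halfspace_Im_lt)
          (auto intro!: open_Collect_less continuous_intros)
      then have "U \<subseteq> interior S" by (intro interior_maximal) (auto simp: U_def S_def intro: less_imp_le)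
      \<comment> \<open>The discs not removed explicitly are avoided anyway: their centres lie
        beyond the ordinate at the bottom or top edge, so every point of \<open>S\<close> has
        distance at least \<delta> from them.\<close>
      have outS: "\<alpha> * \<delta>' m \<le> cmod (s - \<i> * of_real (\<gamma> m))" if s: "s \<in> S" and m: "m \<ge> 1" for s m
      proof -
        define j where "j = nat m"
        have j: "m = int j" "j \<ge> 1" using m by (auto simp: j_def)
        have "r j \<le> cmod (s - \<i> * of_real (g j))"
        proof (cases "j \<in> {k0..k}")
          case True then show ?thesis using s by (auto simp: S_def)
        next
          case False
          have ims: "\<bar>Im s - g j\<bar> \<le> cmod (s - \<i> * of_real (g j))"
            using abs_Im_le_cmod[of "s - \<i> * of_real (g j)"] by simp
          have "\<delta> (int j) \<le> \<bar>Im s - g j\<bar>"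
          proof (cases "j < k0")
            case True
            then have "\<delta> (int j) \<le> \<bar>g j - g k0\<bar>" using delta_le_gap[OF assms(1), of "int k0" "int j"] j k0 by (simp add: g_def)
            also have "\<dots> \<le> \<bar>Im s - g j\<bar>" using gm[OF True] s by (auto simp: S_def T_def)
            finally show ?thesis .
          next
            case F2: False
            then have jk: "k < j" using False by auto
            then have "\<delta> (int j) \<le> \<bar>g j - g k\<bar>" using delta_le_gap[OF assms(1), of "int k" "int j"] j k0 k by (simp add: g_def)
            also have "\<dots> \<le> \<bar>Im s - g j\<bar>" using gm[OF jk] s by (auto simp: S_def T_def)
            finally show ?thesis .
          qed
          moreover have "r j \<le> \<delta> (int j)"
          proof -
            have "\<alpha> * \<delta>' (int j) \<le> \<alpha> * \<delta> (int j)" using \<alpha> by (intro mult_left_mono) (auto simp: \<delta>'_def)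
            also have "\<dots> \<le> 1 * \<delta> (int j)" using \<alpha> dpos[OF j(2)] by (intro mult_right_mono) auto
            finally show ?thesis by (simp add: r_def)
          qed
          ultimately show ?thesis using ims by linarith
        qed
        then show ?thesis by (simp add: r_def g_def j)
      qed
      have nz: "n_fun s \<noteq> 0" if s: "s \<in> S" for s
      proof
        assume "n_fun s = 0"
        moreover have im: "Im s > 0" "T \<le> Im s" "Im s \<le> g k" using s T by (auto simp: S_def)
        ultimately have "zeta (1 / 2 + s) = 0" using n_fun_zero_iff[of s] by simp
        then obtain m where m: "m \<ge> 1" "s = \<i> * of_real (\<gamma> m)" using zero_imp_gamma[OF assms(1) _ im(1)] by blast
        define j where "j = nat m"
        have j: "m = int j" using m by (simp add: j_def)
        have "Im s = g j" using m j by (simp add: g_def)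
        then have "j \<ge> k0" using gm[of j k0] im by (auto simp: T_def not_le[symmetric])
        then show False using outS[OF s m(1)] rpos[of j] m j by (simp add: r_def)
      qed
      define E where "E s = exp (- of_real \<eta> * exp (- \<i> * (s - 1)))" for s
      define G where "G s = s * f_fun s * E s" for s
      have holG: "G holomorphic_on {s. n_fun s \<noteq> 0}"
        unfolding G_def E_def f_fun_def by (intro holomorphic_intros n_fun_holomorphic) auto
      have SV: "S \<subseteq> {s. n_fun s \<noteq> 0}" using nz by blast
      have E1: "cmod (E s) \<le> 1" if "0 \<le> Re s" "Re s \<le> 2" for s
      proof -
        have "cmod (E s) \<le> exp (- \<eta> * exp (Im s) / 2)" unfolding E_def by (rule norm_phragmen_lindelof_factor(1)[OF that \<eta>])
        also have "\<dots> \<le> 1" using \<eta> by simp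
        finally show ?thesis .
      qed
      have "cmod (G s0) \<le> B"
      proof (rule maximum_modulus_frontier[of G S])
        show "G holomorphic_on interior S"
          using holG by (rule holomorphic_on_subset) (use SV interior_subset in blast)
        show "continuous_on (closure S) G"
          using holomorphic_on_imp_continuous_on[OF holomorphic_on_subset[OF holG SV]] \<open>closed S\<close> by simp
        have "S \<subseteq> cbox (Complex 0 T) (Complex 2 (g k))" by (auto simp: S_def in_cbox_complex_iff)
        then show "bounded S" using bounded_cbox bounded_subset by blast
        show "s0 \<in> S" using s0 k out by (auto simp: S_def r_def g_def) (metis k0(1) of_nat_1 of_nat_le_iff order_trans)
        fix s assume "s \<in> frontier S"
        then have "s \<in> S" "s \<notin> U" using \<open>closed S\<close> \<open>U \<subseteq> interior S\<close> by (auto simp: frontier_def)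
        then have sb: "0 \<le> Re s" "Re s \<le> 2" "T \<le> Im s" "Im s \<le> g k" by (auto simp: S_def)
        have Es: "cmod (E s) \<le> 1" using E1 sb by simp
        have Gle: "cmod (G s) \<le> X" if "cmod (s * f_fun s) \<le> X" for X
        proof -
          have "cmod (G s) = cmod (s * f_fun s) * cmod (E s)" by (simp add: G_def norm_mult)
          also have "\<dots> \<le> cmod (s * f_fun s) * 1" using Es by (intro mult_left_mono) auto
          finally show ?thesis using that by simp
        qed
        \<comment> \<open>At the height of an ordinate the distance to its zero is Re s
          itself.\<close>
        have xr: "r j \<le> Re s" if "Im s = g j" "j \<in> {k0..k}" for j
        proof -
          have "r j \<le> cmod (s - \<i> * of_real (g j))" using \<open>s \<in> S\<close> that by (auto simp: S_def)
          also have "s - \<i> * of_real (g j) = of_real (Re s)" using that by (simp add: complex_eq_iff)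
          finally show ?thesis using sb by simp
        qed
        consider "Im s = T" | "Im s = g k" | "Re s = 2" | "Re s = 0 \<or> (\<exists>j\<in>{k0..k}. r j = cmod (s - \<i> * of_real (g j)))"
          using \<open>s \<in> S\<close> \<open>s \<notin> U\<close> unfolding S_def U_def by force
        then show "cmod (G s) \<le> B"
        proof cases
          case 1
          then have "cmod (s * f_fun s) \<le> B0"
            using horiz[of s k0] xr[of k0] sb k by (simp add: B0_def T_def)
          then show ?thesis using Gle by (auto simp: B_def)
        next
          case 2
          have "cmod (s * f_fun s) \<le> (2 + g k) * exp (M' * (g k)\<^sup>2)"
            using horiz[of s k] xr[of k] 2 sb k by simp
          moreover have "cmod (E s) \<le> exp (- \<eta> * exp (g k) / 2)"
            using norm_phragmen_lindelof_factor(1)[OF sb(1,2) \<eta>] 2 by (simp add: E_def)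
          ultimately have "cmod (G s) \<le> (2 + g k) * exp (M' * (g k)\<^sup>2) * exp (- \<eta> * exp (g k) / 2)"
            unfolding G_def norm_mult[of "s * f_fun s"] by (intro mult_mono) (auto intro: order_trans[OF norm_ge_zero])
          then show ?thesis using k by (simp add: B_def)
        next
          case 3
          have "cmod (s * f_fun s) \<le> B2" unfolding B2_def
          proof (rule edge)
            show "cmod (zeta (1 / 2 + s)) \<ge> (1 - 1 / sqrt 2) * Im s powr (- 0)"
              using norm_zeta_ge[of "1 / 2 + s"] 3 sb T by simp
          qed (use sb T in auto)
          then show ?thesis using Gle by (auto simp: B_def)
        next
          case 4
          have "s = s_path \<alpha> (Im s)"
          proof (rule s_path_eqI[OF assms(1) \<alpha> sb(1)])
            show "\<And>m. m \<ge> 1 \<Longrightarrow> \<alpha> * \<delta>' m \<le> cmod (s - \<i> * of_real (\<gamma> m))" by (rule outS[OF \<open>s \<in> S\<close>])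
            show "Re s = 0 \<or> (\<exists>m\<ge>1. cmod (s - \<i> * of_real (\<gamma> m)) = \<alpha> * \<delta>' m)"
              using 4
            proof (elim disjE bexE)
              fix j assume j: "j \<in> {k0..k}" "r j = cmod (s - \<i> * of_real (g j))"
              then have "int j \<ge> 1 \<and> cmod (s - \<i> * of_real (\<gamma> (int j))) = \<alpha> * \<delta>' (int j)"
                using k0(1) by (simp add: r_def g_def)
              then show ?thesis by blast
            qed simp
          qed
          then have "cmod (zeta (1 / 2 + s)) \<ge> l * Im s powr (- \<epsilon>)" using path[of "Im s"] sb T by simp
          then have "cmod (s * f_fun s) \<le> B1" unfolding B1_def using edge[of s l \<epsilon>] sb T l by simp
          then show ?thesis using Gle by (auto simp: B_def)
        qed
      qed
      moreover have "cmod (E s0) = exp (- \<eta> * w)"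
        unfolding E_def w_def by (rule norm_phragmen_lindelof_factor(2)[OF s0(1,2) \<eta>])
      ultimately show ?thesis by (simp add: G_def norm_mult)
    qed
    \<comment> \<open>The bound \<open>B\<close> was fixed before \<eta>, so letting \<eta> tend to
      0 from the right removes the damping.\<close>
    have "((\<lambda>\<eta>. cmod (s0 * f_fun s0) * exp (- \<eta> * w)) \<longlongrightarrow> cmod (s0 * f_fun s0) * exp (- 0 * w)) (at_right 0)"
      by (intro tendsto_intros)
    then have "cmod (s0 * f_fun s0) * exp (- 0 * w) \<le> B"
    proof (rule tendsto_upperbound)
      show "\<forall>\<^sub>F \<eta> in at_right 0. cmod (s0 * f_fun s0) * exp (- \<eta> * w) \<le> B"
        using eventually_at_right_less[of 0] by eventually_elim (rule step)
    qed simp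
    then show ?thesis by simp
  qed
  show ?thesis by (rule that[of T B]) (use main in blast)
qed

section \<open>The partial fractions\<close>

lemma suminf_holomorphic:
  fixes f :: "nat \<Rightarrow> complex \<Rightarrow> complex"
  assumes "open U" "\<And>m. f m holomorphic_on U" "\<And>m s. s \<in> U \<Longrightarrow> cmod (f m s) \<le> M m" "summable M"
  shows "(\<lambda>s. \<Sum>m. f m s) holomorphic_on U"
proof (rule holomorphic_uniform_sequence[OF assms(1)])
  show "(\<lambda>s. \<Sum>m<n. f m s) holomorphic_on U" for n
    by (intro holomorphic_on_sum assms(2))
  have u: "uniform_limit U (\<lambda>n s. \<Sum>m<n. f m s) (\<lambda>s. \<Sum>m. f m s) sequentially"
    by (rule Weierstrass_m_test[OF _ assms(4)]) (use assms(3) in auto)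
  fix x assume "x \<in> U"
  then obtain d where "d > 0" "cball x d \<subseteq> U" using assms(1) open_contains_cball by blast
  then show "\<exists>d>0. cball x d \<subseteq> U \<and> uniform_limit (cball x d) (\<lambda>n s. \<Sum>m<n. f m s) (\<lambda>s. \<Sum>m. f m s) sequentially"
    using uniform_limit_on_subset[OF u] by blast
qed

lemma norm_inverse_le_Im:
  assumes "Im s > 0" "Im w \<ge> 0"
  shows "cmod (1 / (s + w)) \<le> 1 / Im s"
proof -
  have "Im s \<le> cmod (s + w)" using abs_Im_le_cmod[of "s + w"] assms by simp
  then show ?thesis using assms by (simp add: norm_divide frac_le)
qed

definition p_r_term :: "nat \<Rightarrow> complex \<Rightarrow> complex" where
  "p_r_term m s = c_coeff (4 * of_nat (Suc m)) * (1 / (s - 4 * of_nat (Suc m)) + 1 / (s + 4 * of_nat (Suc m)))"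

lemma p_r_eq: "p_r s = c_coeff 0 / s + (\<Sum>m. p_r_term m s)"
  by (simp add: p_r_def p_r_term_def Let_def)

lemma p_r_term_bound:
  obtains M where "summable M" "\<And>m. M m \<ge> 0" "\<And>m s. Im s > 0 \<Longrightarrow> cmod (p_r_term m s) \<le> M m / Im s"
proof -
  obtain C where C: "C > 0" "\<And>w::nat. cmod (c_coeff (4 * of_nat (Suc w))) \<le> C / (real w + 1)\<^sup>2"
    using c_coeff_real_bound by blast
  show ?thesis
  proof (rule that[of "\<lambda>m. C / (real m + 1)\<^sup>2 * 2"])
    have "summable (\<lambda>n. 1 / (real n + 1)\<^sup>2)"
      using sums_summable[OF inverse_squares_sums] by (simp add: add.commute)
    from summable_mult[OF this, of "C * 2"] show "summable (\<lambda>m. C / (real m + 1)\<^sup>2 * 2)" by simp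
    show "C / (real m + 1)\<^sup>2 * 2 \<ge> 0" for m using C by simp
    fix m and s :: complex assume s: "Im s > 0"
    have "cmod (1 / (s - 4 * of_nat (Suc m)) + 1 / (s + 4 * of_nat (Suc m))) \<le> 1 / Im s + 1 / Im s"
    proof -
      have "cmod (1 / (s - w)) \<le> 1 / Im s" if "Im w = 0" for w
        using norm_inverse_le_Im[OF s, of "- w"] that by simp
      moreover have "cmod (1 / (s + w)) \<le> 1 / Im s" if "Im w = 0" for w
        using norm_inverse_le_Im[OF s, of w] that by simp
      moreover have "Im (4 * of_nat (Suc m)) = 0" by simp
      ultimately show ?thesis by (intro order_trans[OF norm_triangle_ineq] add_mono) blast+
    qed
    then have "cmod (p_r_term m s) \<le> C / (real m + 1)\<^sup>2 * (1 / Im s + 1 / Im s)"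
      unfolding p_r_term_def norm_mult using C s by (intro mult_mono) auto
    then show "cmod (p_r_term m s) \<le> C / (real m + 1)\<^sup>2 * 2 / Im s" by simp
  qed
qed

lemma p_r_summable:
  assumes "Im s > 0"
  shows "summable (\<lambda>m. p_r_term m s)"
proof -
  obtain M where M: "summable M" "\<And>m. cmod (p_r_term m s) \<le> M m / Im s"
    using p_r_term_bound assms by metis
  show ?thesis
    by (rule summable_comparison_test'[OF summable_divide[OF M(1)]]) (rule M(2))
qed

lemma p_r_bound:
  obtains P where "P > 0" "\<And>s. Im s > 0 \<Longrightarrow> cmod (p_r s) \<le> P / Im s"
proof -
  obtain M where M: "summable M" "\<And>m. M m \<ge> 0" "\<And>m s. Im s > 0 \<Longrightarrow> cmod (p_r_term m s) \<le> M m / Im s"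
    using p_r_term_bound by metis
  define P where "P = cmod (c_coeff 0) + suminf M + 1"
  have P: "P > 0" using suminf_nonneg[OF M(1)] M(2) by (simp add: P_def add_nonneg_pos)
  show ?thesis
  proof (rule that[OF P])
    fix s :: complex assume s: "Im s > 0"
    have "cmod (p_r s) \<le> cmod (c_coeff 0 / s) + cmod (\<Sum>m. p_r_term m s)"
      unfolding p_r_eq by (rule norm_triangle_ineq)
    also have "cmod (\<Sum>m. p_r_term m s) \<le> (\<Sum>m. M m / Im s)"
      by (rule norm_suminf_le[OF M(3)[OF s] summable_divide[OF M(1)]])
    also have "\<dots> = suminf M / Im s" by (rule suminf_divide[OF M(1)])
    also have "cmod (c_coeff 0 / s) \<le> cmod (c_coeff 0) / Im s"
      using abs_Im_le_cmod[of s] s by (simp add: norm_divide frac_le)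
    finally have "cmod (p_r s) \<le> (cmod (c_coeff 0) + suminf M) / Im s" by (simp add: add_divide_distrib)
    also have "\<dots> \<le> P / Im s" using s by (intro divide_right_mono) (auto simp: P_def)
    finally show "cmod (p_r s) \<le> P / Im s" by simp
  qed
qed

text \<open>The majorants are uniform only for Im s > e with e > 0; these half planes exhaust the
  upper half plane.\<close>

lemma p_r_holomorphic: "p_r holomorphic_on {s. Im s > 0}"
proof -
  obtain M where M: "summable M" "\<And>m. M m \<ge> 0" "\<And>m s. Im s > 0 \<Longrightarrow> cmod (p_r_term m s) \<le> M m / Im s"
    using p_r_term_bound by metis
  have h: "p_r holomorphic_on {s. Im s > e}" if e: "e > 0" for e
  proof -
    have "(\<lambda>s. \<Sum>m. p_r_term m s) holomorphic_on {s. Im s > e}"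
    proof (rule suminf_holomorphic[OF open_halfspace_Im_gt _ _ summable_divide[OF M(1)]])
      fix m
      show "p_r_term m holomorphic_on {s. Im s > e}"
        unfolding p_r_term_def[abs_def] using e by (intro holomorphic_intros) (auto simp: complex_eq_iff)
      fix s assume s: "s \<in> {s. Im s > e}"
      then have "cmod (p_r_term m s) \<le> M m / Im s" using e by (intro M(3)) auto
      also have "\<dots> \<le> M m / e" using s e M(2) by (intro divide_left_mono) auto
      finally show "cmod (p_r_term m s) \<le> M m / e" .
    qed
    then show ?thesis unfolding p_r_eq[abs_def] using e by (intro holomorphic_intros) auto
  qed
  have "p_r holomorphic_on (\<Union>e\<in>{0<..}. {s. Im s > e})"
    using h by (intro holomorphic_on_UN_open open_halfspace_Im_gt) auto
  moreover have "(\<Union>e\<in>{0<..}. {s. Im s > e}) = {s. Im s > 0}"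
  proof (intro equalityI subsetI)
    fix x :: complex assume "x \<in> {s. Im s > 0}"
    then have "Im x / 2 \<in> {0<..}" "x \<in> {s. Im s > Im x / 2}" by auto
    then show "x \<in> (\<Union>e\<in>{0<..}. {s. Im s > e})" by blast
  qed auto
  ultimately show ?thesis by simp
qed

lemma p_r_minus:
  assumes "Im s > 0"
  shows "p_r (- s) = - p_r s"
proof -
  have "p_r_term m (- s) = - p_r_term m s" for m
  proof -
    have e: "1 / (- s - w) + 1 / (- s + w) = - (1 / (s - w) + 1 / (s + w))" for w
      by (metis (no_types, opaque_lifting) add.commute minus_add_distrib minus_diff_eq minus_divide_right uminus_add_conv_diff)
    show ?thesis unfolding p_r_term_def e by (simp only: mult_minus_right)
  qed
  then show ?thesis using suminf_minus[OF p_r_summable[OF assms]] by (simp add: p_r_eq)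
qed

section \<open>The partial fraction over the zeros and the removable singularities\<close>

text \<open>Packages RH with bounds of the kind extracted from C3. The bound on zeta' makes the
  zeros simple.\<close>

locale simple_spaced_zeros =
  fixes a b K :: real
  assumes RH: RH and ab: "a > 0" "b > 0" "a + b < 3/4" and K: "K > 0" "K \<le> 1"
    and zeta'_lower: "\<And>k. k \<ge> 1 \<Longrightarrow> zeta'_abs k > K * \<gamma> k powr (- a)"
    and delta_lower: "\<And>k. k \<ge> 1 \<Longrightarrow> \<delta> k > K * \<gamma> k powr (- b)"
begin

text \<open>The indices start at 0, as in the series \<open>p_i\<close>: \<open>ord m\<close> has
  index m + 1 among the ordinates.\<close>

definition ord :: "nat \<Rightarrow> real" where "ord m = nth_ordinate (Suc m)"
definition zer :: "nat \<Rightarrow> complex" where "zer m = \<i> * of_real (ord m)"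
definition res :: "nat \<Rightarrow> complex" where "res m = c_coeff (zer m)"
definition gap :: "nat \<Rightarrow> real" where "gap m = \<delta> (int (Suc m))"
definition p_i_term :: "nat \<Rightarrow> complex \<Rightarrow> complex" where
  "p_i_term m s = res m * (1 / (s - zer m) + 1 / (s + zer m))"

lemma ord_eq_gamma: "ord m = \<gamma> (int (Suc m))"
  unfolding ord_def by (rule gamma_of_nat[symmetric])

lemma p_i_eq: "p_i s = (\<Sum>m. p_i_term m s)"
  by (simp only: p_i_def p_i_term_def Let_def res_def zer_def ord_eq_gamma)

lemma ord_pos: "ord m > 0"
  unfolding ord_eq_gamma by (rule gamma_pos[OF RH]) simp

lemma ord_less: "m < n \<Longrightarrow> ord m < ord n"
  unfolding ord_eq_gamma by (rule gamma_less[OF RH]) auto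

lemma ord_le: "m \<le> n \<Longrightarrow> ord m \<le> ord n"
  using ord_less[of m n] by (cases "m = n") auto

lemma ord_at_top: "filterlim ord at_top sequentially"
  unfolding ord_def[abs_def] using filterlim_compose[OF nth_ordinate_at_top[OF RH] filterlim_Suc] by (simp add: o_def)

lemma ord_eventually_ge: "\<forall>\<^sub>F m in sequentially. ord m \<ge> T"
  using ord_at_top unfolding filterlim_at_top by blast

lemma Im_zer: "Im (zer m) = ord m" and Re_zer: "Re (zer m) = 0"
  by (simp_all add: zer_def)

lemma zeta_zer: "zeta (1 / 2 + zer m) = 0"
  unfolding zer_def ord_eq_gamma by (rule gamma_zero[OF RH]) simp

lemma zero_imp_zer:
  assumes "n_fun s = 0" "Im s > 0"
  obtains m where "s = zer m"
proof -
  have "zeta (1 / 2 + s) = 0" using n_fun_zero_iff[of s] assms by simp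
  then obtain k where k: "k \<ge> 1" "s = \<i> * of_real (\<gamma> k)" using zero_imp_gamma[OF RH _ assms(2)] by blast
  then have "s = zer (nat (k - 1))" unfolding zer_def ord_eq_gamma by simp
  then show ?thesis by (rule that)
qed

lemma gap_lower: "gap m > K * ord m powr (- b)"
  unfolding gap_def ord_eq_gamma by (rule delta_lower) simp

lemma gap_pos: "gap m > 0"
  using gap_lower[of m] K by (smt (verit) mult_nonneg_nonneg powr_ge_zero)

lemma gap_le: "m \<noteq> n \<Longrightarrow> gap m \<le> \<bar>ord m - ord n\<bar>"
  unfolding gap_def ord_eq_gamma by (rule delta_le_gap[OF RH]) auto

lemma gap_le_ord: "gap m \<le> 2 * ord m"
  unfolding gap_def ord_eq_gamma by (rule delta_le_gamma[OF RH]) simp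

lemma deriv_n_fun_zer_nonzero: "deriv n_fun (zer m) \<noteq> 0"
proof -
  have "cmod (deriv zeta (1 / 2 + zer m)) > 0"
    using zeta'_lower[of "int (Suc m)"] K unfolding zeta'_abs_def zer_def ord_eq_gamma
    by (smt (verit) mult_nonneg_nonneg powr_ge_zero of_nat_Suc of_nat_0_le_iff)
  then show ?thesis
    using deriv_n_fun_zero[of "zer m"] zeta_zer[of m] ord_pos[of m] sin_pi_quarter_nonzero[of "zer m"] xi_eq_mult_zeta(2)[of "1 / 2 + zer m"]
    by (auto simp: Im_zer)
qed

text \<open>At a zero of zeta the product rule leaves only the term with zeta', so |n'| is at least
  a constant times t^(7/4) t^(-a).\<close>

lemma res_bound:
  obtains C where "C > 0" "\<And>m. ord m \<ge> 1 \<Longrightarrow> cmod (res m) \<le> C * ord m powr (a - 7/4)"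
proof -
  obtain c where c: "c > 0" and sa: "\<And>s. 0 \<le> Re s \<Longrightarrow> Re s \<le> 2 \<Longrightarrow> Im s \<ge> 1 \<Longrightarrow>
     c * Im s powr (7/4) \<le> cmod (sin (of_real pi * s / 4) * a_fun (1 / 2 + s))"
    using sin_a_fun_lower_bound by blast
  show ?thesis
  proof (rule that[of "1 / (c * K)"])
    show "1 / (c * K) > 0" using c K by simp
    fix m assume o: "ord m \<ge> 1"
    have z: "cmod (deriv zeta (1 / 2 + zer m)) \<ge> K * ord m powr (- a)"
      using zeta'_lower[of "int (Suc m)"] unfolding zeta'_abs_def zer_def ord_eq_gamma by simp
    have "(c * ord m powr (7/4)) * (K * ord m powr (- a)) \<le> cmod (sin (of_real pi * zer m / 4) * a_fun (1 / 2 + zer m)) * cmod (deriv zeta (1 / 2 + zer m))"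
      using sa[of "zer m"] z o c K by (intro mult_mono) (auto simp: Im_zer Re_zer)
    also have "\<dots> = cmod (deriv n_fun (zer m))"
      using deriv_n_fun_zero[of "zer m"] zeta_zer[of m] ord_pos[of m] by (simp add: Im_zer norm_mult)
    finally have d: "c * K * (ord m powr (7/4) * ord m powr (- a)) \<le> cmod (deriv n_fun (zer m))" by (simp add: mult_ac)
    have e: "ord m powr (7/4) * ord m powr (- a) = ord m powr (7/4 - a)" by (simp add: powr_add[symmetric])
    have p: "c * K * ord m powr (7/4 - a) > 0" using c K ord_pos[of m] by simp
    have "cmod (res m) = 1 / cmod (deriv n_fun (zer m))" by (simp add: res_def c_coeff_def norm_divide)
    also have "\<dots> \<le> 1 / (c * K * ord m powr (7/4 - a))"
      using d p unfolding e by (intro frac_le) auto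
    also have "\<dots> = 1 / (c * K) * ord m powr (- (7/4 - a))" by (simp only: powr_minus_divide) simp
    also have "- (7/4 - a) = a - 7/4" by simp
    finally show "cmod (res m) \<le> 1 / (c * K) * ord m powr (a - 7/4)" .
  qed
qed

text \<open>Write t^(a - 7/4) as t^(-b) t^(-\<eta> - 1) with \<eta> = 3/4 - a - b > 0. The first
  factor is at most 1/K times the gap to the preceding ordinate, and what results is the summable
  Riemann sum over the gaps.\<close>

lemma summable_res: "summable (\<lambda>m. cmod (res m))"
proof -
  obtain C where C: "C > 0" "\<And>m. ord m \<ge> 1 \<Longrightarrow> cmod (res m) \<le> C * ord m powr (a - 7/4)"
    using res_bound by metis
  define \<eta> where "\<eta> = 3/4 - a - b"
  have \<eta>: "\<eta> > 0" using ab by (simp add: \<eta>_def)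
  obtain N where N: "\<And>m. m \<ge> N \<Longrightarrow> ord m \<ge> 1"
    using ord_eventually_ge[of 1] unfolding eventually_sequentially by blast
  have s: "summable (\<lambda>m. C / K * ((ord (Suc m) - ord m) * ord (Suc m) powr (- \<eta> - 1)))"
    unfolding ord_def by (rule summable_mult[OF summable_gap_powr[OF RH \<eta>]])
  \<comment> \<open>The shift by one provides a preceding ordinate within the enumeration.\<close>
  have "summable (\<lambda>m. cmod (res (Suc m)))"
  proof (rule summable_comparison_test'[OF s])
    fix m assume m: "m \<ge> N"
    have o: "ord (Suc m) \<ge> 1" using N[of "Suc m"] m by simp
    have e: "ord (Suc m) powr (a - 7/4) = ord (Suc m) powr (- b) * ord (Suc m) powr (- \<eta> - 1)"
      by (simp add: powr_add[symmetric] \<eta>_def)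
    have "K * ord (Suc m) powr (- b) \<le> ord (Suc m) - ord m"
      using gap_lower[of "Suc m"] gap_le[of "Suc m" m] ord_less[of m "Suc m"] by simp
    then have le: "ord (Suc m) powr (- b) \<le> (ord (Suc m) - ord m) / K" using K by (simp add: field_simps)
    have "ord (Suc m) powr (a - 7/4) \<le> (ord (Suc m) - ord m) / K * ord (Suc m) powr (- \<eta> - 1)"
      unfolding e by (rule mult_right_mono[OF le]) simp
    then have "C * ord (Suc m) powr (a - 7/4) \<le> C * ((ord (Suc m) - ord m) / K * ord (Suc m) powr (- \<eta> - 1))"
      using C by (intro mult_left_mono) auto
    then show "norm (cmod (res (Suc m))) \<le> C / K * ((ord (Suc m) - ord m) * ord (Suc m) powr (- \<eta> - 1))"
      using C(2)[OF o] by simp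
  qed
  then show ?thesis by (subst (asm) summable_Suc_iff)
qed

lemma norm_plus_zer_ge: "Im s > 0 \<Longrightarrow> cmod (1 / (s + zer m)) \<le> 1 / Im s"
  using norm_inverse_le_Im[of s "zer m"] ord_pos[of m] by (simp add: Im_zer)

lemma norm_minus_zer_ge: "cmod (s - zer m) \<ge> \<bar>Im s - ord m\<bar>"
  using abs_Im_le_cmod[of "s - zer m"] by (simp add: Im_zer)

lemma norm_p_i_term_le:
  assumes "Im s > 0"
  shows "cmod (p_i_term m s) \<le> cmod (res m) / cmod (s - zer m) + cmod (res m) / Im s"
proof -
  have "cmod (p_i_term m s) \<le> cmod (res m) * (cmod (1 / (s - zer m)) + cmod (1 / (s + zer m)))"
    unfolding p_i_term_def norm_mult by (intro mult_left_mono norm_triangle_ineq) auto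
  also have "\<dots> \<le> cmod (res m) * (1 / cmod (s - zer m) + 1 / Im s)"
    using norm_plus_zer_ge[OF assms, of m] by (intro mult_left_mono add_mono) (auto simp: norm_divide)
  finally show ?thesis by (simp add: algebra_simps)
qed

lemma p_i_summable:
  assumes "Im s > 0"
  shows "summable (\<lambda>m. p_i_term m s)"
proof -
  obtain N where N: "\<And>m. m \<ge> N \<Longrightarrow> ord m \<ge> Im s + 1"
    using ord_eventually_ge[of "Im s + 1"] unfolding eventually_sequentially by blast
  show ?thesis
  proof (rule summable_comparison_test')
    show "summable (\<lambda>m. cmod (res m) + cmod (res m) / Im s)"
      by (intro summable_add summable_divide summable_res)
    fix m assume m: "m \<ge> N"
    have "1 \<le> cmod (s - zer m)" using norm_minus_zer_ge[of s m] N[OF m] by linarith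
    then have "cmod (res m) / cmod (s - zer m) \<le> cmod (res m) / 1" by (intro divide_left_mono) auto
    then show "norm (p_i_term m s) \<le> cmod (res m) + cmod (res m) / Im s"
      using norm_p_i_term_le[OF assms, of m] by simp
  qed
qed

lemma p_i_minus:
  assumes "Im s > 0"
  shows "p_i (- s) = - p_i s"
proof -
  have "p_i_term m (- s) = - p_i_term m s" for m
  proof -
    have e: "1 / (- s - w) + 1 / (- s + w) = - (1 / (s - w) + 1 / (s + w))" for w
      by (metis (no_types, opaque_lifting) add.commute minus_add_distrib minus_diff_eq minus_divide_right uminus_add_conv_diff)
    show ?thesis unfolding p_i_term_def e by (simp only: mult_minus_right)
  qed
  then show ?thesis using suminf_minus[OF p_i_summable[OF assms]] by (simp add: p_i_eq)
qed

lemma f_minus_p_minus: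
  assumes "Im s > 0"
  shows "f_fun (- s) - p_fun (- s) = - (f_fun s - p_fun s)"
  using p_i_minus[OF assms] p_r_minus[OF assms] by (simp add: f_fun_def p_fun_def n_fun_minus)

lemma zer_dist: "m \<noteq> n \<Longrightarrow> cmod (zer m - zer n) \<ge> gap n"
proof -
  assume "m \<noteq> n"
  then have "gap n \<le> \<bar>ord m - ord n\<bar>" using gap_le[of n m] by (simp add: abs_minus_commute)
  also have "\<dots> = cmod (zer m - zer n)"
    using norm_of_real[of "ord m - ord n", where 'a = complex] by (simp add: zer_def norm_mult right_diff_distrib[symmetric] del: norm_of_real)
  finally show ?thesis .
qed

lemma Im_pos_ball: "s \<in> ball (zer k) (gap k / 2) \<Longrightarrow> Im s > 0"
  using abs_Im_le_cmod[of "zer k - s"] gap_le_ord[of k] by (simp add: dist_norm Im_zer)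

lemma not_Z_circ:
  assumes "Im s \<noteq> 0" "n_fun s \<noteq> 0"
  shows "s \<notin> Z_circ"
  using n_fun_zero_iff[OF assms(1)] assms by (auto simp: Z_circ_def Z_i_def)

lemma zer_Z_circ: "zer k \<in> Z_circ" "- zer k \<in> Z_circ"
proof -
  have nr: "zer k \<notin> \<real>" "- zer k \<notin> \<real>" using ord_pos[of k] by (auto simp: complex_is_Real_iff Im_zer)
  have "n_fun (zer k) = 0" using n_fun_zero_iff[of "zer k"] zeta_zer[of k] ord_pos[of k] by (simp add: Im_zer)
  then have "n_fun (- zer k) = 0" by (simp add: n_fun_minus)
  then have "zeta (1 / 2 + - zer k) = 0" using n_fun_zero_iff[of "- zer k"] ord_pos[of k] by (simp add: Im_zer)
  then show "zer k \<in> Z_circ" "- zer k \<in> Z_circ" using zeta_zer[of k] nr by (auto simp: Z_circ_def Z_i_def)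
qed

text \<open>The residues of \<^const>\<open>f_fun\<close> and \<^const>\<open>p_i\<close> at a simple zero agree, so the singularity is removable.\<close>
lemma Delta_holomorphic_near_zer:
  obtains g where "g holomorphic_on ball (zer k) (gap k / 2)"
    "\<And>s. s \<in> ball (zer k) (gap k / 2) \<Longrightarrow> \<Delta> s = g s"
    "((\<lambda>s. f_fun s - p_fun s) \<longlongrightarrow> \<Delta> (zer k)) (at (zer k))"
proof -
  define z0 where "z0 = zer k"
  define U where "U = ball z0 (gap k / 2)"
  have U: "open U" "z0 \<in> U" using gap_pos[of k] by (auto simp: U_def)
  have ImU: "Im s > 0" if "s \<in> U" for s using that Im_pos_ball[of s k] by (simp add: U_def z0_def)
  have far: "cmod (s - zer m) \<ge> gap k / 2" if "s \<in> U" "m \<noteq> k" for s m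
  proof -
    have "gap k \<le> cmod (zer m - z0)" using zer_dist[OF that(2)] by (simp add: z0_def)
    also have "\<dots> \<le> cmod (s - zer m) + cmod (s - z0)" using norm_triangle_ineq4[of "s - z0" "s - zer m"] by (simp add: add.commute)
    also have "cmod (s - z0) < gap k / 2" using that by (simp add: U_def dist_norm norm_minus_commute)
    finally show ?thesis by simp
  qed
  have nz: "n_fun s \<noteq> 0" if sU: "s \<in> U" "s \<noteq> z0" for s
  proof
    assume "n_fun s = 0"
    then obtain m where m: "s = zer m" using zero_imp_zer[OF _ ImU[OF sU(1)]] by blast
    then have "m \<noteq> k" using sU by (auto simp: z0_def)
    then show False using far[OF sU(1), of m] m gap_pos[of k] by simp
  qed
  \<comment> \<open>The series without its k-th term has no pole in \<open>U\<close>, since the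
    other zeros are at least \<open>gap k / 2\<close> away.\<close>
  define q where "q s = (\<Sum>m. if m = k then 0 else p_i_term m s)" for s
  have q: "q holomorphic_on U"
    unfolding q_def
  proof (rule suminf_holomorphic[OF U(1)])
    show "summable (\<lambda>m. cmod (res m) / (gap k / 2) + cmod (res m) / ord 0)"
      by (intro summable_add summable_divide summable_res)
    fix m
    have nzero: "s - zer m \<noteq> 0" if "s \<in> U" "m \<noteq> k" for s using far[OF that] gap_pos[of k] by auto
    have pzero: "s + zer m \<noteq> 0" if "s \<in> U" for s using ImU[OF that] ord_pos[of m] by (auto simp: complex_eq_iff Im_zer)
    show "(\<lambda>s. if m = k then 0 else p_i_term m s) holomorphic_on U"
      by (cases "m = k") (auto simp: p_i_term_def intro!: holomorphic_intros dest: nzero pzero)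
    fix s assume s: "s \<in> U"
    have "cmod (p_i_term m s) \<le> cmod (res m) / (gap k / 2) + cmod (res m) / ord 0" if "m \<noteq> k"
    proof -
      have "cmod (1 / (s - zer m)) \<le> 1 / (gap k / 2)"
        using far[OF s that] gap_pos[of k] by (simp only: norm_divide norm_one) (intro frac_le, auto)
      moreover have "cmod (1 / (s + zer m)) \<le> 1 / ord 0"
      proof -
        have "ord 0 \<le> cmod (s + zer m)"
          using abs_Im_le_cmod[of "s + zer m"] ImU[OF s] ord_le[of 0 m] by (simp add: Im_zer)
        then show ?thesis using ord_pos[of 0] by (simp add: norm_divide frac_le)
      qed
      ultimately have "cmod (1 / (s - zer m) + 1 / (s + zer m)) \<le> 1 / (gap k / 2) + 1 / ord 0"
        by (intro order_trans[OF norm_triangle_ineq] add_mono)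
      then have "cmod (p_i_term m s) \<le> cmod (res m) * (1 / (gap k / 2) + 1 / ord 0)"
        unfolding p_i_term_def norm_mult by (intro mult_left_mono) auto
      then show ?thesis by (simp add: distrib_left)
    qed
    then show "cmod (if m = k then 0 else p_i_term m s) \<le> cmod (res m) / (gap k / 2) + cmod (res m) / ord 0"
      using gap_pos[of k] ord_pos[of 0] by (cases "m = k") auto
  qed
  have split: "p_i s = p_i_term k s + q s" if s: "s \<in> U" for s
  proof -
    have "(\<lambda>m. if m = k then p_i_term k s else 0) sums p_i_term k s" by (rule sums_single)
    from sums_diff[OF summable_sums[OF p_i_summable[OF ImU[OF s]]] this]
    have "(\<lambda>m. p_i_term m s - (if m = k then p_i_term k s else 0)) sums (p_i s - p_i_term k s)" by (simp add: p_i_eq)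
    also have "(\<lambda>m. p_i_term m s - (if m = k then p_i_term k s else 0)) = (\<lambda>m. if m = k then 0 else p_i_term m s)" by auto
    finally show ?thesis by (simp add: q_def sums_iff)
  qed
  define H where "H s = res k / (s + z0) + q s + p_r s" for s
  have H: "H holomorphic_on U"
    unfolding H_def
  proof (intro holomorphic_intros q)
    show "p_r holomorphic_on U" by (rule holomorphic_on_subset[OF p_r_holomorphic]) (use ImU in auto)
    show "s + z0 \<noteq> 0" if "s \<in> U" for s using ImU[OF that] ImU[OF U(2)] by (auto simp: complex_eq_iff)
  qed
  define F where "F s = f_fun s - p_fun s" for s
  have F: "F s = 1 / n_fun s - res k / (s - z0) - H s" if "s \<in> U" for s
    unfolding F_def p_fun_def split[OF that] H_def f_fun_def p_i_term_def by (simp add: z0_def algebra_simps)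
  have holF: "F holomorphic_on U - {z0}"
  proof (rule holomorphic_transform)
    show "(\<lambda>s. 1 / n_fun s - res k / (s - z0) - H s) holomorphic_on U - {z0}"
      by (intro holomorphic_intros n_fun_holomorphic holomorphic_on_subset[OF H]) (use nz in auto)
  qed (use F in auto)
  \<comment> \<open>The criterion for a removable singularity. The limit is 1 / n'(z0) -
    \<open>res k\<close>, which is 0 because the coefficient was defined as that residue.\<close>
  have lim: "((\<lambda>s. (s - z0) * F s) \<longlongrightarrow> 0) (at z0)"
  proof (rule Lim_transform_eventually)
    have "(n_fun has_field_derivative deriv n_fun z0) (at z0)"
      by (intro holomorphic_derivI[OF n_fun_holomorphic[of UNIV]]) auto
    moreover have "n_fun z0 = 0"
      using n_fun_zero_iff[of z0] zeta_zer[of k] ImU[OF U(2)] by (simp add: z0_def)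
    ultimately have d: "((\<lambda>s. n_fun s / (s - z0)) \<longlongrightarrow> deriv n_fun z0) (at z0)"
      by (simp add: has_field_derivative_iff)
    have "isCont H z0" using H U by (metis continuous_on_eq_continuous_at holomorphic_on_imp_continuous_on)
    then have Hl: "(H \<longlongrightarrow> H z0) (at z0)" by (simp add: isCont_def)
    have dn: "deriv n_fun z0 \<noteq> 0" unfolding z0_def by (rule deriv_n_fun_zer_nonzero)
    have "((\<lambda>s. 1 / (n_fun s / (s - z0)) - res k - (s - z0) * H s) \<longlongrightarrow> 1 / deriv n_fun z0 - res k - (z0 - z0) * H z0) (at z0)"
      by (intro tendsto_intros d Hl dn)
    then show "((\<lambda>s. 1 / (n_fun s / (s - z0)) - res k - (s - z0) * H s) \<longlongrightarrow> 0) (at z0)"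
      by (simp add: res_def c_coeff_def z0_def)
    have "\<forall>\<^sub>F s in at z0. s \<in> U - {z0}" using eventually_at_in_open[OF U] by simp
    then show "\<forall>\<^sub>F s in at z0. 1 / (n_fun s / (s - z0)) - res k - (s - z0) * H s = (s - z0) * F s"
      by eventually_elim (simp add: F right_diff_distrib)
  qed
  have "z0 \<in> interior U" using U by (simp add: interior_open)
  then obtain g where g: "g holomorphic_on U" "\<And>s. s \<in> U - {z0} \<Longrightarrow> g s = F s"
    using holomorphic_on_extend_lim[OF holF] lim by blast
  have "isCont g z0" using g(1) U by (metis continuous_on_eq_continuous_at holomorphic_on_imp_continuous_on)
  then have gl: "(g \<longlongrightarrow> g z0) (at z0)" by (simp add: isCont_def)
  have Fl: "(F \<longlongrightarrow> g z0) (at z0)"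
  proof (rule Lim_transform_eventually[OF gl])
    have "\<forall>\<^sub>F s in at z0. s \<in> U - {z0}" using eventually_at_in_open[OF U] by simp
    then show "\<forall>\<^sub>F s in at z0. g s = F s" by eventually_elim (rule g(2))
  qed
  have D0: "\<Delta> z0 = g z0"
    using tendsto_Lim[OF _ Fl] zer_Z_circ(1)[of k] by (simp add: \<Delta>_def F_def[abs_def] z0_def)
  show ?thesis
  proof (rule that[of g])
    show "g holomorphic_on ball (zer k) (gap k / 2)" using g(1) by (simp add: U_def z0_def)
    show "((\<lambda>s. f_fun s - p_fun s) \<longlongrightarrow> \<Delta> (zer k)) (at (zer k))"
      using Fl D0 by (simp add: F_def[abs_def] z0_def)
    fix s assume "s \<in> ball (zer k) (gap k / 2)"
    then have s: "s \<in> U" by (simp add: U_def z0_def)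
    show "\<Delta> s = g s"
    proof (cases "s = z0")
      case False
      then have "s \<notin> Z_circ" using not_Z_circ[of s] nz[OF s] ImU[OF s] by simp
      then show ?thesis using g(2)[of s] s False by (simp add: \<Delta>_def F_def)
    qed (simp add: D0)
  qed
qed

text \<open>f and p are odd. At a zero of n the values are limits, and the identity is carried over
  by reflecting the filter at s to the one at - s.\<close>

lemma Delta_minus:
  assumes "Im s > 0"
  shows "\<Delta> (- s) = - \<Delta> s"
proof (cases "n_fun s = 0")
  case False
  then have "n_fun (- s) \<noteq> 0" by (simp add: n_fun_minus)
  then have "- s \<notin> Z_circ" "s \<notin> Z_circ" using not_Z_circ[of s] not_Z_circ[of "- s"] False assms by auto
  then show ?thesis using f_minus_p_minus[OF assms] by (simp add: \<Delta>_def)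
next
  case True
  then obtain k where k: "s = zer k" using zero_imp_zer assms by blast
  obtain g where "((\<lambda>s. f_fun s - p_fun s) \<longlongrightarrow> \<Delta> (zer k)) (at (zer k))"
    using Delta_holomorphic_near_zer by metis
  then have l: "((\<lambda>s. - (f_fun s - p_fun s)) \<longlongrightarrow> - \<Delta> s) (at s)" unfolding k by (rule tendsto_minus)
  have "((\<lambda>w. f_fun (- w) - p_fun (- w)) \<longlongrightarrow> - \<Delta> s) (at s)"
  proof (rule Lim_transform_eventually[OF l])
    have "\<forall>\<^sub>F w in at s. w \<in> {w. Im w > 0}"
      using assms by (intro eventually_at_in_open' open_halfspace_Im_gt) auto
    then show "\<forall>\<^sub>F w in at s. - (f_fun w - p_fun w) = f_fun (- w) - p_fun (- w)"
      by eventually_elim (simp add: f_minus_p_minus)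
  qed
  then have "((\<lambda>w. f_fun w - p_fun w) \<longlongrightarrow> - \<Delta> s) (filtermap uminus (at s))"
    by (simp add: filterlim_filtermap)
  then have "((\<lambda>w. f_fun w - p_fun w) \<longlongrightarrow> - \<Delta> s) (at (- s))" by (simp add: filtermap_at_minus)
  then have "Lim (at (- s)) (\<lambda>w. f_fun w - p_fun w) = - \<Delta> s" by (intro tendsto_Lim) auto
  moreover have "\<Delta> (- s) = Lim (at (- s)) (\<lambda>w. f_fun w - p_fun w)"
    using zer_Z_circ(2)[of k] k by (simp add: \<Delta>_def)
  ultimately show ?thesis by simp
qed

end

section \<open>The limit\<close>

context simple_spaced_zeros
begin

definition rad :: "real \<Rightarrow> nat \<Rightarrow> real" where "rad \<alpha> m = \<alpha> * \<delta>' (int (Suc m))"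

text \<open>Applying ln x <= x to x = t^b gives 1 / ln t >= b t^(-b), so both members of the minimum
  in \<delta>' obey a bound of order t^(-b). The bound of order 1/t used for Phragmen-Lindelof would
  be too weak for the sum of the near terms.\<close>

lemma rad_lower:
  assumes "\<alpha> > 0" "ord m \<ge> 3"
  shows "rad \<alpha> m \<ge> \<alpha> * (K * b * ord m powr (- b))"
proof -
  have b1: "b < 1" using ab by simp
  have p: "ord m powr b > 0" using assms by simp
  have "ln (ord m powr b) \<le> ord m powr b - 1" using p by (rule ln_le_minus_one)
  then have "b * ln (ord m) \<le> ord m powr b" using assms by (simp add: ln_powr)
  moreover have l: "ln (ord m) > 0" using assms by simp
  ultimately have "b / ord m powr b \<le> 1 / ln (ord m)" using p by (simp add: field_simps)
  then have 1: "b * ord m powr (- b) \<le> 1 / ln (ord m)" by (simp add: powr_minus_divide)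
  have "K * (b * ord m powr (- b)) \<le> 1 * (b * ord m powr (- b))" using K ab by (intro mult_right_mono) auto
  with 1 have 2: "K * b * ord m powr (- b) \<le> 1 / ln \<bar>ord m\<bar>" using assms by simp
  have "K * b * ord m powr (- b) \<le> K * 1 * ord m powr (- b)" using K b1 by (intro mult_right_mono mult_left_mono) auto
  also have "\<dots> \<le> gap m" using gap_lower[of m] by simp
  finally have "K * b * ord m powr (- b) \<le> \<delta>' (int (Suc m))" using 2 unfolding \<delta>'_def gap_def ord_eq_gamma by simp
  then show ?thesis using assms unfolding rad_def by (intro mult_left_mono) auto
qed

lemma rad_pos:
  assumes "\<alpha> > 0" "ord m \<ge> 3"
  shows "rad \<alpha> m > 0"
proof -
  have "\<alpha> * (K * b * ord m powr (- b)) > 0" using assms K ab by simp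
  then show ?thesis using rad_lower[OF assms] by linarith
qed

lemma rad_le_gap:
  assumes "\<alpha> > 0"
  shows "rad \<alpha> m \<le> \<alpha> * gap m"
  unfolding rad_def gap_def using assms by (intro mult_left_mono) (auto simp: \<delta>'_def)

lemma rad_le:
  assumes "\<alpha> > 0" "ord m \<ge> 3"
  shows "rad \<alpha> m \<le> \<alpha>"
proof -
  have "exp 1 \<le> (3::real)" by (rule exp_le)
  then have "ln (ord m) \<ge> 1" using assms by (subst ln_ge_iff) auto
  then have "1 / ln \<bar>ord m\<bar> \<le> 1" using assms by simp
  then have "\<delta>' (int (Suc m)) \<le> 1" unfolding \<delta>'_def ord_eq_gamma by simp
  then have "\<alpha> * \<delta>' (int (Suc m)) \<le> \<alpha> * 1" using assms by (intro mult_left_mono) auto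
  then show ?thesis by (simp add: rad_def)
qed

text \<open>Ordinates in a window of length 2 are separated by at least K (t + 1)^(-b). The result
  is expressed through t - 1, the lower end of the window, using t + 1 <= 2 (t - 1).\<close>

lemma card_near_ordinates:
  assumes t: "t \<ge> 3"
  shows "finite {m. \<bar>ord m - t\<bar> \<le> 1}" "real (card {m. \<bar>ord m - t\<bar> \<le> 1}) \<le> (4 / K + 1) * (t - 1) powr b"
proof -
  let ?N = "{m. \<bar>ord m - t\<bar> \<le> 1}"
  define d where "d = K * (t + 1) powr (- b)"
  have d: "d > 0" using K t by (simp add: d_def)
  have inj: "inj_on ord A" for A by (rule inj_onI) (metis ord_less less_irrefl linorder_neqE_nat)
  have sep: "d \<le> \<bar>x - y\<bar>" if xy: "x \<in> ord ` ?N" "y \<in> ord ` ?N" "x \<noteq> y" for x y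
  proof -
    obtain m n where mn: "x = ord m" "y = ord n" "\<bar>ord m - t\<bar> \<le> 1" using xy by auto
    have "(t + 1) powr (- b) \<le> ord m powr (- b)" using mn ord_pos[of m] ab by (intro powr_mono2') auto
    then have "d \<le> K * ord m powr (- b)" using K by (simp add: d_def)
    also have "\<dots> \<le> gap m" using gap_lower[of m] by simp
    also have "\<dots> \<le> \<bar>x - y\<bar>" using gap_le[of m n] mn xy by auto
    finally show ?thesis .
  qed
  have sub: "ord ` ?N \<subseteq> {t - 1..t - 1 + 2}" by auto
  note c = card_separated_le[OF d sep sub]
  show "finite ?N" using finite_imageD[OF c(1) inj] by simp
  have "real (card ?N) = real (card (ord ` ?N))" using card_image[OF inj] by simp
  also have "\<dots> \<le> 2 / d + 1" using c(2) by simp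
  also have "\<dots> \<le> 2 / K * (2 * (t - 1) powr b) + (t - 1) powr b"
  proof (rule add_mono)
    have "(t + 1) powr b \<le> (2 * (t - 1)) powr b" using t ab by (intro powr_mono2) auto
    also have "\<dots> = 2 powr b * (t - 1) powr b" by (rule powr_mult)
    also have "\<dots> \<le> 2 powr 1 * (t - 1) powr b" using ab by (intro mult_right_mono powr_mono) auto
    finally have "(t + 1) powr b \<le> 2 * (t - 1) powr b" by simp
    then have "2 / K * (t + 1) powr b \<le> 2 / K * (2 * (t - 1) powr b)" using K by (intro mult_left_mono) auto
    moreover have "2 / d = 2 / K * (t + 1) powr b" using t by (simp add: d_def powr_minus_divide)
    ultimately show "2 / d \<le> 2 / K * (2 * (t - 1) powr b)" by simp
    show "1 \<le> (t - 1) powr b" using t ab by (intro ge_one_powr_ge_zero) auto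
  qed
  finally show "real (card ?N) \<le> (4 / K + 1) * (t - 1) powr b" by (simp add: distrib_right)
qed

text \<open>
  The terms with ordinate at distance more than 1 are handled by the convergence of
  \<open>\<Sum>|res m|\<close>. For the others the crude bound \<open>t powr (a - 7/4) / rad\<close> on each term suffices, because
  \<open>a + 2 * b < 7/4\<close>.
\<close>
lemma p_i_tendsto_0:
  assumes \<alpha>: "\<alpha> > 0" and e: "e > 0"
  obtains T where "\<And>s. Im s \<ge> T \<Longrightarrow> (\<And>m. rad \<alpha> m \<le> cmod (s - zer m)) \<Longrightarrow> cmod (p_i s) \<le> e"
proof -
  define R where "R = (\<Sum>m. cmod (res m))"
  have R: "R \<ge> 0" unfolding R_def by (intro suminf_nonneg summable_res) auto
  obtain C where C: "C > 0" "\<And>m. ord m \<ge> 1 \<Longrightarrow> cmod (res m) \<le> C * ord m powr (a - 7/4)"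
    using res_bound by metis
  obtain m1 where m1: "norm (\<Sum>m. cmod (res (m + m1))) < e / 4"
    using suminf_exist_split[OF _ summable_res, of "e / 4"] e by auto
  \<comment> \<open>At distance \<open>W\<close> the whole sum of the residues contributes at most e
    / 4. It handles the first \<open>m1\<close> terms, the tail being small already without help
    from the denominators.\<close>
  define W where "W = 4 * (R + 1) / e"
  have W: "W > 0" using R e by (simp add: W_def)
  define C' where "C' = C / (\<alpha> * (K * b))"
  have C': "C' > 0" using C \<alpha> K ab by (simp add: C'_def)
  \<comment> \<open>The exponents add up as follows: b for the number of near terms, b for the
    inverse radius and a - 7/4 for the residue.\<close>
  define \<kappa> where "\<kappa> = a + 2 * b - 7/4"
  have \<kappa>: "\<kappa> < 0" using ab by (simp add: \<kappa>_def)
  have "((\<lambda>t. (4 / K + 1) * C' * (t - 1) powr \<kappa>) \<longlongrightarrow> (4 / K + 1) * C' * 0) at_top"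
    by (intro tendsto_mult tendsto_const tendsto_neg_powr \<kappa>) real_asymp
  then have "\<forall>\<^sub>F t in at_top. (4 / K + 1) * C' * (t - 1) powr \<kappa> < e / 4"
    using e by (intro order_tendstoD(2)) auto
  then obtain T0 where T0: "\<And>t. t \<ge> T0 \<Longrightarrow> (4 / K + 1) * C' * (t - 1) powr \<kappa> < e / 4"
    unfolding eventually_at_top_linorder by blast
  define T where "T = max (max 4 T0) (max (ord m1 + W) W)"
  show ?thesis
  proof (rule that[of T])
    fix s assume sT: "Im s \<ge> T" and out: "\<And>m. rad \<alpha> m \<le> cmod (s - zer m)"
    define t where "t = Im s"
    have t: "t \<ge> 4" "t \<ge> T0" "t \<ge> ord m1 + W" "t \<ge> W" using sT by (auto simp: t_def T_def)
    define N where "N = {m. \<bar>ord m - t\<bar> \<le> 1}"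
    define X where "X = C' * (t - 1) powr (a + b - 7/4)"
    have X: "X \<ge> 0" using C' by (simp add: X_def)
    have N: "finite N" "real (card N) \<le> (4 / K + 1) * (t - 1) powr b"
      using card_near_ordinates[of t] t by (auto simp: N_def)
    \<comment> \<open>\<open>A\<close> majorizes the terms in the window and \<open>D\<close> the
      others. Defined for every index, they allow one summable majorant for the whole
      series.\<close>
    define A where "A m = (if m \<in> N then X else 0)" for m
    define D where "D m = cmod (res m) * (if m < m1 then 1 / W else 1)" for m
    have As: "A sums (real (card N) * X)"
      using sums_If_finite_set[OF N(1), of "\<lambda>_. X"] by (simp add: A_def[abs_def])
    have Ds: "summable D"
    proof (rule summable_comparison_test')
      show "summable (\<lambda>m. cmod (res m) * (1 / W + 1))" by (rule summable_mult2[OF summable_res])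
      show "norm (D m) \<le> cmod (res m) * (1 / W + 1)" for m
        using W by (auto simp: D_def abs_mult distrib_left)
    qed
    have DS: "suminf D \<le> e / 4 + e / 4"
    proof -
      have "suminf D = (\<Sum>m. D (m + m1)) + (\<Sum>m<m1. D m)" by (rule suminf_split_initial_segment[OF Ds])
      also have "(\<Sum>m. D (m + m1)) = (\<Sum>m. cmod (res (m + m1)))" by (simp add: D_def)
      also have "\<dots> \<le> e / 4" using m1 by simp
      also have "(\<Sum>m<m1. D m) = (\<Sum>m<m1. cmod (res m)) / W" by (simp add: D_def sum_divide_distrib)
      also have "\<dots> \<le> R / W" unfolding R_def using W
        by (intro divide_right_mono sum_le_suminf summable_res) auto
      also have "R / W \<le> e / 4" using R e by (simp add: W_def field_simps)
      finally show ?thesis by simp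
    qed
    have near: "cmod (res m) / cmod (s - zer m) \<le> A m + D m" for m
    proof (cases "m \<in> N")
      case True
      then have o: "t - 1 \<le> ord m" "ord m \<ge> 3" using t by (auto simp: N_def)
      have r: "rad \<alpha> m > 0" by (rule rad_pos[OF \<alpha> o(2)])
      have "cmod (res m) / cmod (s - zer m) \<le> cmod (res m) / rad \<alpha> m"
        using out[of m] r by (intro divide_left_mono mult_pos_pos) auto
      also have "\<dots> \<le> (C * ord m powr (a - 7/4)) / (\<alpha> * (K * b * ord m powr (- b)))"
        using C(2)[of m] o rad_lower[OF \<alpha> o(2)] \<alpha> K ab C(1) by (intro frac_le) auto
      also have "\<dots> = C' * (ord m powr (a - 7/4) * ord m powr b)"
        using o by (simp add: C'_def powr_minus_divide)
      also have "ord m powr (a - 7/4) * ord m powr b = ord m powr (a + b - 7/4)"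
        by (simp add: powr_add[symmetric] algebra_simps)
      also have "C' * ord m powr (a + b - 7/4) \<le> X"
        unfolding X_def using C' o t ab by (intro mult_left_mono powr_mono2') auto
      also have "X \<le> A m + D m" using True W by (simp add: A_def D_def)
      finally show ?thesis .
    next
      case False
      have "cmod (res m) / cmod (s - zer m) \<le> D m"
      proof (cases "m < m1")
        case True
        have "W \<le> \<bar>Im s - ord m\<bar>" using t(3) ord_less[OF True] by (simp add: t_def)
        then have "W \<le> cmod (s - zer m)" using norm_minus_zer_ge[of s m] by linarith
        then have "cmod (res m) / cmod (s - zer m) \<le> cmod (res m) / W"
          using W by (intro divide_left_mono mult_pos_pos) auto
        then show ?thesis using True by (simp add: D_def)
      next
        case F: False
        have "1 \<le> \<bar>Im s - ord m\<bar>" using False by (simp add: N_def t_def abs_minus_commute)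
        then have "1 \<le> cmod (s - zer m)" using norm_minus_zer_ge[of s m] by linarith
        then have "cmod (res m) / cmod (s - zer m) \<le> cmod (res m) / 1"
          by (intro divide_left_mono mult_pos_pos) auto
        then show ?thesis using F by (simp add: D_def)
      qed
      then show ?thesis using False by (simp add: A_def)
    qed
    have le: "cmod (p_i_term m s) \<le> (A m + D m) + cmod (res m) / t" for m
      using norm_p_i_term_le[of s m] near[of m] t by (simp add: t_def)
    have sm: "summable (\<lambda>m. (A m + D m) + cmod (res m) / t)"
      by (intro summable_add summable_divide summable_res Ds sums_summable[OF As])
    have "cmod (p_i s) \<le> (\<Sum>m. (A m + D m) + cmod (res m) / t)"
      unfolding p_i_eq by (rule norm_suminf_le[OF le sm])
    also have "\<dots> = (\<Sum>m. A m) + suminf D + R / t"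
      unfolding R_def using sums_summable[OF As] Ds summable_res
      by (simp add: suminf_add[symmetric] suminf_divide[symmetric] summable_add summable_divide)
    also have "(\<Sum>m. A m) = real (card N) * X" using As by (simp add: sums_iff)
    also have "real (card N) * X \<le> (4 / K + 1) * (t - 1) powr b * X" using N(2) X by (rule mult_right_mono)
    also have "\<dots> = (4 / K + 1) * C' * (t - 1) powr \<kappa>"
    proof -
      have "(t - 1) powr b * (t - 1) powr (a + b - 7/4) = (t - 1) powr \<kappa>"
        unfolding powr_add[symmetric] by (simp add: \<kappa>_def algebra_simps)
      then show ?thesis by (simp add: X_def mult_ac)
    qed
    also have "\<dots> \<le> e / 4" using T0[OF t(2)] by simp
    also have "suminf D \<le> e / 4 + e / 4" by (rule DS)
    also have "R / t \<le> e / 4"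
    proof -
      have "R / t \<le> R / W" using R W t by (intro divide_left_mono) auto
      also have "R / W \<le> e / 4" using R e by (simp add: W_def field_simps)
      finally show ?thesis .
    qed
    finally show "cmod (p_i s) \<le> e" by simp
  qed
qed

lemma f_minus_p_tendsto_0:
  assumes \<alpha>: "0 < \<alpha>" "\<alpha> < 1/2" and C1: "C1 \<alpha>" and e: "e > 0"
  obtains T where "T > 0" "\<And>s. Im s \<ge> T \<Longrightarrow> \<bar>Re s\<bar> \<le> 2 \<Longrightarrow> (\<And>m. rad \<alpha> m \<le> cmod (s - zer m)) \<Longrightarrow>
     cmod (f_fun s - p_fun s) \<le> e"
proof -
  have b1: "b < 1" using ab by simp
  obtain B T1 where B: "\<And>s. 0 \<le> Re s \<Longrightarrow> Re s \<le> 2 \<Longrightarrow> Im s \<ge> T1 \<Longrightarrow>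
      (\<And>k. k \<ge> 1 \<Longrightarrow> \<alpha> * \<delta>' k \<le> cmod (s - \<i> * of_real (\<gamma> k))) \<Longrightarrow> cmod (s * f_fun s) \<le> B"
    using f_fun_quadrant_bound[OF RH \<alpha> C1 K ab(2) b1 delta_lower] by blast
  have B': "cmod (s * f_fun s) \<le> B"
    if s: "0 \<le> Re s" "Re s \<le> 2" "Im s \<ge> T1" and out: "\<And>m. rad \<alpha> m \<le> cmod (s - zer m)" for s
  proof (rule B[OF s])
    fix k :: int assume "k \<ge> 1"
    then have "k = int (Suc (nat (k - 1)))" by simp
    then show "\<alpha> * \<delta>' k \<le> cmod (s - \<i> * of_real (\<gamma> k))"
      using out[of "nat (k - 1)"] unfolding rad_def zer_def ord_eq_gamma by metis
  qed
  have B2: "cmod (s * f_fun s) \<le> B"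
    if s: "\<bar>Re s\<bar> \<le> 2" "Im s \<ge> T1" and out: "\<And>m. rad \<alpha> m \<le> cmod (s - zer m)" for s
  proof (cases "Re s \<ge> 0")
    case True
    then show ?thesis using B'[of s] s out by simp
  next
    case False
    \<comment> \<open>The map s -> - cnj s reflects in the imaginary axis and fixes every zero
      there, so it preserves the distances to the discs and swaps the two quadrants.\<close>
    have "- cnj s - zer m = - cnj (s - zer m)" for m by (simp add: zer_def)
    then have d: "cmod (- cnj s - zer m) = cmod (s - zer m)" for m by (simp only: norm_minus_cancel complex_mod_cnj)
    have "f_fun (- cnj s) = - cnj (f_fun s)" by (simp add: f_fun_def n_fun_minus n_fun_cnj)
    then have "cmod (s * f_fun s) = cmod (- cnj s * f_fun (- cnj s))" by (simp add: norm_mult)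
    also have "\<dots> \<le> B" by (rule B') (use False s out d in auto)
    finally show ?thesis .
  qed
  obtain P where P: "P > 0" "\<And>s. Im s > 0 \<Longrightarrow> cmod (p_r s) \<le> P / Im s" using p_r_bound by blast
  have e3: "e / 3 > 0" using e by simp
  obtain T2 where T2: "\<And>s. Im s \<ge> T2 \<Longrightarrow> (\<And>m. rad \<alpha> m \<le> cmod (s - zer m)) \<Longrightarrow> cmod (p_i s) \<le> e / 3"
    using p_i_tendsto_0[OF \<alpha>(1) e3] by blast
  define T where "T = max (max 1 (max T1 T2)) (3 * (\<bar>B\<bar> + P) / e)"
  show ?thesis
  proof (rule that[of T])
    show "T > 0" by (simp add: T_def)
    fix s assume s: "Im s \<ge> T" "\<bar>Re s\<bar> \<le> 2" and out: "\<And>m. rad \<alpha> m \<le> cmod (s - zer m)"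
    have t: "Im s \<ge> 1" "Im s \<ge> T1" "Im s \<ge> T2" "Im s \<ge> 3 * (\<bar>B\<bar> + P) / e" using s by (auto simp: T_def)
    have t': "(\<bar>B\<bar> + P) / Im s \<le> e / 3" using t(1,4) e by (simp add: field_simps)
    have "cmod s * cmod (f_fun s) \<le> \<bar>B\<bar>" using B2[OF s(2) t(2) out] by (simp add: norm_mult)
    moreover have "Im s * cmod (f_fun s) \<le> cmod s * cmod (f_fun s)"
      using abs_Im_le_cmod[of s] by (intro mult_right_mono) auto
    ultimately have "cmod (f_fun s) \<le> \<bar>B\<bar> / Im s" using t(1) by (simp add: pos_le_divide_eq mult.commute)
    moreover have "cmod (p_r s) \<le> P / Im s" using P(2)[of s] t(1) by simp
    moreover have "\<bar>B\<bar> / Im s + P / Im s \<le> e / 3" using t' by (simp only: add_divide_distrib)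
    ultimately have "cmod (f_fun s) + cmod (p_r s) \<le> e / 3" by linarith
    moreover have "cmod (p_i s) \<le> e / 3" by (rule T2[OF t(3) out])
    moreover have "cmod (f_fun s - p_fun s) \<le> cmod (f_fun s) + (cmod (p_r s) + cmod (p_i s))"
      unfolding p_fun_def by (intro order_trans[OF norm_triangle_ineq4] add_left_mono norm_triangle_ineq)
    ultimately show "cmod (f_fun s - p_fun s) \<le> e" using e by linarith
  qed
qed

text \<open>For a point inside a disc the estimate is taken on the bounding circle. With \<alpha> <
  1/2 two radii together do not exceed the distance of the centres, so that circle avoids the
  interiors of all other discs and belongs to the region already treated.\<close>

lemma Delta_tendsto_0_upper:
  assumes \<alpha>: "0 < \<alpha>" "\<alpha> < 1/2" and C1: "C1 \<alpha>" and e: "e > 0"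
  obtains T where "T > 0" "\<And>s. Im s \<ge> T \<Longrightarrow> \<bar>Re s\<bar> \<le> 1/2 \<Longrightarrow> cmod (\<Delta> s) \<le> e"
proof -
  obtain T0 where T0: "T0 > 0" "\<And>s. Im s \<ge> T0 \<Longrightarrow> \<bar>Re s\<bar> \<le> 2 \<Longrightarrow> (\<And>m. rad \<alpha> m \<le> cmod (s - zer m)) \<Longrightarrow>
     cmod (f_fun s - p_fun s) \<le> e"
    using f_minus_p_tendsto_0[OF \<alpha> C1 e] by blast
  have off: "cmod (\<Delta> s) \<le> e"
    if s: "Im s \<ge> T0" "\<bar>Re s\<bar> \<le> 2" "Im s > 6" and out: "\<And>m. rad \<alpha> m \<le> cmod (s - zer m)" for s
  proof -
    have "n_fun s \<noteq> 0"
    proof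
      assume "n_fun s = 0"
      moreover have "Im s > 0" using s by simp
      ultimately obtain m where m: "s = zer m" using zero_imp_zer by blast
      then have "ord m \<ge> 3" using s by (simp add: Im_zer)
      then show False using rad_pos[OF \<alpha>(1)] out[of m] m by fastforce
    qed
    then have "s \<notin> Z_circ" using not_Z_circ[of s] s by simp
    then show ?thesis using T0(2)[OF s(1,2) out] by (simp add: \<Delta>_def)
  qed
  show ?thesis
  \<comment> \<open>The margin 1 is spent in two halves: the centre of the disc is within 1/2 of the
    height of s, and its circle within 1/2 of the height of the centre.\<close>
  proof (rule that[of "max T0 7 + 1"])
    show "max T0 7 + 1 > 0" by simp
    fix s assume s: "Im s \<ge> max T0 7 + 1" "\<bar>Re s\<bar> \<le> 1/2"
    show "cmod (\<Delta> s) \<le> e"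
    proof (cases "\<forall>m. rad \<alpha> m \<le> cmod (s - zer m)")
      case True
      then show ?thesis using off[of s] s by auto
    next
      case False
      then obtain k where k: "cmod (s - zer k) < rad \<alpha> k" by (auto simp: not_le)
      have hg: "rad \<alpha> k < gap k / 2"
      proof -
        have "\<alpha> * gap k < 1/2 * gap k" using \<alpha> gap_pos[of k] by (intro mult_strict_right_mono) auto
        then show ?thesis using rad_le_gap[OF \<alpha>(1), of k] by simp
      qed
      have "\<bar>Im s - ord k\<bar> < ord k" using norm_minus_zer_ge[of s k] k hg gap_le_ord[of k] by linarith
      then have o: "ord k \<ge> 3" using s by linarith
      have r1: "rad \<alpha> k \<le> 1/2" using rad_le[OF \<alpha>(1) o] \<alpha> by simp
      have r0: "rad \<alpha> k > 0" by (rule rad_pos[OF \<alpha>(1) o])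
      obtain g where g: "g holomorphic_on ball (zer k) (gap k / 2)"
        "\<And>w. w \<in> ball (zer k) (gap k / 2) \<Longrightarrow> \<Delta> w = g w"
        using Delta_holomorphic_near_zer by metis
      have sub: "cball (zer k) (rad \<alpha> k) \<subseteq> ball (zer k) (gap k / 2)" using hg by auto
      have ok: "ord k \<ge> max T0 7 + 1/2" using norm_minus_zer_ge[of s k] k r1 s by linarith
      have "cmod (g s) \<le> e"
      proof (rule maximum_modulus_frontier[of g "cball (zer k) (rad \<alpha> k)"])
        show "g holomorphic_on interior (cball (zer k) (rad \<alpha> k))"
          by (rule holomorphic_on_subset[OF g(1)]) (use sub ball_subset_cball in auto)
        show "continuous_on (closure (cball (zer k) (rad \<alpha> k))) g"
          using holomorphic_on_imp_continuous_on[OF holomorphic_on_subset[OF g(1) sub]] by simp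
        show "s \<in> cball (zer k) (rad \<alpha> k)" using k by (simp add: dist_norm norm_minus_commute)
        fix w assume "w \<in> frontier (cball (zer k) (rad \<alpha> k))"
        then have w: "cmod (w - zer k) = rad \<alpha> k" using r0 by (simp add: dist_norm norm_minus_commute)
        then have wb: "w \<in> ball (zer k) (gap k / 2)" using hg by (simp add: dist_norm norm_minus_commute)
        have "\<bar>Im w - ord k\<bar> \<le> 1/2" using norm_minus_zer_ge[of w k] w r1 by linarith
        then have Imw: "Im w \<ge> T0" "Im w > 6"
          using ok max.cobounded1[of T0 7] max.cobounded2[of 7 T0] by linarith+
        have "\<bar>Re w\<bar> \<le> 1/2" using abs_Re_le_cmod[of "w - zer k"] w r1 by (simp add: Re_zer)
        moreover have "rad \<alpha> m \<le> cmod (w - zer m)" for m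
        proof (cases "m = k")
          case True then show ?thesis using w by simp
        next
          case ne: False
          define D where "D = cmod (zer m - zer k)"
          have D: "gap k \<le> D" "gap m \<le> D" using zer_dist[of m k] zer_dist[of k m] ne by (auto simp: D_def norm_minus_commute)
          have "rad \<alpha> m \<le> \<alpha> * D" "rad \<alpha> k \<le> \<alpha> * D"
            using rad_le_gap[OF \<alpha>(1), of m] rad_le_gap[OF \<alpha>(1), of k] D \<alpha> by (auto intro: order_trans mult_left_mono)
          moreover have "\<alpha> * D \<le> 1/2 * D" using \<alpha> D gap_pos[of k] by (intro mult_right_mono) auto
          moreover have "D \<le> cmod (w - zer m) + cmod (w - zer k)"
            unfolding D_def using norm_triangle_ineq4[of "w - zer k" "w - zer m"] by simp
          ultimately show ?thesis using w by linarith
        qed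
        ultimately have "cmod (\<Delta> w) \<le> e" using off[of w] Imw by simp
        then show "cmod (g w) \<le> e" using g(2)[OF wb] by simp
      qed simp
      moreover have "s \<in> ball (zer k) (gap k / 2)" using k hg by (simp add: dist_norm norm_minus_commute)
      ultimately show ?thesis using g(2) by simp
    qed
  qed
qed

end

theorem mainTheorem3:
  assumes "hypothesis_C_hat"
  shows "tends_to_0_uniformly_Im \<Delta> {s. \<bar>Re s\<bar> < 1 / 2}"
proof -
  obtain \<alpha> where \<alpha>: "0 < \<alpha>" "\<alpha> < 1 / 2" and hyps: RH "C1 \<alpha>" C3
    using assms unfolding hypothesis_C_hat_def by blast
  obtain a b K where "a > 0" "b > 0" "a + b < 3/4" "K > 0" "K \<le> 1"
    "\<And>k. k \<ge> 1 \<Longrightarrow> zeta'_abs k > K * \<gamma> k powr (- a)" "\<And>k. k \<ge> 1 \<Longrightarrow> \<delta> k > K * \<gamma> k powr (- b)"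
    using C3_lower_bounds[OF hyps(1,3)] by blast
  then interpret simple_spaced_zeros a b K
    by unfold_locales (use hyps in auto)
  show ?thesis
    unfolding tends_to_0_uniformly_Im_def
  proof (intro allI impI)
    fix e :: real assume "e > 0"
    \<comment> \<open>Halving turns the weak inequality of the preceding estimate into the strict
      one of the definition.\<close>
    then have e: "e / 2 > 0" by simp
    obtain T where T: "T > 0" "\<And>s. Im s \<ge> T \<Longrightarrow> \<bar>Re s\<bar> \<le> 1/2 \<Longrightarrow> cmod (\<Delta> s) \<le> e / 2"
      using Delta_tendsto_0_upper[OF \<alpha> hyps(2) e] by blast
    have "cmod (\<Delta> s) < e" if s: "\<bar>Re s\<bar> < 1 / 2" "\<bar>Im s\<bar> \<ge> T" for s
    proof (cases "Im s > 0")
      case True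
      then show ?thesis using T(2)[of s] s e by simp
    next
      case False
      then have "Im (- s) > 0" using s T by simp
      then have "\<Delta> (- (- s)) = - \<Delta> (- s)" by (rule Delta_minus)
      then show ?thesis using T(2)[of "- s"] s False e by simp
    qed
    then show "\<exists>R. \<forall>s\<in>{s. \<bar>Re s\<bar> < 1 / 2}. R \<le> \<bar>Im s\<bar> \<longrightarrow> cmod (\<Delta> s) < e" by blast
  qed
qed

end
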